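(* Let $\mathbb{K}$ be a division ring and let $\Gamma(\mathbb{K})$ be one of the following point-line geometries: $\mathrm{Gr}_{1,n}(A_n(\mathbb{K}))$ with $n\geq 3$; $\mathrm{Gr}_{+,-}(D_n(\mathbb{K}))$ with $n\geq 3$; $\mathrm{Gr}_{1,+,-}(D_n(\mathbb{K}))$ with $n\geq 4$; $\mathrm{Gr}_{1,-}(D_n(\mathbb{K}))$ with $n\geq 4$ (in the three $D_n$ cases $\mathbb{K}$ is a field). Then for every proper sub-division ring $\mathbb{K}_0$ of $\mathbb{K}$, $\Gamma(\mathbb{K})$ is not $\mathbb{K}_0$-generated.
   Context: Building $A_n(\mathbb{K})$: let $V$ be a right vector space of dimension $n+1$ over the division ring $\mathbb{K}$ with a fixed basis $E$. The elements of $A_n(\mathbb{K})$ are the subspaces of $V$ of dimension $1,\dots,n$, the type of an element being its dimension; incidence is symmetrized inclusion. The diagram $A_n$ is the path $1-2-\cdots-n$. Building $D_n(\mathbb{K})$ ($\mathbb{K}$ a field, $n\ge 3$): let $V$ be a $2n$-dimensional vector space over $\mathbb{K}$ with basis $E=(e_1,\dots,e_{2n})$ and quadratic form $q(x_1,\dots,x_{2n})=x_1x_2+x_3x_4+\dots+x_{2n-1}x_{2n}$ (coordinates w.r.t. $E$). The $n$-dimensional totally singular subspaces split into two classes $\mathfrak S^+,\mathfrak S^-$, where $X,Y$ are in the same class iff $X\cap Y$ has even codimension in $X$. The elements of $D_n(\mathbb{K})$ are the totally singular subspaces of dimension $i\in\{1,\dots,n-2\}$ (type $i$) and the members of $\mathfrak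 S^+$ (type $+$) and $\mathfrak S^-$ (type $-$). Incidence is symmetrized inclusion, except that $X\in\mathfrak S^+$ and $Y\in\mathfrak S^-$ are incident iff $\dim(X\cap Y)=n-1$. The diagram $D_n$ has the path $1-2-\cdots-(n-2)$ with $n-2$ adjacent to both $+$ and $-$ (for $n=3$, node $1$ is adjacent to $+$ and $-$). A flag is a set of pairwise incident elements; its type is the set of types of its elements. For a nonempty set $J$ of types, the $J$-Grassmannian $\mathrm{Gr}_J$ is the point-line geometry whose points are the flags of type $J$ and whose lines are the flags of type $(J\setminus\{j\})\cup\mathrm{fr}(j)$ for $j\in J$, where $\mathrm{fr}(j)$ is the set of nodes adjacent to $j$ in the diagram; a point and a line are incident iff their union is a flag. Rationality: for a sub-division ring $\mathbb{K}_0$ of $\mathbb{K}$, a vector is $\mathbb{K}_0$-rational if it is a $\mathbb{K}_0$-linear combination of $E$; a subspace is $\mathbb{K}_0$-rational if it has a basis of $\mathbb{K}_0$-rational vectors; a flag (hence a point or line of a Grassmannian) is $\mathbb{K}_0$-rational if all its elements are. The $\mathbb{K}_0$-rational points and lines form a subgeometry identified with $\mathrm{Gr}_J(X_n(\mathbb{K}_0))$. A subspace of a point-line geometry is a set of points containing all points of every line meeting it in at least two points; $\Gamma(\mathbb{K})$ is $\mathbb{K}_0$-generated if the smallest subspace containing all $\mathbb{K}_0$-rational points is the whole point set. *)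

theory Defs
  imports Complex_Main
begin

section \<open>Geometries over a diagram and their Grassmannians\<close>

record ('x, 't) diagram_geometry =
  elements :: "'x set"
  type_of :: "'x \<Rightarrow> 't"
  incident :: "'x \<Rightarrow> 'x \<Rightarrow> bool"
  adjacent :: "'t \<Rightarrow> 't \<Rightarrow> bool"

definition flag :: "('x, 't) diagram_geometry \<Rightarrow> 'x set \<Rightarrow> bool" where
  "flag G F \<longleftrightarrow> F \<subseteq> elements G \<and> pairwise (incident G) F"

definition flags_of_type :: "('x, 't) diagram_geometry \<Rightarrow> 't set \<Rightarrow> 'x set set" where
  "flags_of_type G J = {F. flag G F \<and> type_of G ` F = J}"

definition fr :: "('x, 't) diagram_geometry \<Rightarrow> 't \<Rightarrow> 't set" where
  "fr G j = {i. adjacent G j i}"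

definition gr_points :: "('x, 't) diagram_geometry \<Rightarrow> 't set \<Rightarrow> 'x set set" where
  "gr_points G J = flags_of_type G J"

definition gr_lines :: "('x, 't) diagram_geometry \<Rightarrow> 't set \<Rightarrow> 'x set set" where
  "gr_lines G J = (\<Union>j\<in>J. flags_of_type G ((J - {j}) \<union> fr G j))"

definition gr_incident :: "('x, 't) diagram_geometry \<Rightarrow> 'x set \<Rightarrow> 'x set \<Rightarrow> bool" where
  "gr_incident G P L \<longleftrightarrow> flag G (P \<union> L)"

definition gr_subspace :: "('x, 't) diagram_geometry \<Rightarrow> 't set \<Rightarrow> 'x set set \<Rightarrow> bool" where
  "gr_subspace G J S \<longleftrightarrow> S \<subseteq> gr_points G J \<and>
     (\<forall>L \<in> gr_lines G J.
        (\<exists>P\<in>S. \<exists>Q\<in>S. P \<noteq> Q \<and> gr_incident G P L \<and> gr_incident G Q L) \<longrightarrow>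
        {P \<in> gr_points G J. gr_incident G P L} \<subseteq> S)"

section \<open>Right vector spaces over division rings\<close>

definition sub_division_ring :: "'k::division_ring set \<Rightarrow> bool" where
  "sub_division_ring R \<longleftrightarrow> 1 \<in> R \<and>
     (\<forall>x\<in>R. \<forall>y\<in>R. x - y \<in> R \<and> x * y \<in> R) \<and> (\<forall>x\<in>R. inverse x \<in> R)"

text \<open>The library's modules and vector spaces have commutative scalars. The following
  notions are those of the library, transferred to right vector spaces over a division
  ring; the vector space \<open>V\<close> is the whole type \<open>'v\<close>.\<close>

locale right_vector_space =
  fixes scale :: "'v::ab_group_add \<Rightarrow> 'k::division_ring \<Rightarrow> 'v" (infixl "\<cdot>" 75)
  assumes scale_left_distrib: "(x + y) \<cdot> a = x \<cdot> a + y \<cdot> a"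
    and scale_right_distrib: "x \<cdot> (a + b) = x \<cdot> a + x \<cdot> b"
    and scale_scale: "(x \<cdot> a) \<cdot> b = x \<cdot> (a * b)"
    and scale_one: "x \<cdot> 1 = x"
begin

definition subspace :: "'v set \<Rightarrow> bool" where
  "subspace U \<longleftrightarrow> 0 \<in> U \<and> (\<forall>x\<in>U. \<forall>y\<in>U. x + y \<in> U) \<and> (\<forall>x\<in>U. \<forall>a. x \<cdot> a \<in> U)"

definition span :: "'v set \<Rightarrow> 'v set" where
  "span B = subspace hull B"

definition independent :: "'v set \<Rightarrow> bool" where
  "independent B \<longleftrightarrow>
     (\<forall>S c. finite S \<and> S \<subseteq> B \<and> (\<Sum>v\<in>S. v \<cdot> c v) = 0 \<longrightarrow> (\<forall>v\<in>S. c v = 0))"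

definition basis_of :: "'v set \<Rightarrow> 'v set \<Rightarrow> bool" where
  "basis_of U B \<longleftrightarrow> independent B \<and> span B = U"

definition dim :: "'v set \<Rightarrow> nat" where
  "dim U = card (SOME B. basis_of U B)"

definition indexed_basis :: "(nat \<Rightarrow> 'v) \<Rightarrow> nat \<Rightarrow> bool" where
  "indexed_basis E d \<longleftrightarrow> inj_on E {1..d} \<and> basis_of UNIV (E ` {1..d})"

subsection \<open>Rationality with respect to the basis \<open>E 1, \<dots>, E d\<close>\<close>

definition rational_vector :: "(nat \<Rightarrow> 'v) \<Rightarrow> nat \<Rightarrow> 'k set \<Rightarrow> 'v \<Rightarrow> bool" where
  "rational_vector E d K0 v \<longleftrightarrow>
     (\<exists>a. (\<forall>i\<in>{1..d}. a i \<in> K0) \<and> v = (\<Sum>i=1..d. E i \<cdot> a i))"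

definition rational_subspace :: "(nat \<Rightarrow> 'v) \<Rightarrow> nat \<Rightarrow> 'k set \<Rightarrow> 'v set \<Rightarrow> bool" where
  "rational_subspace E d K0 U \<longleftrightarrow>
     (\<exists>B. basis_of U B \<and> (\<forall>v\<in>B. rational_vector E d K0 v))"

definition rational_points ::
  "(nat \<Rightarrow> 'v) \<Rightarrow> nat \<Rightarrow> 'k set \<Rightarrow> ('v set, 't) diagram_geometry \<Rightarrow> 't set \<Rightarrow> 'v set set set" where
  "rational_points E d K0 G J = {P \<in> gr_points G J. \<forall>U\<in>P. rational_subspace E d K0 U}"

definition rationally_generated ::
  "(nat \<Rightarrow> 'v) \<Rightarrow> nat \<Rightarrow> 'k set \<Rightarrow> ('v set, 't) diagram_geometry \<Rightarrow> 't set \<Rightarrow> bool" where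
  "rationally_generated E d K0 G J \<longleftrightarrow>
     gr_subspace G J hull rational_points E d K0 G J = gr_points G J"

end

section \<open>The buildings\<close>

text \<open>For \<open>dim V = n + 1\<close>.\<close>

definition (in right_vector_space) A_building :: "nat \<Rightarrow> ('v set, nat) diagram_geometry" where
  "A_building n =
     \<lparr>elements = {U. subspace U \<and> dim U \<in> {1..n}},
      type_of = dim,
      incident = (\<lambda>X Y. X \<subseteq> Y \<or> Y \<subseteq> X),
      adjacent = (\<lambda>i j. i \<in> {1..n} \<and> j \<in> {1..n} \<and> (j = i + 1 \<or> i = j + 1))\<rparr>"

datatype D_node = Node nat | Plus | Minus

fun D_edge :: "nat \<Rightarrow> D_node \<Rightarrow> D_node \<Rightarrow> bool" where
  "D_edge n (Node i) (Node j) \<longleftrightarrow>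
     i \<in> {1..n - 2} \<and> j \<in> {1..n - 2} \<and> (j = i + 1 \<or> i = j + 1)"
| "D_edge n (Node i) Plus \<longleftrightarrow> i = n - 2"
| "D_edge n (Node i) Minus \<longleftrightarrow> i = n - 2"
| "D_edge n Plus (Node i) \<longleftrightarrow> i = n - 2"
| "D_edge n Minus (Node i) \<longleftrightarrow> i = n - 2"
| "D_edge n _ _ \<longleftrightarrow> False"

context right_vector_space
begin

definition coord :: "(nat \<Rightarrow> 'v) \<Rightarrow> nat \<Rightarrow> 'v \<Rightarrow> nat \<Rightarrow> 'k" where
  "coord E d v = (THE x. (\<forall>i. i \<notin> {1..d} \<longrightarrow> x i = 0) \<and> v = (\<Sum>i=1..d. E i \<cdot> x i))"

definition quad_form :: "(nat \<Rightarrow> 'v) \<Rightarrow> nat \<Rightarrow> 'v \<Rightarrow> 'k" where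
  "quad_form E n v =
     (\<Sum>i=1..n. coord E (2 * n) v (2 * i - 1) * coord E (2 * n) v (2 * i))"

definition totally_singular :: "(nat \<Rightarrow> 'v) \<Rightarrow> nat \<Rightarrow> 'v set \<Rightarrow> bool" where
  "totally_singular E n U \<longleftrightarrow> subspace U \<and> (\<forall>v\<in>U. quad_form E n v = 0)"

definition max_singular :: "(nat \<Rightarrow> 'v) \<Rightarrow> nat \<Rightarrow> 'v set set" where
  "max_singular E n = {U. totally_singular E n U \<and> dim U = n}"

definition same_class :: "'v set \<Rightarrow> 'v set \<Rightarrow> bool" where
  "same_class X Y \<longleftrightarrow> even (dim X - dim (X \<inter> Y))"

text \<open>Nothing distinguishes the two classes of \<open>n\<close>-dimensional totally singular subspaces,
  so which of them is called \<open>S\<^sup>+\<close> is a choice. It is recorded by a member \<open>M\<close> of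
  \<open>S\<^sup>+\<close>; letting \<open>M\<close> range over \<open>max_singular E n\<close> covers both choices.\<close>

definition plus_class :: "(nat \<Rightarrow> 'v) \<Rightarrow> nat \<Rightarrow> 'v set \<Rightarrow> 'v set set" where
  "plus_class E n M = {X \<in> max_singular E n. same_class X M}"

definition minus_class :: "(nat \<Rightarrow> 'v) \<Rightarrow> nat \<Rightarrow> 'v set \<Rightarrow> 'v set set" where
  "minus_class E n M = {X \<in> max_singular E n. \<not> same_class X M}"

text \<open>For commutative scalars and \<open>dim V = 2 * n\<close>.\<close>

definition D_building ::
  "(nat \<Rightarrow> 'v) \<Rightarrow> nat \<Rightarrow> 'v set \<Rightarrow> ('v set, D_node) diagram_geometry" where
  "D_building E n M =
     (let Sp = plus_class E n M; Sm = minus_class E n M in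
      \<lparr>elements = {U. totally_singular E n U \<and> dim U \<in> {1..n - 2}} \<union> Sp \<union> Sm,
       type_of = (\<lambda>U. if U \<in> Sp then Plus else if U \<in> Sm then Minus else Node (dim U)),
       incident = (\<lambda>X Y.
         if X \<in> Sp \<and> Y \<in> Sm \<or> X \<in> Sm \<and> Y \<in> Sp then dim (X \<inter> Y) = n - 1
         else X \<subseteq> Y \<or> Y \<subseteq> X),
       adjacent = D_edge n\<rparr>)"

end

end

theory Submission
  imports Defs "HOL-Library.Function_Algebras"
begin

text \<open>Let \<open>f\<close> range over the left \<open>K0\<close>-linear maps of \<open>K\<close> to itself, applied to coordinates. A
  rational subspace is stable under all of them, while for \<open>a \<notin> K0\<close> some \<open>f\<close> maps \<open>1\<close> to \<open>0\<close> and
  \<open>a\<close> to \<open>1\<close>. If a Grassmannian has points \<open>p\<close> and hyperplanes (or maximal singular subspaces) \<open>H\<close>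
  with \<open>p \<subseteq> H\<close> in its flags, the flags with \<open>f p \<subseteq> H\<close> for all \<open>f\<close> form a subspace: \<open>f\<close> is
  additive, and two distinct \<open>H\<close> in a pencil meet in its base. It contains the rational flags and misses
  a suitable flag whose point is spanned by a vector with coordinates \<open>1\<close> and \<open>a\<close>.

  For flags \<open>(X, Y)\<close> of type \<open>{+,-}\<close> the same works after replacing \<open>X\<close> and \<open>Y\<close> by their pure
  spinors. Along a pencil the pure spinors are linear combinations of two of them, and incidence implies
  the vanishing of a bilinear form, the matching of the two half-spin modules of a nondegenerate
  \<open>6\<close>-dimensional section. The subspace consists of the flags for which that form vanishes on
  \<open>(f s, t)\<close> for all \<open>f\<close> and all spinors \<open>s\<close> of \<open>X\<close> and \<open>t\<close> of \<open>Y\<close>.\<close>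

section \<open>Linear algebra in right vector spaces\<close>

text \<open>The condition ranges over all forms at once: a single \<open>f\<close> does not respect
  the scalars of \<open>V\<close>, but replacing \<open>x\<close> by \<open>x * a\<close> inside
  \<open>f\<close> gives another left linear form, so the family of all forms does. Rational vectors
  cause no trouble because \<open>f k = k * f 1\<close> for \<open>k\<close> in \<open>K0\<close>.
  For flags of type {+,-} the obstacle is that incidence of \<open>X\<close> and \<open>Y\<close> is
  no inclusion, and \<open>dim (X \<inter> Y) = n - 1\<close> is not a linear condition on either
  space, so there is no target space into which \<open>f\<close> could be required to map the
  vectors of \<open>X\<close>. Spinors supply the linearity. The model is \<open>n = 3\<close>: D_3
  is A_3, the half-spin modules are a 4-dimensional space and its dual, and up to sign the bilinear
  form evaluates hyperplanes on points, as in type A. For larger \<open>n\<close> the form reads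
  only coefficients at monomials divisible by e_4 ... e_n, which carries the same matching to every
  rank. Division by 2 is avoided throughout: the quadratic form, its polar form and the Clifford
  relations are treated separately, so that characteristic 2 is covered.\<close>

declare One_nat_def [simp del]

context right_vector_space
begin

lemma scale_zero_right [simp]: "x \<cdot> 0 = 0"
  using scale_right_distrib[of x 0 0] by simp

lemma scale_zero_left [simp]: "0 \<cdot> a = 0"
  using scale_left_distrib[of 0 0 a] by simp

lemma scale_minus_right: "x \<cdot> (- a) = - (x \<cdot> a)"
  using scale_right_distrib[of x a "- a"] by (simp add: eq_neg_iff_add_eq_0 add.commute)

lemma scale_sum_left: "(\<Sum>i\<in>I. g i) \<cdot> a = (\<Sum>i\<in>I. g i \<cdot> a)"
  by (induction I rule: infinite_finite_induct) (auto simp: scale_left_distrib)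

lemma subspace_0: "subspace U \<Longrightarrow> 0 \<in> U"
  and subspace_add: "subspace U \<Longrightarrow> x \<in> U \<Longrightarrow> y \<in> U \<Longrightarrow> x + y \<in> U"
  and subspace_scale: "subspace U \<Longrightarrow> x \<in> U \<Longrightarrow> x \<cdot> a \<in> U"
  by (auto simp: subspace_def)

lemma subspace_neg: "subspace U \<Longrightarrow> x \<in> U \<Longrightarrow> - x \<in> U"
  using subspace_scale[of U x "- 1"] by (simp add: scale_minus_right scale_one)

lemma subspace_diff: "subspace U \<Longrightarrow> x \<in> U \<Longrightarrow> y \<in> U \<Longrightarrow> x - y \<in> U"
  using subspace_add[of U x "- y"] subspace_neg by simp

lemma subspace_sum: "subspace U \<Longrightarrow> (\<And>i. i \<in> I \<Longrightarrow> g i \<in> U) \<Longrightarrow> (\<Sum>i\<in>I. g i) \<in> U"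
  by (induction I rule: infinite_finite_induct) (auto simp: subspace_0 subspace_add)

lemma subspace_Int: "subspace U \<Longrightarrow> subspace W \<Longrightarrow> subspace (U \<inter> W)"
  by (auto simp: subspace_def)

lemma subspace_UNIV: "subspace UNIV"
  by (auto simp: subspace_def)

lemma subspace_span: "subspace (span B)"
  unfolding span_def hull_def by (auto simp: subspace_def)

lemma span_superset: "B \<subseteq> span B"
  unfolding span_def by (rule hull_subset)

lemma span_base: "x \<in> B \<Longrightarrow> x \<in> span B"
  using span_superset by auto

lemma span_minimal: "B \<subseteq> U \<Longrightarrow> subspace U \<Longrightarrow> span B \<subseteq> U"
  unfolding span_def by (rule hull_minimal)

lemma span_mono: "B \<subseteq> C \<Longrightarrow> span B \<subseteq> span C"
  unfolding span_def by (rule hull_mono)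

lemma span_subspace: "subspace U \<Longrightarrow> span U = U"
  using span_minimal[of U U] span_superset[of U] by auto

lemma span_subset_span: "B \<subseteq> span C \<Longrightarrow> span B \<subseteq> span C"
  by (rule span_minimal[OF _ subspace_span])

lemma span_insert: "span (insert x B) = {u + x \<cdot> a | u a. u \<in> span B}"
proof
  have "subspace {u + x \<cdot> a | u a. u \<in> span B}"
    unfolding subspace_def
  proof (intro conjI ballI allI)
    show "0 \<in> {u + x \<cdot> a |u a. u \<in> span B}"
      using subspace_0[OF subspace_span] by (force intro: exI[of _ 0])
  next
    fix y z assume "y \<in> {u + x \<cdot> a |u a. u \<in> span B}" "z \<in> {u + x \<cdot> a |u a. u \<in> span B}"
    then obtain u a u' a' where "y = u + x \<cdot> a" "z = u' + x \<cdot> a'" "u \<in> span B" "u' \<in> span B"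
      by blast
    then have "y + z = (u + u') + x \<cdot> (a + a') \<and> u + u' \<in> span B"
      by (simp add: scale_right_distrib subspace_add subspace_span)
    then show "y + z \<in> {u + x \<cdot> a |u a. u \<in> span B}" by blast
  next
    fix y b assume "y \<in> {u + x \<cdot> a |u a. u \<in> span B}"
    then obtain u a where "y = u + x \<cdot> a" "u \<in> span B" by blast
    then have "y \<cdot> b = u \<cdot> b + x \<cdot> (a * b) \<and> u \<cdot> b \<in> span B"
      by (simp add: scale_left_distrib scale_scale subspace_scale subspace_span)
    then show "y \<cdot> b \<in> {u + x \<cdot> a |u a. u \<in> span B}" by blast
  qed
  moreover have "insert x B \<subseteq> {u + x \<cdot> a | u a. u \<in> span B}"
  proof
    fix y assume "y \<in> insert x B"
    then have "y = 0 + x \<cdot> 1 \<or> y = y + x \<cdot> 0 \<and> y \<in> span B"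
      using span_superset by (auto simp: scale_one)
    then show "y \<in> {u + x \<cdot> a | u a. u \<in> span B}"
      using subspace_0[OF subspace_span] by blast
  qed
  ultimately show "span (insert x B) \<subseteq> {u + x \<cdot> a | u a. u \<in> span B}"
    by (rule span_minimal[rotated])
  show "{u + x \<cdot> a | u a. u \<in> span B} \<subseteq> span (insert x B)"
    using span_mono[of B "insert x B"] span_base[of x "insert x B"]
    by (auto intro!: subspace_add[OF subspace_span] subspace_scale[OF subspace_span])
qed

lemma span_empty: "span {} = {0}"
  using span_minimal[of "{}" "{0}"] subspace_0[OF subspace_span, of "{}"]
  by (auto simp: subspace_def)

lemma span_finite_subset:
  assumes "x \<in> span B"
  obtains S where "finite S" "S \<subseteq> B" "x \<in> span S"
proof -
  let ?U = "{x. \<exists>S. finite S \<and> S \<subseteq> B \<and> x \<in> span S}"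
  have "subspace ?U"
    unfolding subspace_def
  proof (intro conjI ballI allI)
    show "0 \<in> ?U" using subspace_0[OF subspace_span, of "{}"] by auto
  next
    fix x y assume "x \<in> ?U" "y \<in> ?U"
    then obtain S T where ST: "finite S" "S \<subseteq> B" "x \<in> span S" "finite T" "T \<subseteq> B" "y \<in> span T"
      by auto
    then have "x + y \<in> span (S \<union> T)"
      using span_mono[of S "S \<union> T"] span_mono[of T "S \<union> T"]
      by (auto intro: subspace_add[OF subspace_span])
    with ST show "x + y \<in> ?U" by (auto intro!: exI[of _ "S \<union> T"])
  next
    fix x a assume "x \<in> ?U"
    then show "x \<cdot> a \<in> ?U" using subspace_scale[OF subspace_span] by blast
  qed
  moreover have "B \<subseteq> ?U"
  proof
    fix x assume "x \<in> B"
    then show "x \<in> ?U" using span_base[of x "{x}"] by (auto intro!: exI[of _ "{x}"])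
  qed
  ultimately have "span B \<subseteq> ?U" by (rule span_minimal[rotated])
  then show ?thesis using assms that by blast
qed

lemma independent_subset: "independent B \<Longrightarrow> C \<subseteq> B \<Longrightarrow> independent C"
  unfolding independent_def by blast

lemma independent_empty: "independent {}"
  unfolding independent_def by auto

lemma span_finite: "finite S \<Longrightarrow> span S = range (\<lambda>c. \<Sum>v\<in>S. v \<cdot> c v)"
proof (induction S rule: finite_induct)
  case empty
  then show ?case by (auto simp: span_empty)
next
  case (insert x S)
  have "u + x \<cdot> a \<in> range (\<lambda>c. \<Sum>v\<in>insert x S. v \<cdot> c v)" if "u \<in> span S" for u a
  proof -
    from that insert.IH obtain c where "u = (\<Sum>v\<in>S. v \<cdot> c v)" by blast
    then have "u + x \<cdot> a = (\<Sum>v\<in>insert x S. v \<cdot> (c(x := a)) v)"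
      using insert.hyps by (auto simp: add.commute intro!: sum.cong)
    then show ?thesis by blast
  qed
  moreover have "(\<Sum>v\<in>insert x S. v \<cdot> c v) \<in> {u + x \<cdot> a | u a. u \<in> span S}" for c
    using insert by (simp add: add.commute[of "x \<cdot> _"]) blast
  ultimately show ?case unfolding span_insert by blast
qed

lemma independent_notin_span:
  assumes "independent B" "x \<in> B"
  shows "x \<notin> span (B - {x})"
proof
  assume "x \<in> span (B - {x})"
  then obtain S where S: "finite S" "S \<subseteq> B - {x}" "x \<in> span S" by (rule span_finite_subset)
  then obtain c where c: "x = (\<Sum>v\<in>S. v \<cdot> c v)" using span_finite by blast
  have xS: "x \<notin> S" using S by auto
  have "(\<Sum>v\<in>S. v \<cdot> (c(x := - 1)) v) = (\<Sum>v\<in>S. v \<cdot> c v)"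
    using xS by (auto intro!: sum.cong)
  then have "(\<Sum>v\<in>insert x S. v \<cdot> (c(x := - 1)) v) = 0"
    using S xS c by (simp add: scale_minus_right scale_one)
  moreover have "finite (insert x S)" "insert x S \<subseteq> B" using S assms by auto
  ultimately have "\<forall>v\<in>insert x S. (c(x := - 1)) v = 0"
    using assms(1) unfolding independent_def by blast
  then show False by simp
qed

lemma independent_insert:
  assumes "independent B" "x \<notin> span B"
  shows "independent (insert x B)"
  unfolding independent_def
proof (intro allI impI)
  fix S c assume S: "finite S \<and> S \<subseteq> insert x B \<and> (\<Sum>v\<in>S. v \<cdot> c v) = 0"
  show "\<forall>v\<in>S. c v = 0"
  proof (cases "x \<in> S")
    case False
    then have "S \<subseteq> B" using S by auto
    then show ?thesis using assms(1) S unfolding independent_def by blast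
  next
    case True
    let ?T = "S - {x}"
    have T: "finite ?T" "?T \<subseteq> B" using S by auto
    have eq: "x \<cdot> c x + (\<Sum>v\<in>?T. v \<cdot> c v) = 0"
      using S True sum.remove[of S x "\<lambda>v. v \<cdot> c v"] by simp
    have cx: "c x = 0"
    proof (rule ccontr)
      assume nz: "c x \<noteq> 0"
      have "x \<cdot> c x = - (\<Sum>v\<in>?T. v \<cdot> c v)" using eq by (simp add: eq_neg_iff_add_eq_0)
      moreover have "(\<Sum>v\<in>?T. v \<cdot> c v) \<in> span B"
        using T by (intro subspace_sum[OF subspace_span] subspace_scale[OF subspace_span] span_base) auto
      ultimately have "x \<cdot> c x \<in> span B" using subspace_neg[OF subspace_span] by simp
      then have "x \<cdot> c x \<cdot> inverse (c x) \<in> span B" by (rule subspace_scale[OF subspace_span])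
      then show False using nz assms(2) by (simp add: scale_scale scale_one)
    qed
    then have "(\<Sum>v\<in>?T. v \<cdot> c v) = 0" using eq by simp
    then have "\<forall>v\<in>?T. c v = 0" using T assms(1) unfolding independent_def by blast
    then show ?thesis using cx by auto
  qed
qed

text \<open>Elements are dropped from \<open>D\<close> one at a time. The first one whose removal
  takes \<open>b\<close> out of the span has a nonzero coefficient in \<open>b\<close>, and the
  equation can be solved for it.\<close>

lemma span_exchange_element:
  assumes "finite D" "b \<in> span (B \<union> D)" "b \<notin> span B"
  shows "\<exists>d\<in>D. d \<in> span (insert b (B \<union> (D - {d})))"
  using assms
proof (induction D rule: finite_induct)
  case empty
  then show ?case by simp
next
  case (insert d D)
  show ?case
  proof (cases "b \<in> span (B \<union> D)")
    case True
    then obtain d' where "d' \<in> D" "d' \<in> span (insert b (B \<union> (D - {d'})))"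
      using insert by blast
    moreover have "span (insert b (B \<union> (D - {d'}))) \<subseteq> span (insert b (B \<union> (insert d D - {d'})))"
      by (rule span_mono) auto
    ultimately show ?thesis by blast
  next
    case False
    have "b \<in> span (insert d (B \<union> D))" using insert.prems by simp
    then obtain u a where ua: "b = u + d \<cdot> a" "u \<in> span (B \<union> D)" unfolding span_insert by blast
    have "a \<noteq> 0" using ua False by auto
    then have "d = (b - u) \<cdot> inverse a" by (simp add: ua scale_scale scale_one)
    moreover have "b - u \<in> span (insert b (B \<union> D))"
    proof (rule subspace_diff[OF subspace_span])
      show "u \<in> span (insert b (B \<union> D))"
        using ua(2) span_mono[of "B \<union> D" "insert b (B \<union> D)"] by blast
    qed (simp add: span_base)
    ultimately have "d \<in> span (insert b (B \<union> D))" using subspace_scale[OF subspace_span] by simp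
    then show ?thesis using insert.hyps by simp
  qed
qed

text \<open>Each \<open>b\<close> in turn replaces an element \<open>d\<close> of \<open>C\<close>
  given by \<open>span_exchange_element\<close>; independence keeps \<open>b\<close> out of the span
  of its predecessors.\<close>

lemma steinitz_exchange:
  assumes "finite B" "finite C" "independent B" "B \<subseteq> span C"
  shows "\<exists>D\<subseteq>C. card D + card B = card C \<and> C \<subseteq> span (B \<union> D)"
  using assms
proof (induction B rule: finite_induct)
  case empty
  then show ?case using span_superset by auto
next
  case (insert b B)
  have "independent B" using insert.prems independent_subset by blast
  then obtain D where D: "D \<subseteq> C" "card D + card B = card C" "C \<subseteq> span (B \<union> D)"
    using insert by auto
  have "b \<in> span (B \<union> D)" using insert.prems D(3) span_subset_span by blast
  moreover have "b \<notin> span B"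
    using independent_notin_span[OF insert.prems(2), of b] insert.hyps by simp
  moreover have finD: "finite D" using D insert.prems finite_subset by blast
  ultimately obtain d where d: "d \<in> D" "d \<in> span (insert b (B \<union> (D - {d})))"
    using span_exchange_element by blast
  have "B \<union> D \<subseteq> span (insert b B \<union> (D - {d}))"
    using d span_superset[of "insert b B \<union> (D - {d})"] by auto
  then have "C \<subseteq> span (insert b B \<union> (D - {d}))"
    using D(3) span_subset_span by blast
  moreover have "card (D - {d}) + card (insert b B) = card C"
    using D(2) d(1) finD insert.hyps card_Suc_Diff1[OF finD d(1)] by simp
  ultimately show ?case using D(1) by (intro exI[of _ "D - {d}"]) auto
qed

lemma independent_card_le:
  assumes "finite C" "independent B" "B \<subseteq> span C"
  shows "finite B \<and> card B \<le> card C"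
proof -
  have fin: "card S \<le> card C" if "finite S" "S \<subseteq> B" for S
    using steinitz_exchange[of S C] independent_subset that assms by fastforce
  moreover have "finite B"
  proof (rule ccontr)
    assume "infinite B"
    then obtain S where "finite S" "card S = Suc (card C)" "S \<subseteq> B"
      using infinite_arbitrarily_large by blast
    then show False using fin by fastforce
  qed
  ultimately show ?thesis by blast
qed

end

section \<open>Dimension, linear forms and coordinates\<close>

locale fin_dim_rvs = right_vector_space scale
  for scale :: "'v::ab_group_add \<Rightarrow> 'k::division_ring \<Rightarrow> 'v" (infixl "\<cdot>" 75) +
  fixes E :: "nat \<Rightarrow> 'v" and d :: nat
  assumes E_basis: "indexed_basis E d"
begin

lemma inj_E: "inj_on E {1..d}" and independent_E: "independent (E ` {1..d})"
  and span_E: "span (E ` {1..d}) = UNIV"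
  using E_basis by (auto simp: indexed_basis_def basis_of_def)

lemma independent_bound: "independent B \<Longrightarrow> finite B \<and> card B \<le> d"
  using independent_card_le[of "E ` {1..d}" B] span_E card_image[OF inj_E] by simp

text \<open>An independent set between \<open>A\<close> and \<open>U\<close> of greatest cardinality
  spans \<open>U\<close>, since a vector outside its span could be added;
  \<open>independent_bound\<close> makes the maximum exist.\<close>

lemma basis_extend:
  assumes "subspace U" "independent A" "A \<subseteq> U"
  obtains B where "A \<subseteq> B" "basis_of U B"
proof -
  let ?P = "\<lambda>B. A \<subseteq> B \<and> B \<subseteq> U \<and> independent B"
  obtain B where B: "?P B" "\<And>B'. ?P B' \<Longrightarrow> card B' \<le> card B"
    using ex_has_greatest_nat[of ?P A card "d + 1"] assms independent_bound
    by (metis le_imp_less_Suc Suc_eq_plus1 order_refl)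
  have "x \<in> span B" if "x \<in> U" for x
  proof (rule ccontr)
    assume x: "x \<notin> span B"
    then have "?P (insert x B)" using B(1) that independent_insert by auto
    then have "card (insert x B) \<le> card B" using B(2) by blast
    moreover have "x \<notin> B" using x span_base by blast
    ultimately show False using B(1) independent_bound by auto
  qed
  moreover have "span B \<subseteq> U" using B(1) assms span_minimal by blast
  ultimately have "basis_of U B" using B(1) by (auto simp: basis_of_def)
  then show ?thesis using that B(1) by blast
qed

lemma basis_exists:
  assumes "subspace U"
  obtains B where "basis_of U B"
  using basis_extend[OF assms independent_empty] by blast

text \<open>Any two bases bound each other's cardinality, so the arbitrary choice in the definition
  of \<open>dim\<close> does not matter.\<close>

lemma dim_basis: "basis_of U B \<Longrightarrow> dim U = card B"
proof -
  have le: "card B \<le> card C" if "basis_of U B" "basis_of U C" for B C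
    using that independent_card_le[of C B] independent_bound span_superset
    by (auto simp: basis_of_def)
  assume B: "basis_of U B"
  then have C: "basis_of U (SOME B. basis_of U B)" by (rule someI)
  show "dim U = card B" unfolding dim_def by (rule le_antisym[OF le[OF C B] le[OF B C]])
qed

lemma dim_span_independent: "independent B \<Longrightarrow> dim (span B) = card B"
  by (rule dim_basis) (simp add: basis_of_def)

lemma dim_mono:
  assumes "subspace U" "subspace W" "U \<subseteq> W"
  shows "dim U \<le> dim W"
proof -
  obtain B where B: "basis_of U B" using assms basis_exists by blast
  then have "independent B" "B \<subseteq> W" using assms span_superset by (auto simp: basis_of_def)
  then obtain C where C: "B \<subseteq> C" "basis_of W C" using assms basis_extend by blast
  then show ?thesis
    using B dim_basis independent_bound[of C] by (auto simp: basis_of_def card_mono)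
qed

lemma dim_eq_imp_eq:
  assumes "subspace U" "subspace W" "U \<subseteq> W" "dim W \<le> dim U"
  shows "U = W"
proof -
  obtain B where B: "basis_of U B" using assms basis_exists by blast
  then have "independent B" "B \<subseteq> W" using assms span_superset by (auto simp: basis_of_def)
  then obtain C where C: "B \<subseteq> C" "basis_of W C" using assms basis_extend by blast
  then have "B = C"
    using dim_basis[OF B] dim_basis[OF C(2)] independent_bound[of C] assms(4)
    by (intro card_seteq) (auto simp: basis_of_def)
  then show ?thesis using B C by (auto simp: basis_of_def)
qed

lemma dim_span_insert:
  assumes "subspace U" "x \<notin> U"
  shows "dim (span (insert x U)) = dim U + 1"
proof -
  obtain B where B: "basis_of U B" using assms basis_exists by blast
  have BU: "span B = U" using B by (simp add: basis_of_def)
  have "independent (insert x B)" using B assms by (auto simp: basis_of_def intro: independent_insert)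
  moreover have "span (insert x B) = span (insert x U)"
    unfolding span_insert BU span_subspace[OF assms(1)] ..
  ultimately have "dim (span (insert x U)) = card (insert x B)" using dim_span_independent by metis
  moreover have "x \<notin> B" using BU assms span_superset by blast
  ultimately show ?thesis
    using dim_basis[OF B] B independent_bound[of B] by (simp add: basis_of_def)
qed

lemma dim_span_insert_le:
  assumes "subspace U"
  shows "dim (span (insert x U)) \<le> dim U + 1"
  by (cases "x \<in> U") (simp_all add: assms dim_span_insert insert_absorb span_subspace)

definition linear_form :: "('v \<Rightarrow> 'k) \<Rightarrow> bool" where
  "linear_form \<phi> \<longleftrightarrow> (\<forall>x y. \<phi> (x + y) = \<phi> x + \<phi> y) \<and> (\<forall>x a. \<phi> (x \<cdot> a) = \<phi> x * a)"

lemma linear_form_0: "linear_form \<phi> \<Longrightarrow> \<phi> 0 = 0"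
  unfolding linear_form_def by (metis add_cancel_right_right)

lemma linear_form_diff: "linear_form \<phi> \<Longrightarrow> \<phi> (x - y) = \<phi> x - \<phi> y"
  unfolding linear_form_def by (metis diff_add_cancel add_diff_cancel_right')

lemma subspace_kernel: "linear_form \<phi> \<Longrightarrow> subspace U \<Longrightarrow> subspace {u \<in> U. \<phi> u = 0}"
  unfolding subspace_def using linear_form_0 by (auto simp: linear_form_def)

lemma dim_kernel:
  assumes "linear_form \<phi>" "subspace U"
  shows "dim U \<le> dim {u \<in> U. \<phi> u = 0} + 1"
proof (cases "\<forall>u\<in>U. \<phi> u = 0")
  case True
  then have "{u \<in> U. \<phi> u = 0} = U" by auto
  then show ?thesis by simp
next
  case False
  let ?K = "{u \<in> U. \<phi> u = 0}"
  obtain w where w: "w \<in> U" "\<phi> w \<noteq> 0" using False by blast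
  have "u \<in> span (insert w ?K)" if "u \<in> U" for u
  proof -
    \<comment> \<open>Forms satisfy \<open>\<phi> (w \<cdot> a) = \<phi> w * a\<close>, so the
      inverse has to stand on the left.\<close>
    let ?a = "inverse (\<phi> w) * \<phi> u"
    have "\<phi> (u - w \<cdot> ?a) = 0"
      using assms(1) w by (simp add: linear_form_diff) (simp add: linear_form_def mult.assoc[symmetric])
    moreover have "u - w \<cdot> ?a \<in> U" using that w assms by (simp add: subspace_diff subspace_scale)
    moreover have "u = (u - w \<cdot> ?a) + w \<cdot> ?a" by simp
    moreover have "span ?K = ?K" using subspace_kernel[OF assms] by (rule span_subspace)
    ultimately show ?thesis unfolding span_insert by blast
  qed
  then have "dim U \<le> dim (span (insert w ?K))"
    by (intro dim_mono assms subspace_span) auto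
  also have "\<dots> \<le> dim ?K + 1" by (rule dim_span_insert_le[OF subspace_kernel[OF assms]])
  finally show ?thesis .
qed

lemma dim_common_kernel:
  assumes "finite I" "\<And>i. i \<in> I \<Longrightarrow> linear_form (\<phi> i)" "subspace U"
  shows "dim U \<le> dim {u \<in> U. \<forall>i\<in>I. \<phi> i u = 0} + card I \<and> subspace {u \<in> U. \<forall>i\<in>I. \<phi> i u = 0}"
  using assms
proof (induction I rule: finite_induct)
  case empty
  then show ?case by simp
next
  case (insert j I)
  let ?K = "{u \<in> U. \<forall>i\<in>I. \<phi> i u = 0}"
  have eq: "{u \<in> U. \<forall>i\<in>insert j I. \<phi> i u = 0} = {u \<in> ?K. \<phi> j u = 0}" by auto
  have "subspace ?K" "dim U \<le> dim ?K + card I" using insert by auto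
  moreover have "linear_form (\<phi> j)" using insert by auto
  ultimately show ?case
    unfolding eq using dim_kernel[of "\<phi> j" ?K] subspace_kernel[of "\<phi> j" ?K] insert.hyps by simp
qed

text \<open>\<open>coord\<close> is a definite description, so uniqueness is needed as well as
  existence; the value 0 outside \<open>{1..d}\<close> makes the coordinate function unique.\<close>

lemma coord_ex1: "\<exists>!x. (\<forall>i. i \<notin> {1..d} \<longrightarrow> x i = 0) \<and> v = (\<Sum>i=1..d. E i \<cdot> x i)"
proof (rule ex_ex1I)
  have "v \<in> span (E ` {1..d})" by (simp add: span_E)
  then obtain c where "v = (\<Sum>u\<in>E ` {1..d}. u \<cdot> c u)" by (auto simp: span_finite)
  then have "v = (\<Sum>i=1..d. E i \<cdot> c (E i))" by (simp add: sum.reindex[OF inj_E])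
  then have "v = (\<Sum>i=1..d. E i \<cdot> (if i \<in> {1..d} then c (E i) else 0))" by simp
  then show "\<exists>x. (\<forall>i. i \<notin> {1..d} \<longrightarrow> x i = 0) \<and> v = (\<Sum>i=1..d. E i \<cdot> x i)"
    by (intro exI[of _ "\<lambda>i. if i \<in> {1..d} then c (E i) else 0"]) simp
next
  fix x y
  assume x: "(\<forall>i. i \<notin> {1..d} \<longrightarrow> x i = 0) \<and> v = (\<Sum>i=1..d. E i \<cdot> x i)"
    and y: "(\<forall>i. i \<notin> {1..d} \<longrightarrow> y i = 0) \<and> v = (\<Sum>i=1..d. E i \<cdot> y i)"
  let ?c = "\<lambda>u. x (the_inv_into {1..d} E u) - y (the_inv_into {1..d} E u)"
  have "(\<Sum>u\<in>E ` {1..d}. u \<cdot> ?c u) = (\<Sum>i=1..d. E i \<cdot> (x i - y i))"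
    by (subst sum.reindex[OF inj_E]) (auto simp: the_inv_into_f_f[OF inj_E] intro!: sum.cong)
  also have "\<dots> = (\<Sum>i=1..d. E i \<cdot> x i - E i \<cdot> y i)"
    using scale_right_distrib[of _ _ "- _"] by (simp add: scale_minus_right)
  also have "\<dots> = 0" using x y by (simp add: sum_subtractf)
  finally have "\<forall>u\<in>E ` {1..d}. ?c u = 0"
    using independent_E unfolding independent_def by (meson finite_atLeastAtMost finite_imageI subset_refl)
  then have "x i = y i" if "i \<in> {1..d}" for i
    using that by (auto simp: the_inv_into_f_f[OF inj_E])
  moreover have "x i = y i" if "i \<notin> {1..d}" for i
    using that x y by metis
  ultimately show "x = y" by blast
qed

abbreviation co :: "'v \<Rightarrow> nat \<Rightarrow> 'k" where "co \<equiv> coord E d"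

lemma co_outside: "i \<notin> {1..d} \<Longrightarrow> co v i = 0"
  and sum_co: "(\<Sum>i=1..d. E i \<cdot> co v i) = v"
  using theI'[OF coord_ex1[of v]] unfolding coord_def by auto

lemma co_unique: "\<lbrakk>v = (\<Sum>i=1..d. E i \<cdot> x i); \<And>i. i \<notin> {1..d} \<Longrightarrow> x i = 0\<rbrakk> \<Longrightarrow> co v = x"
  unfolding coord_def by (rule the1_equality[OF coord_ex1]) auto

lemma co_sum: "co (\<Sum>i=1..d. E i \<cdot> x i) = (\<lambda>i. if i \<in> {1..d} then x i else 0)"
  by (rule co_unique) auto

lemma co_add: "co (v + w) i = co v i + co w i"
proof -
  have "co (v + w) = (\<lambda>i. co v i + co w i)"
    by (rule co_unique) (simp_all add: scale_right_distrib sum.distrib sum_co co_outside)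
  then show ?thesis by simp
qed

lemma co_scale: "co (v \<cdot> a) i = co v i * a"
proof -
  have "co (v \<cdot> a) = (\<lambda>i. co v i * a)"
    by (rule co_unique)
      (simp_all add: scale_scale[symmetric] scale_sum_left[symmetric] sum_co co_outside)
  then show ?thesis by simp
qed

lemma linear_form_co: "linear_form (\<lambda>v. co v i)"
  by (simp add: linear_form_def co_add co_scale)

lemma co_0 [simp]: "co 0 i = 0"
  using linear_form_0[OF linear_form_co] .

lemma co_diff: "co (v - w) i = co v i - co w i"
  using linear_form_diff[OF linear_form_co] .

lemma co_E: "j \<in> {1..d} \<Longrightarrow> co (E j) i = (if i = j then 1 else 0)"
proof -
  assume j: "j \<in> {1..d}"
  have "co (E j) = (\<lambda>i. if i = j then 1 else 0)"
  proof (rule co_unique)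
    have "(\<Sum>i=1..d. E i \<cdot> (if i = j then 1 else 0)) = (\<Sum>i=1..d. if i = j then E i else 0)"
      by (rule sum.cong) (auto simp: scale_one)
    then show "E j = (\<Sum>i=1..d. E i \<cdot> (if i = j then 1 else 0))" using j by simp
  qed (use j in auto)
  then show ?thesis by simp
qed

lemma co_eqI: "(\<And>i. i \<in> {1..d} \<Longrightarrow> co v i = co w i) \<Longrightarrow> v = w"
  using sum_co[of v] sum_co[of w] by (metis (mono_tags, lifting) sum.cong)

text \<open>The coordinate \<open>k i\<close> is 1 on \<open>g i\<close> and 0 on the other members,
  so it reads the coefficient of \<open>g i\<close> off any linear relation.\<close>

lemma dim_span_family:
  assumes "finite I" "\<And>i. i \<in> I \<Longrightarrow> co (g i) (k i) = 1"
    "\<And>i j. i \<in> I \<Longrightarrow> j \<in> I \<Longrightarrow> i \<noteq> j \<Longrightarrow> co (g j) (k i) = 0"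
  shows "dim (span (g ` I)) = card I"
proof -
  have inj: "inj_on g I"
    by (rule inj_onI) (metis assms(2,3) zero_neq_one)
  have "independent (g ` I)"
    unfolding independent_def
  proof (intro allI impI ballI)
    fix S c v assume S: "finite S \<and> S \<subseteq> g ` I \<and> (\<Sum>v\<in>S. v \<cdot> c v) = 0" and v: "v \<in> S"
    then obtain i where i: "i \<in> I" "v = g i" by auto
    have co_lin: "co (\<Sum>v\<in>S. v \<cdot> c v) m = (\<Sum>v\<in>S. co v m * c v)" for m
      using conjunct1[OF S] by (induction S rule: finite_induct) (auto simp: co_add co_scale)
    have "0 = (\<Sum>w\<in>S. co w (k i) * c w)" using co_lin S by (metis co_0)
    also have "\<dots> = (\<Sum>w\<in>S. if w = v then c w else 0)"
      using S i assms(2,3) by (intro sum.cong) (auto simp: image_iff subset_iff, metis)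
    also have "\<dots> = c v" using S v by simp
    finally show "c v = 0" by simp
  qed
  then show ?thesis using dim_span_independent card_image[OF inj] by simp
qed

end

section \<open>Linear forms over the sub-division ring and pencils\<close>

definition left_linear :: "'k::division_ring set \<Rightarrow> ('k \<Rightarrow> 'k) \<Rightarrow> bool" where
  "left_linear K0 f \<longleftrightarrow> (\<forall>x y. f (x + y) = f x + f y) \<and> (\<forall>k\<in>K0. \<forall>x. f (k * x) = k * f x)"

lemma left_linear_add: "left_linear K0 f \<Longrightarrow> f (x + y) = f x + f y"
  and left_linear_mult: "left_linear K0 f \<Longrightarrow> k \<in> K0 \<Longrightarrow> f (k * x) = k * f x"
  by (auto simp: left_linear_def)

lemma left_linear_0: "left_linear K0 f \<Longrightarrow> f 0 = 0"
  using left_linear_add[of K0 f 0 0] by simp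

lemma left_linear_minus: "left_linear K0 f \<Longrightarrow> f (- x) = - f x"
  using left_linear_add[of K0 f x "- x"] by (simp add: left_linear_0 eq_neg_iff_add_eq_0 add.commute)

lemma left_linear_sum: "left_linear K0 f \<Longrightarrow> f (\<Sum>i\<in>I. g i) = (\<Sum>i\<in>I. f (g i))"
  by (induction I rule: infinite_finite_induct) (auto simp: left_linear_0 left_linear_add)

lemma left_linear_right_mult: "left_linear K0 f \<Longrightarrow> left_linear K0 (\<lambda>x. f (x * a))"
  by (simp add: left_linear_def distrib_right mult.assoc)

lemma sub_division_ring_closed:
  assumes "sub_division_ring K0"
  shows "1 \<in> K0" "0 \<in> K0" "x \<in> K0 \<Longrightarrow> y \<in> K0 \<Longrightarrow> x - y \<in> K0"
    "x \<in> K0 \<Longrightarrow> y \<in> K0 \<Longrightarrow> x * y \<in> K0" "x \<in> K0 \<Longrightarrow> - x \<in> K0"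
    "x \<in> K0 \<Longrightarrow> y \<in> K0 \<Longrightarrow> x + y \<in> K0" "x \<in> K0 \<Longrightarrow> inverse x \<in> K0"
proof -
  show one: "1 \<in> K0" and diff: "x \<in> K0 \<Longrightarrow> y \<in> K0 \<Longrightarrow> x - y \<in> K0"
    and "x \<in> K0 \<Longrightarrow> y \<in> K0 \<Longrightarrow> x * y \<in> K0" and "x \<in> K0 \<Longrightarrow> inverse x \<in> K0" for x y
    using assms by (auto simp: sub_division_ring_def)
  show zero: "0 \<in> K0" using diff[OF one one] by simp
  show neg: "x \<in> K0 \<Longrightarrow> - x \<in> K0" for x using diff[OF zero, of x] by simp
  show "x \<in> K0 \<Longrightarrow> y \<in> K0 \<Longrightarrow> x + y \<in> K0" using diff[of x "- y"] neg[of y] by simp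
qed

text \<open>A maximal left subspace \<open>N\<close> over \<open>K0\<close> with \<open>1 \<in> N\<close> and \<open>a \<notin> N\<close> is a complement of
  \<open>K0 a\<close>; the form is the projection along \<open>N\<close>.\<close>

lemma exists_left_linear_separating:
  assumes K0: "sub_division_ring K0" and a: "a \<notin> K0"
  obtains f where "left_linear K0 f" "f 1 = 0" "f a = 1"
proof -
  note cl = sub_division_ring_closed[OF K0]
  define \<N> where "\<N> = {N. 1 \<in> N \<and> a \<notin> N \<and> (\<forall>x\<in>N. \<forall>y\<in>N. x + y \<in> N) \<and> (\<forall>k\<in>K0. \<forall>x\<in>N. k * x \<in> N)}"
  have "K0 \<in> \<N>" using cl a by (auto simp: \<N>_def)
  moreover have "\<Union>C \<in> \<N>" if "C \<noteq> {}" "subset.chain \<N> C" for C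
  proof -
    have "x + y \<in> \<Union>C" if "x \<in> \<Union>C" "y \<in> \<Union>C" for x y
    proof -
      obtain N M where "x \<in> N" "y \<in> M" "N \<in> C" "M \<in> C" "N \<subseteq> M \<or> M \<subseteq> N"
        using \<open>subset.chain \<N> C\<close> \<open>x \<in> \<Union>C\<close> \<open>y \<in> \<Union>C\<close> unfolding subset_chain_def by blast
      moreover have "C \<subseteq> \<N>" using \<open>subset.chain \<N> C\<close> by (auto simp: subset_chain_def)
      ultimately show ?thesis unfolding \<N>_def by blast
    qed
    moreover have "C \<subseteq> \<N>" using \<open>subset.chain \<N> C\<close> by (auto simp: subset_chain_def)
    ultimately show ?thesis using \<open>C \<noteq> {}\<close> unfolding \<N>_def by blast
  qed
  ultimately obtain N where N: "N \<in> \<N>" "\<And>M. M \<in> \<N> \<Longrightarrow> N \<subseteq> M \<Longrightarrow> M = N"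
    using subset_Zorn_nonempty[of \<N>] by blast
  have N_closed: "1 \<in> N" "a \<notin> N" "\<And>x y. x \<in> N \<Longrightarrow> y \<in> N \<Longrightarrow> x + y \<in> N"
    "\<And>k x. k \<in> K0 \<Longrightarrow> x \<in> N \<Longrightarrow> k * x \<in> N"
    using N(1) by (auto simp: \<N>_def)
  have N_neg: "- x \<in> N" if "x \<in> N" for x
    using N_closed(4)[of "- 1" x] cl that by simp
  have N_diff: "x - y \<in> N" if "x \<in> N" "y \<in> N" for x y
    using N_closed(3)[of x "- y"] N_neg that by simp
  \<comment> \<open>If \<open>x\<close> is outside \<open>N\<close>, adjoining it gives a larger
    left subspace, which contains \<open>a\<close> by maximality; solving
    \<open>a = m + k * x\<close> for \<open>x\<close> yields the coefficient
    \<open>inverse k\<close>.\<close>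
  have ex: "\<exists>k\<in>K0. x - k * a \<in> N" for x
  proof (cases "x \<in> N")
    case True
    then show ?thesis using cl by (intro bexI[of _ 0]) auto
  next
    case False
    let ?M = "{m + k * x | m k. m \<in> N \<and> k \<in> K0}"
    have "N \<subseteq> ?M" using cl by (force intro: exI[of _ 0])
    moreover have "x \<in> ?M"
    proof -
      have "0 \<in> N" using N_diff[OF N_closed(1) N_closed(1)] by simp
      then show ?thesis using cl(1) by (force intro: exI[of _ 0] exI[of _ 1])
    qed
    ultimately have "?M \<noteq> N" "1 \<in> ?M" using False N_closed(1) by blast+
    moreover have "\<forall>y\<in>?M. \<forall>z\<in>?M. y + z \<in> ?M"
    proof (intro ballI)
      fix y z assume "y \<in> ?M" "z \<in> ?M"
      then obtain m k m' k' where "y = m + k * x" "z = m' + k' * x" "m \<in> N" "m' \<in> N" "k \<in> K0" "k' \<in> K0"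
        by blast
      then have "y + z = (m + m') + (k + k') * x" "m + m' \<in> N" "k + k' \<in> K0"
        using N_closed cl by (auto simp: algebra_simps)
      then show "y + z \<in> ?M" by blast
    qed
    moreover have "\<forall>j\<in>K0. \<forall>y\<in>?M. j * y \<in> ?M"
    proof (intro ballI)
      fix j y assume "j \<in> K0" "y \<in> ?M"
      then obtain m k where "y = m + k * x" "m \<in> N" "k \<in> K0" by blast
      then have "j * y = j * m + (j * k) * x" "j * m \<in> N" "j * k \<in> K0"
        using N_closed cl \<open>j \<in> K0\<close> by (auto simp: algebra_simps)
      then show "j * y \<in> ?M" by blast
    qed
    ultimately have "a \<in> ?M" using N(2)[of ?M] \<open>N \<subseteq> ?M\<close> by (auto simp: \<N>_def)
    then obtain m k where mk: "a = m + k * x" "m \<in> N" "k \<in> K0" by blast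
    then have "k \<noteq> 0" using N_closed by auto
    then have "x - inverse k * a = - (inverse k * m)"
      by (simp add: mk algebra_simps mult.assoc[symmetric])
    then show ?thesis using mk N_closed cl N_neg by (intro bexI[of _ "inverse k"]) auto
  qed
  have uniq: "k = k'" if "k \<in> K0" "k' \<in> K0" "x - k * a \<in> N" "x - k' * a \<in> N" for k k' x
  proof (rule ccontr)
    assume "k \<noteq> k'"
    have "(x - k * a) - (x - k' * a) = (k' - k) * a" by (simp add: algebra_simps)
    then have "(k' - k) * a \<in> N" using N_diff[OF that(3,4)] by simp
    then have "inverse (k' - k) * ((k' - k) * a) \<in> N"
      by (rule N_closed(4)[OF cl(7)[OF cl(3)[OF that(2,1)]]])
    then show False using N_closed(2) \<open>k \<noteq> k'\<close> by (simp add: mult.assoc[symmetric])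
  qed
  define f where "f x = (SOME k. k \<in> K0 \<and> x - k * a \<in> N)" for x
  have f: "f x \<in> K0" "x - f x * a \<in> N" for x
    using someI_ex[of "\<lambda>k. k \<in> K0 \<and> x - k * a \<in> N"] ex[of x] unfolding f_def by auto
  have f_eq: "f x = k" if "k \<in> K0" "x - k * a \<in> N" for x k
    using uniq f that by blast
  have "f (x + y) = f x + f y" for x y
  proof (rule f_eq)
    have "x + y - (f x + f y) * a = (x - f x * a) + (y - f y * a)" by (simp add: algebra_simps)
    then show "x + y - (f x + f y) * a \<in> N" using N_closed(3) f(2) by metis
  qed (use f cl in auto)
  moreover have "f (k * x) = k * f x" if "k \<in> K0" for k x
  proof (rule f_eq)
    have "k * x - k * f x * a = k * (x - f x * a)" by (simp add: algebra_simps)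
    then show "k * x - k * f x * a \<in> N" using N_closed(4) f(2) that by metis
  qed (use f cl that in auto)
  ultimately have "left_linear K0 f" by (simp add: left_linear_def)
  moreover have "f 1 = 0" "f a = 1"
    using N_diff[OF N_closed(1) N_closed(1)] by (auto intro!: f_eq simp: cl N_closed(1))
  ultimately show ?thesis using that by blast
qed

section \<open>Subspaces of a Grassmannian defined by a relation between two types\<close>

lemma flag_element: "flag G F \<Longrightarrow> x \<in> F \<Longrightarrow> x \<in> elements G"
  by (auto simp: flag_def)

lemma flag_incident: "flag G F \<Longrightarrow> x \<in> F \<Longrightarrow> y \<in> F \<Longrightarrow> x \<noteq> y \<Longrightarrow> incident G x y"
  by (auto simp: flag_def pairwise_def)

definition related_points ::
  "('x, 't) diagram_geometry \<Rightarrow> 't set \<Rightarrow> 't \<Rightarrow> 't \<Rightarrow> ('x \<Rightarrow> 'x \<Rightarrow> bool) \<Rightarrow> 'x set set" where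
  "related_points G J s t R =
     {P \<in> gr_points G J. \<forall>x\<in>P. \<forall>y\<in>P. type_of G x = s \<longrightarrow> type_of G y = t \<longrightarrow> R x y}"

definition pencil :: "('x, 't) diagram_geometry \<Rightarrow> 't \<Rightarrow> 'x \<Rightarrow> 'x set" where
  "pencil G s l = {x \<in> elements G. type_of G x = s \<and> incident G x l}"

text \<open>Along a line of type \<open>(J - {j}) \<union> fr j\<close> only the element of type \<open>j\<close> of a point
  varies, inside the pencil of any element of the line whose type lies in \<open>fr j\<close>.\<close>

lemma gr_subspace_related_points:
  assumes uniq: "\<And>F x y. \<lbrakk>flag G F; x \<in> F; y \<in> F; type_of G x = type_of G y\<rbrakk> \<Longrightarrow> x = y"
    and st: "s \<in> J" "t \<in> J" "s \<noteq> t"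
    and s': "s' \<in> fr G s" "s' \<noteq> s" and t': "t' \<in> fr G t" "t' \<noteq> t"
    and closed_s: "\<And>l y x1 x2 x. \<lbrakk>l \<in> elements G; type_of G l = s'; y \<in> elements G; type_of G y = t;
      x1 \<in> pencil G s l; x2 \<in> pencil G s l; x \<in> pencil G s l; x1 \<noteq> x2; R x1 y; R x2 y\<rbrakk> \<Longrightarrow> R x y"
    and closed_t: "\<And>l x y1 y2 y. \<lbrakk>l \<in> elements G; type_of G l = t'; x \<in> elements G; type_of G x = s;
      y1 \<in> pencil G t l; y2 \<in> pencil G t l; y \<in> pencil G t l; y1 \<noteq> y2; R x y1; R x y2\<rbrakk> \<Longrightarrow> R x y"
  shows "gr_subspace G J (related_points G J s t R)"
  unfolding gr_subspace_def
proof (intro conjI ballI impI subsetI)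
  fix P assume "P \<in> related_points G J s t R"
  then show "P \<in> gr_points G J" by (simp add: related_points_def)
next
  fix L P assume L: "L \<in> gr_lines G J"
    and "\<exists>P\<in>related_points G J s t R. \<exists>Q\<in>related_points G J s t R.
      P \<noteq> Q \<and> gr_incident G P L \<and> gr_incident G Q L"
    and P: "P \<in> {P \<in> gr_points G J. gr_incident G P L}"
  then obtain P1 P2 where P12: "P1 \<in> related_points G J s t R" "P2 \<in> related_points G J s t R" "P1 \<noteq> P2"
    "gr_incident G P1 L" "gr_incident G P2 L" by blast
  obtain j where j: "j \<in> J" "flag G L" "type_of G ` L = (J - {j}) \<union> fr G j"
    using L by (auto simp: gr_lines_def flags_of_type_def)
  let ?on = "\<lambda>Q. Q \<in> gr_points G J \<and> gr_incident G Q L"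
  have on: "?on P" "?on P1" "?on P2" using P P12 by (auto simp: related_points_def)
  have ty: "type_of G ` Q = J" if "?on Q" for Q
    using that by (auto simp: gr_points_def flags_of_type_def)
  \<comment> \<open>\<open>Q \<union> L\<close> is a flag, so an element of the point and one of the
    line coincide if their types agree. Hence a point and a line through it share every element of a
    type in \<open>J - {j}\<close>.\<close>
  have same: "x = y" if "?on Q" "x \<in> Q" "y \<in> L" "type_of G x = type_of G y" for Q x y
    using uniq[of "Q \<union> L" x y] that by (auto simp: gr_incident_def)
  have same': "x = y" if "?on Q" "x \<in> Q" "y \<in> Q" "type_of G x = type_of G y" for Q x y
    using uniq[of Q x y] that by (auto simp: gr_points_def flags_of_type_def)
  have in_L: "x \<in> L" if "?on Q" "x \<in> Q" "type_of G x \<noteq> j" for Q x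
  proof -
    have "type_of G x \<in> type_of G ` L" using ty[OF that(1)] that j(3) by blast
    then obtain y where "y \<in> L" "type_of G y = type_of G x" by auto
    then show ?thesis using same[OF that(1,2), of y] by simp
  qed
  have in_Q: "y \<in> Q" if "?on Q" "y \<in> L" "type_of G y \<in> J" for Q y
  proof -
    have "type_of G y \<in> type_of G ` Q" using that ty by auto
    then obtain x where "x \<in> Q" "type_of G x = type_of G y" by auto
    then show ?thesis using same[OF that(1) _ that(2)] by auto
  qed
  obtain u1 where u1: "u1 \<in> P1" "type_of G u1 = j" using ty[OF on(2)] j(1) by force
  obtain u2 where u2: "u2 \<in> P2" "type_of G u2 = j" using ty[OF on(3)] j(1) by force
  \<comment> \<open>Points on \<open>L\<close> agree in all types except \<open>j\<close>; if they
    agreed there as well, they would be equal.\<close>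
  have "u1 \<noteq> u2"
  proof
    assume eq: "u1 = u2"
    have "Q \<subseteq> Q'" if "?on Q" "?on Q'" "u1 \<in> Q" "u1 \<in> Q'" for Q Q'
    proof
      fix x assume x: "x \<in> Q"
      show "x \<in> Q'"
      proof (cases "type_of G x = j")
        case True
        then show ?thesis using same'[OF that(1) x that(3)] u1 that(4) by simp
      next
        case False
        then have "x \<in> L" by (rule in_L[OF that(1) x])
        moreover have "type_of G x \<in> J" using ty[OF that(1)] x by blast
        ultimately show ?thesis by (rule in_Q[OF that(2)])
      qed
    qed
    then have "P1 = P2" using on u1 u2 eq by (metis subset_antisym)
    then show False using P12 by simp
  qed
  have pencil: "u \<in> pencil G j l" if "?on Q" "u \<in> Q" "type_of G u = j" "l \<in> L" "type_of G l \<noteq> j" for Q u l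
  proof -
    have "flag G (Q \<union> L)" using that by (simp add: gr_incident_def)
    moreover have "u \<noteq> l" using that by auto
    ultimately show ?thesis using that
      by (auto simp: pencil_def flag_def pairwise_def gr_points_def flags_of_type_def)
  qed
  have elt: "x \<in> elements G" if "x \<in> L" for x using j(2) that by (auto simp: flag_def)
  have R1: "R x y" if "x \<in> P1" "y \<in> P1" "type_of G x = s" "type_of G y = t" for x y
    using P12(1) that unfolding related_points_def by blast
  have R2: "R x y" if "x \<in> P2" "y \<in> P2" "type_of G x = s" "type_of G y = t" for x y
    using P12(2) that unfolding related_points_def by blast
  have "R x y" if xy: "x \<in> P" "y \<in> P" "type_of G x = s" "type_of G y = t" for x y
  proof -
    consider "j = s" | "j = t" | "j \<noteq> s" "j \<noteq> t" by blast
    then show ?thesis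
    proof cases
      case 1
      have y: "y \<in> L" using in_L[OF on(1)] xy 1 st by auto
      then have y12: "y \<in> P1" "y \<in> P2" using in_Q on xy st by auto
      have "s' \<in> type_of G ` L" using j(3) s' 1 by auto
      then obtain l where l: "l \<in> L" "type_of G l = s'" by auto
      show ?thesis
      proof (rule closed_s[of l y u1 u2 x])
        show "R u1 y" "R u2 y" using R1[OF u1(1) y12(1)] R2[OF u2(1) y12(2)] u1 u2 1 xy by auto
        show "u1 \<in> pencil G s l" "u2 \<in> pencil G s l" "x \<in> pencil G s l"
          using pencil[OF on(2) u1 l(1)] pencil[OF on(3) u2 l(1)] pencil[OF on(1) xy(1) _ l(1)] 1 l s' xy
          by auto
      qed (use elt l y xy \<open>u1 \<noteq> u2\<close> in auto)
    next
      case 2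
      have x: "x \<in> L" using in_L[OF on(1)] xy 2 st by auto
      then have x12: "x \<in> P1" "x \<in> P2" using in_Q on xy st by auto
      have "t' \<in> type_of G ` L" using j(3) t' 2 by auto
      then obtain l where l: "l \<in> L" "type_of G l = t'" by auto
      show ?thesis
      proof (rule closed_t[of l x u1 u2 y])
        show "R x u1" "R x u2" using R1[OF x12(1) u1(1)] R2[OF x12(2) u2(1)] u1 u2 2 xy by auto
        show "u1 \<in> pencil G t l" "u2 \<in> pencil G t l" "y \<in> pencil G t l"
          using pencil[OF on(2) u1 l(1)] pencil[OF on(3) u2 l(1)] pencil[OF on(1) xy(2) _ l(1)] 2 l t' xy
          by auto
      qed (use elt l x xy \<open>u1 \<noteq> u2\<close> in auto)
    next
      case 3
      \<comment> \<open>Neither type varies along \<open>L\<close>, so \<open>x\<close> and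
        \<open>y\<close> already belong to \<open>P1\<close>.\<close>
      then have "x \<in> L" "y \<in> L" using in_L[OF on(1)] xy by auto
      then have "x \<in> P1" "y \<in> P1" using in_Q on xy st by auto
      then show ?thesis using R1 xy by auto
    qed
  qed
  then show "P \<in> related_points G J s t R" using P by (auto simp: related_points_def)
qed

text \<open>The related flags form a subspace containing the rational points, hence their hull; one
  unrelated flag shows that the hull is not everything.\<close>

lemma (in right_vector_space) not_rationally_generatedI:
  assumes "gr_subspace G J (related_points G J s t R)"
    and "\<And>P x y. \<lbrakk>P \<in> rational_points E d K0 G J; x \<in> P; y \<in> P; type_of G x = s; type_of G y = t\<rbrakk> \<Longrightarrow> R x y"
    and "P \<in> gr_points G J" "x \<in> P" "y \<in> P" "type_of G x = s" "type_of G y = t" "\<not> R x y"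
  shows "\<not> rationally_generated E d K0 G J"
proof
  assume "rationally_generated E d K0 G J"
  moreover have "rational_points E d K0 G J \<subseteq> related_points G J s t R"
    using assms(2) by (auto simp: related_points_def rational_points_def)
  ultimately have "gr_points G J \<subseteq> related_points G J s t R"
    using hull_minimal[of _ _ "gr_subspace G J"] assms(1) unfolding rationally_generated_def by metis
  then show False using assms(3-) unfolding related_points_def by blast
qed

section \<open>Forms applied to coordinates\<close>

context fin_dim_rvs
begin

definition lift :: "('k \<Rightarrow> 'k) \<Rightarrow> 'v \<Rightarrow> 'v" where
  "lift f v = (\<Sum>i=1..d. E i \<cdot> f (co v i))"

lemma co_lift: "left_linear K0 f \<Longrightarrow> co (lift f v) i = f (co v i)"
  unfolding lift_def by (subst co_sum) (simp add: co_outside left_linear_0)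

lemma lift_add: "left_linear K0 f \<Longrightarrow> lift f (v + w) = lift f v + lift f w"
  by (rule co_eqI) (simp add: co_lift co_add left_linear_add)

lemma lift_scale: "left_linear K0 f \<Longrightarrow> lift f (v \<cdot> a) = lift (\<lambda>x. f (x * a)) v"
  by (rule co_eqI) (simp add: co_lift[OF left_linear_right_mult] co_lift[of K0] co_scale)

lemma rational_vector_co: "rational_vector E d K0 v \<Longrightarrow> i \<in> {1..d} \<Longrightarrow> co v i \<in> K0"
  unfolding rational_vector_def by (auto simp: co_sum)

lemma lift_rational_vector:
  assumes "left_linear K0 f" "rational_vector E d K0 v"
  shows "lift f v = v \<cdot> f 1"
proof (rule co_eqI)
  fix i assume "i \<in> {1..d}"
  then show "co (lift f v) i = co (v \<cdot> f 1) i"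
    using left_linear_mult[OF assms(1) rational_vector_co[OF assms(2)], of i 1] assms(1)
    by (simp add: co_lift co_scale)
qed

text \<open>The vectors whose lifts under every form lie in \<open>U\<close> make up a subspace.
  Closure under scalars takes all forms together, as \<open>lift f (v \<cdot> a)\<close> is a lift
  of \<open>v\<close> under another form. The rational basis belongs to it because there
  \<open>lift f v\<close> is the multiple \<open>v \<cdot> f 1\<close>.\<close>

lemma lift_rational_subspace:
  assumes U: "rational_subspace E d K0 U" and f: "left_linear K0 f" and v: "v \<in> U"
  shows "lift f v \<in> U"
proof -
  obtain B where B: "span B = U" "\<And>v. v \<in> B \<Longrightarrow> rational_vector E d K0 v"
    using U by (auto simp: rational_subspace_def basis_of_def)
  have subU: "subspace U" using B(1) subspace_span by blast
  let ?W = "{v. \<forall>f. left_linear K0 f \<longrightarrow> lift f v \<in> U}"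
  have "subspace ?W"
    unfolding subspace_def
  proof (intro conjI ballI allI)
    show "0 \<in> ?W" using subspace_0[OF subU] by (simp add: lift_def left_linear_0)
  next
    fix x y assume "x \<in> ?W" "y \<in> ?W"
    then show "x + y \<in> ?W" using subspace_add[OF subU] lift_add by auto
  next
    fix x a assume "x \<in> ?W"
    then show "x \<cdot> a \<in> ?W" using lift_scale[of K0] left_linear_right_mult[of K0] by auto
  qed
  moreover have "B \<subseteq> ?W"
    using B span_superset[of B] subspace_scale[OF subU] lift_rational_vector by fastforce
  ultimately have "U \<subseteq> ?W" using B(1) span_minimal by blast
  then show ?thesis using f v by auto
qed

lemma dim_Int_less:
  assumes "subspace U" "subspace W" "dim U = dim W" "U \<noteq> W"
  shows "dim (U \<inter> W) < dim U"
proof (rule ccontr)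
  assume "\<not> dim (U \<inter> W) < dim U"
  then have "U \<inter> W = U" "U \<inter> W = W"
    using dim_eq_imp_eq[of "U \<inter> W" U] dim_eq_imp_eq[of "U \<inter> W" W] assms subspace_Int by auto
  then show False using assms by auto
qed

lemma line_sum:
  assumes "subspace P" "subspace Q" "subspace L" "P \<noteq> Q" "dim P = 1" "dim Q = 1" "dim L = 2"
    "P \<subseteq> L" "Q \<subseteq> L" "v \<in> L"
  obtains x y where "x \<in> P" "y \<in> Q" "v = x + y"
proof -
  obtain q where q: "q \<in> Q" "q \<notin> P" using dim_eq_imp_eq[of Q P] assms by auto
  have "span (insert q P) = L"
  proof (rule dim_eq_imp_eq)
    show "span (insert q P) \<subseteq> L" using assms q by (intro span_minimal) auto
    show "dim L \<le> dim (span (insert q P))" using dim_span_insert[of P q] q assms by simp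
  qed (auto simp: assms subspace_span)
  then obtain x a where "v = x + q \<cdot> a" "x \<in> P"
    using \<open>v \<in> L\<close> span_subspace[OF \<open>subspace P\<close>] unfolding span_insert by auto
  then show ?thesis using that q subspace_scale[OF \<open>subspace Q\<close>] by blast
qed

definition lift_incident :: "'k set \<Rightarrow> 'v set \<Rightarrow> 'v set \<Rightarrow> bool" where
  "lift_incident K0 U W \<longleftrightarrow> (\<forall>f. left_linear K0 f \<longrightarrow> lift f ` U \<subseteq> W)"

text \<open>Each vector of the line is a sum of one from \<open>P\<close> and one from
  \<open>Q\<close>, and \<open>lift f\<close> is additive.\<close>

lemma lift_incident_pencil:
  assumes "subspace P" "subspace Q" "subspace L" "P \<noteq> Q" "dim P = 1" "dim Q = 1" "dim L = 2"
    "P \<subseteq> L" "Q \<subseteq> L" "U \<subseteq> L" "subspace W" "lift_incident K0 P W" "lift_incident K0 Q W"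
  shows "lift_incident K0 U W"
  unfolding lift_incident_def
proof (intro allI impI subsetI)
  fix f w assume f: "left_linear K0 f" and "w \<in> lift f ` U"
  then obtain v where v: "v \<in> L" "w = lift f v" using assms(10) by auto
  obtain x y where "x \<in> P" "y \<in> Q" "v = x + y" using line_sum[OF assms(1-9) v(1)] .
  then show "w \<in> W"
    using v lift_add[OF f] subspace_add[OF assms(11)] assms(12,13) f
    unfolding lift_incident_def by (metis image_subset_iff)
qed

lemma lift_incident_rational:
  "rational_subspace E d K0 U \<Longrightarrow> U \<subseteq> W \<Longrightarrow> lift_incident K0 U W"
  using lift_rational_subspace by (auto simp: lift_incident_def)

end

section \<open>Type A: flags of a point and a hyperplane\<close>

lemma A_not_rationally_generated:
  fixes scale :: "'v::ab_group_add \<Rightarrow> 'k::division_ring \<Rightarrow> 'v" (infixl "\<cdot>" 75)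
  assumes rvs: "right_vector_space scale" and basis: "right_vector_space.indexed_basis scale E (n + 1)"
    and K0: "sub_division_ring K0" "K0 \<noteq> UNIV" and n: "3 \<le> n"
  shows "\<not> right_vector_space.rationally_generated scale E (n + 1) K0
           (right_vector_space.A_building scale n) {1, n}"
proof -
  interpret fin_dim_rvs scale E "n + 1"
    using rvs basis by (simp add: fin_dim_rvs_def fin_dim_rvs_axioms_def)
  let ?G = "A_building n"
  have elts: "X \<in> elements ?G \<longleftrightarrow> subspace X \<and> dim X \<in> {1..n}" and ty: "type_of ?G X = dim X"
    and inc: "incident ?G X Y \<longleftrightarrow> X \<subseteq> Y \<or> Y \<subseteq> X" for X Y
    by (auto simp: A_building_def)
  have le: "X \<subseteq> Y" if "subspace X" "subspace Y" "X \<subseteq> Y \<or> Y \<subseteq> X" "dim X \<le> dim Y" for X Y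
    using that dim_eq_imp_eq[of Y X] by auto
  \<comment> \<open>The inclusions are conditional so that one fact serves both points on a line and
    hyperplanes through an \<open>(n - 1)\<close>-space.\<close>
  have pen: "subspace X \<and> dim X = i \<and> (dim X \<le> dim L \<longrightarrow> X \<subseteq> L) \<and> (dim L \<le> dim X \<longrightarrow> L \<subseteq> X)"
    if "X \<in> pencil ?G i L" "L \<in> elements ?G" for X i L
    using that le[of X L] le[of L X] by (simp add: pencil_def elts ty inc) blast
  have "gr_subspace ?G {1, n} (related_points ?G {1, n} 1 n (lift_incident K0))"
  proof (rule gr_subspace_related_points[where s' = 2 and t' = "n - 1"])
    fix F X Y assume F: "flag ?G F" "X \<in> F" "Y \<in> F" and XY: "type_of ?G X = type_of ?G Y"
    have "X \<subseteq> Y \<or> Y \<subseteq> X" using flag_incident[OF F] by (cases "X = Y") (auto simp: inc)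
    moreover have "X \<in> elements ?G" "Y \<in> elements ?G" using flag_element[OF F(1)] F by auto
    ultimately show "X = Y" using le[of X Y] le[of Y X] XY by (simp add: elts ty)
  next
    fix L W P Q U
    assume *: "L \<in> elements ?G" "type_of ?G L = 2" "W \<in> elements ?G" "type_of ?G W = n"
      "P \<in> pencil ?G 1 L" "Q \<in> pencil ?G 1 L" "U \<in> pencil ?G 1 L" "P \<noteq> Q"
      "lift_incident K0 P W" "lift_incident K0 Q W"
    have L: "subspace L" "dim L = 2" and W: "subspace W" using *(1-3) by (simp_all add: elts ty)
    show "lift_incident K0 U W"
      using pen[OF *(5,1)] pen[OF *(6,1)] pen[OF *(7,1)] L W *(8-10)
      by - (rule lift_incident_pencil[of P Q L], simp_all)
  next
    fix L U H1 H2 H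
    assume *: "L \<in> elements ?G" "type_of ?G L = n - 1" "U \<in> elements ?G" "type_of ?G U = 1"
      "H1 \<in> pencil ?G n L" "H2 \<in> pencil ?G n L" "H \<in> pencil ?G n L" "H1 \<noteq> H2"
      "lift_incident K0 U H1" "lift_incident K0 U H2"
    have L: "subspace L" "dim L = n - 1" using *(1,2) by (simp_all add: elts ty)
    have sub: "L \<subseteq> H1" "L \<subseteq> H2" "L \<subseteq> H"
      and s: "subspace H1" "subspace H2" "subspace L" "dim H1 = n" "dim H2 = n" "dim L = n - 1"
      using pen[OF *(5,1)] pen[OF *(6,1)] pen[OF *(7,1)] L by simp_all
    \<comment> \<open>Two distinct hyperplanes of the pencil intersect in its base, so lifts lying
      in both lie in \<open>L\<close> and hence in every member.\<close>
    have "L = H1 \<inter> H2"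
      using sub s dim_Int_less[OF s(1,2)] \<open>H1 \<noteq> H2\<close> subspace_Int by (intro dim_eq_imp_eq) auto
    then show "lift_incident K0 U H" using *(9,10) sub(3) unfolding lift_incident_def by blast
  qed (use n in \<open>auto simp: fr_def A_building_def\<close>)
  moreover have "lift_incident K0 U H"
    if "P \<in> rational_points E (n + 1) K0 ?G {1, n}" "U \<in> P" "H \<in> P" "type_of ?G U = 1" "type_of ?G H = n"
    for P U H
  proof (rule lift_incident_rational)
    show "rational_subspace E (n + 1) K0 U" using that by (auto simp: rational_points_def)
    have F: "flag ?G P" using that by (auto simp: rational_points_def gr_points_def flags_of_type_def)
    have "U \<noteq> H" using that n by (auto simp: ty)
    then have "U \<subseteq> H \<or> H \<subseteq> U" using flag_incident[OF F that(2,3)] by (simp add: inc)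
    then show "U \<subseteq> H"
      using that n flag_element[OF F that(2)] flag_element[OF F that(3)]
      by (intro le) (auto simp: elts ty)
  qed
  moreover obtain a where a: "a \<notin> K0" using K0 by auto
  \<comment> \<open>\<open>U\<close> is spanned by \<open>E 1 + E 2 \<cdot> a\<close>, and
    \<open>H\<close> adds \<open>E 3, ..., E (n + 1)\<close>. A form with \<open>f 1 = 0\<close> and
    \<open>f a = 1\<close> sends the generator of \<open>U\<close> to \<open>E 2\<close>, which
    violates the equation \<open>co v 2 = a * co v 1\<close> valid on \<open>H\<close>.\<close>
  define g where "g i = (if i = 1 then E 1 + E 2 \<cdot> a else E (i + 1))" for i :: nat
  define H where "H = span (g ` {1..n})"
  define U where "U = span (g ` {1})"
  have dims: "dim H = n" "dim U = 1"
    using dim_span_family[of "{1..n}" g "\<lambda>i. if i = 1 then 1 else i + 1"]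
      dim_span_family[of "{1}" g "\<lambda>i. 1"] n
    by (auto simp: H_def U_def g_def co_add co_scale co_E)
  have UH: "U \<subseteq> H" unfolding U_def H_def using n by (intro span_mono) auto
  have "{U, H} \<in> gr_points ?G {1, n}"
    using UH dims n
    by (auto simp: gr_points_def flags_of_type_def flag_def pairwise_def elts ty inc U_def H_def subspace_span)
  moreover have "\<not> lift_incident K0 U H"
  proof
    assume *: "lift_incident K0 U H"
    obtain f where f: "left_linear K0 f" "f 1 = 0" "f a = 1"
      using exists_left_linear_separating[OF K0(1) a] .
    have "g 1 \<in> U" by (simp add: U_def span_base)
    then have "lift f (g 1) \<in> H" using * f by (auto simp: lift_incident_def)
    moreover have "lift f (g 1) = E 2"
      using f n by (intro co_eqI) (auto simp: co_lift g_def co_add co_scale co_E left_linear_0)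
    moreover have "H \<subseteq> {v \<in> UNIV. co v 2 - a * co v 1 = 0}"
      unfolding H_def
    proof (rule span_minimal)
      show "g ` {1..n} \<subseteq> {v \<in> UNIV. co v 2 - a * co v 1 = 0}"
        using n by (auto simp: g_def co_add co_scale co_E)
      show "subspace {v \<in> UNIV. co v 2 - a * co v 1 = 0}"
        by (rule subspace_kernel[OF _ subspace_UNIV])
          (simp add: linear_form_def co_add co_scale, simp add: algebra_simps)
    qed
    ultimately show False using n by (auto simp: co_E)
  qed
  ultimately show ?thesis
    using dims by (intro not_rationally_generatedI[where P = "{U, H}" and x = U and y = H]) (auto simp: ty)
qed

section \<open>Hyperbolic quadrics\<close>

text \<open>Commutativity is a locale assumption on a division ring, so that the linear algebra
  above serves both types of building.\<close>

locale hyperbolic_quadric = fin_dim_rvs scale E "2 * n"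
  for scale :: "'v::ab_group_add \<Rightarrow> 'k::division_ring \<Rightarrow> 'v" (infixl "\<cdot>" 75)
    and E :: "nat \<Rightarrow> 'v" and n :: nat +
  assumes mult_comm: "(x::'k) * y = y * x"
begin

lemma mult_left_comm: "(x::'k) * (y * z) = y * (x * z)"
  by (metis mult.assoc mult_comm)

lemmas comm_simps = mult_comm mult_left_comm mult.assoc

abbreviation q :: "'v \<Rightarrow> 'k" where "q \<equiv> quad_form E n"

text \<open>The polarization of \<open>q\<close>, written without dividing by 2. In characteristic 2
  \<open>polar v v = 0\<close> for every \<open>v\<close>, so singularity remains a condition on
  \<open>q\<close> itself.\<close>

definition polar :: "'v \<Rightarrow> 'v \<Rightarrow> 'k" where
  "polar v w = (\<Sum>i=1..n. co v (2 * i - 1) * co w (2 * i) + co v (2 * i) * co w (2 * i - 1))"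

lemma polar_sym: "polar v w = polar w v"
  unfolding polar_def by (rule sum.cong) (simp_all add: add.commute mult_comm)

lemma polar_add_right: "polar v (w + u) = polar v w + polar v u"
  by (simp add: polar_def co_add sum.distrib distrib_left)

lemma polar_add_left: "polar (w + u) v = polar w v + polar u v"
  by (simp add: polar_sym[of _ v] polar_add_right)

lemma polar_scale_right: "polar v (w \<cdot> a) = polar v w * a"
  by (simp add: polar_def co_scale sum_distrib_right distrib_right mult.assoc)

lemma polar_scale_left: "polar (w \<cdot> a) v = polar w v * a"
  by (simp add: polar_sym[of _ v] polar_scale_right)

lemma linear_form_polar: "linear_form (polar v)"
  by (simp add: linear_form_def polar_add_right polar_scale_right)

lemma polar_0_right [simp]: "polar v 0 = 0"
  using linear_form_0[OF linear_form_polar] .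

lemma polar_diff_right: "polar v (w - u) = polar v w - polar v u"
  using linear_form_diff[OF linear_form_polar] .

lemma polar_diff_left: "polar (w - u) v = polar w v - polar u v"
  by (simp add: polar_sym[of _ v] polar_diff_right)

lemma quad_form_add: "q (v + w) = q v + q w + polar v w"
proof -
  have "q (v + w) = (\<Sum>i=1..n. co v (2 * i - 1) * co v (2 * i) + co w (2 * i - 1) * co w (2 * i)
      + (co v (2 * i - 1) * co w (2 * i) + co v (2 * i) * co w (2 * i - 1)))"
    unfolding quad_form_def
    by (rule sum.cong) (simp_all add: co_add distrib_left distrib_right add.assoc add.commute
        add.left_commute mult_comm)
  then show ?thesis by (simp add: quad_form_def polar_def sum.distrib)
qed

lemma quad_form_scale: "q (v \<cdot> a) = q v * (a * a)"
  unfolding quad_form_def sum_distrib_right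
  by (rule sum.cong) (simp_all add: co_scale comm_simps)

lemma quad_form_0 [simp]: "q 0 = 0"
  using quad_form_scale[of 0 0] by simp

lemma totally_singularD:
  assumes "totally_singular E n U"
  shows "subspace U" "v \<in> U \<Longrightarrow> q v = 0" "v \<in> U \<Longrightarrow> w \<in> U \<Longrightarrow> polar v w = 0"
proof -
  show "subspace U" "v \<in> U \<Longrightarrow> q v = 0" for v
    using assms by (auto simp: totally_singular_def)
  then show "v \<in> U \<Longrightarrow> w \<in> U \<Longrightarrow> polar v w = 0"
    using quad_form_add[of v w] subspace_add[of U v w] by simp
qed

lemma max_singularD:
  assumes "X \<in> max_singular E n"
  shows "totally_singular E n X" "subspace X" "dim X = n"
    "v \<in> X \<Longrightarrow> q v = 0" "v \<in> X \<Longrightarrow> w \<in> X \<Longrightarrow> polar v w = 0"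
  using assms totally_singularD by (auto simp: max_singular_def)

lemma subspace_perp: "subspace {v. polar w v = 0}"
  using subspace_kernel[OF linear_form_polar subspace_UNIV] by simp

lemma polar_span: "(\<And>v. v \<in> B \<Longrightarrow> polar w v = 0) \<Longrightarrow> v \<in> span B \<Longrightarrow> polar w v = 0"
  using span_minimal[OF _ subspace_perp, of B w] by auto

lemma totally_singular_span:
  assumes "\<And>v. v \<in> B \<Longrightarrow> q v = 0" "\<And>v w. v \<in> B \<Longrightarrow> w \<in> B \<Longrightarrow> polar v w = 0"
  shows "totally_singular E n (span B)"
proof -
  have perp: "polar v w = 0" if "v \<in> span B" "w \<in> span B" for v w
  proof -
    have "polar w v = 0" if "w \<in> B" for w using polar_span[OF assms(2)[OF that] \<open>v \<in> span B\<close>] .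
    then show ?thesis using polar_span[of B v w] that polar_sym by metis
  qed
  have "subspace {v \<in> span B. q v = 0}"
    using subspace_span[of B] perp
    by (auto simp: subspace_def quad_form_add quad_form_scale)
  then have "span B \<subseteq> {v \<in> span B. q v = 0}"
    using assms(1) by (intro span_minimal) (auto intro: span_base)
  then show ?thesis using subspace_span by (auto simp: totally_singular_def)
qed

lemma pair_index: "i \<in> {1..n} \<Longrightarrow> 2 * i - 1 \<in> {1..2 * n}" "i \<in> {1..n} \<Longrightarrow> 2 * i \<in> {1..2 * n}"
  by auto

lemma pair_index_eq:
  fixes i j :: nat
  assumes "1 \<le> i" "1 \<le> j"
  shows "2 * i - 1 = 2 * j - 1 \<longleftrightarrow> i = j" "2 * i - 1 \<noteq> 2 * j" "2 * i \<noteq> 2 * j - 1"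
  using assms by presburger+

lemma polar_E:
  assumes "i \<in> {1..n}"
  shows "polar v (E (2 * i)) = co v (2 * i - 1)" "polar v (E (2 * i - 1)) = co v (2 * i)"
proof -
  have "polar v (E (2 * i)) = (\<Sum>j=1..n. if j = i then co v (2 * i - 1) else 0)"
    unfolding polar_def
    by (rule sum.cong) (auto simp: co_E[OF pair_index(2)[OF assms]] pair_index_eq)
  then show "polar v (E (2 * i)) = co v (2 * i - 1)" using assms by simp
  have "polar v (E (2 * i - 1)) = (\<Sum>j=1..n. if j = i then co v (2 * i) else 0)"
    unfolding polar_def
    using assms by (intro sum.cong) (auto simp: co_E[OF pair_index(1)[OF assms]] pair_index_eq)
  then show "polar v (E (2 * i - 1)) = co v (2 * i)" using assms by simp
qed

lemma pair_cases:
  fixes m :: nat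
  assumes "m \<in> {1..2 * n}"
  obtains i where "i \<in> {1..n}" "m = 2 * i - 1" | i where "i \<in> {1..n}" "m = 2 * i"
proof (cases "even m")
  case True
  then obtain i where "m = 2 * i" by auto
  then show ?thesis using assms that(2)[of i] by simp
next
  case False
  then obtain i where "m = 2 * i + 1" by (auto elim: oddE)
  then show ?thesis using assms that(1)[of "i + 1"] by simp
qed

lemma polar_nondegenerate:
  assumes "\<And>w. polar v w = 0"
  shows "v = 0"
proof (rule co_eqI)
  fix m assume "m \<in> {1..2 * n}"
  then show "co v m = co 0 m"
    by (cases rule: pair_cases) (metis polar_E assms co_0)+
qed

text \<open>\<open>J\<close> picks one coordinate from each hyperbolic pair. The same choice
  describes the coordinate subspaces opposite a given one and, later, the coefficient with which
  pair \<open>i\<close> of a vector contributes to the monomial of \<open>J\<close> in the Clifford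
  action.\<close>

definition sel :: "nat set \<Rightarrow> nat \<Rightarrow> 'v \<Rightarrow> 'k" where
  "sel J i v = co v (if i \<in> J then 2 * i - 1 else 2 * i)"

lemma linear_form_sel: "linear_form (sel J i)"
  unfolding sel_def by (rule linear_form_co)

lemma sel_add: "sel J i (v + w) = sel J i v + sel J i w"
  and sel_scale: "sel J i (v \<cdot> a) = sel J i v * a"
  and sel_diff: "sel J i (v - w) = sel J i v - sel J i w"
  by (auto simp: sel_def co_add co_scale co_diff)

lemma polar_term_0:
  assumes "sel J i v = 0" "sel J i w = 0"
  shows "co v (2 * i - 1) * co w (2 * i) + co v (2 * i) * co w (2 * i - 1) = 0"
  using assms by (auto simp: sel_def split: if_splits)

lemma polar_sel_0:
  "(\<And>i. i \<in> {1..n} \<Longrightarrow> sel J i v = 0) \<Longrightarrow> (\<And>i. i \<in> {1..n} \<Longrightarrow> sel J i w = 0) \<Longrightarrow> polar v w = 0"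
  unfolding polar_def by (intro sum.neutral ballI polar_term_0) auto

text \<open>The coordinate subspace \<open>{v. \<forall>j. sel J j v = 0}\<close> is totally singular. It is chosen disjoint
  from \<open>X\<close> greedily, one hyperbolic pair at a time: if both choices for a pair fail, the two
  offending vectors of \<open>X\<close> are not orthogonal.\<close>

lemma opposite_frame_exists:
  assumes X: "totally_singular E n X" and C: "C \<subseteq> {1..n}"
    and disj: "\<And>x. \<lbrakk>x \<in> X; \<And>j. j \<in> C \<Longrightarrow> co x (2 * j - 1) = 0;
      \<And>j. j \<in> {1..n} - C \<Longrightarrow> co x (2 * j - 1) = 0 \<and> co x (2 * j) = 0\<rbrakk> \<Longrightarrow> x = 0"
  obtains J where "C \<subseteq> J" "J \<subseteq> {1..n}" "\<And>x. \<lbrakk>x \<in> X; \<And>j. j \<in> {1..n} \<Longrightarrow> sel J j x = 0\<rbrakk> \<Longrightarrow> x = 0"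
proof -
  \<comment> \<open>\<open>D\<close> collects the pairs decided beyond \<open>C\<close>. The vectors
    tested vanish completely on undecided pairs, so the condition starts as \<open>disj\<close> and
    ends as the full claim.\<close>
  let ?ok = "\<lambda>J D. \<forall>x\<in>X. (\<forall>j\<in>C \<union> D. sel J j x = 0) \<longrightarrow>
    (\<forall>j\<in>{1..n} - (C \<union> D). co x (2 * j - 1) = 0 \<and> co x (2 * j) = 0) \<longrightarrow> x = 0"
  have "\<exists>J. C \<subseteq> J \<and> J \<subseteq> C \<union> D \<and> ?ok J D" if "finite D" "D \<subseteq> {1..n} - C" for D
    using that
  proof (induction D rule: finite_induct)
    case empty
    have "?ok C {}"
    proof (intro ballI impI)
      fix x assume "x \<in> X" "\<forall>j\<in>C \<union> {}. sel C j x = 0"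
        "\<forall>j\<in>{1..n} - (C \<union> {}). co x (2 * j - 1) = 0 \<and> co x (2 * j) = 0"
      then show "x = 0" by (intro disj) (auto simp: sel_def)
    qed
    then show ?case by blast
  next
    case (insert i D)
    then obtain J where J: "C \<subseteq> J" "J \<subseteq> C \<union> D" and ok: "?ok J D" by auto
    have i: "i \<in> {1..n}" "i \<notin> C \<union> D" "i \<notin> J" using insert J by auto
    have "?ok J (insert i D) \<or> ?ok (insert i J) (insert i D)"
    proof (rule ccontr)
      assume "\<not> ?thesis"
      then have n1: "\<not> ?ok J (insert i D)" and n2: "\<not> ?ok (insert i J) (insert i D)" by blast+
      obtain x where
        x: "x \<in> X" "x \<noteq> 0" "\<forall>j\<in>C \<union> insert i D. sel J j x = 0"
          "\<forall>j\<in>{1..n} - (C \<union> insert i D). co x (2 * j - 1) = 0 \<and> co x (2 * j) = 0"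
        using n1 by blast
      obtain y where
        y: "y \<in> X" "y \<noteq> 0" "\<forall>j\<in>C \<union> insert i D. sel (insert i J) j y = 0"
          "\<forall>j\<in>{1..n} - (C \<union> insert i D). co y (2 * j - 1) = 0 \<and> co y (2 * j) = 0"
        using n2 by blast
      have yJ: "sel J j y = 0" if "j \<in> C \<union> D" for j
        using y(3) that i by (auto simp: sel_def split: if_splits)
      have xi: "co x (2 * i) = 0" and yi: "co y (2 * i - 1) = 0"
        using x(3) y(3) i by (auto simp: sel_def)
      \<comment> \<open>On every other decided pair \<open>x\<close> and \<open>y\<close> have a
        common vanishing coordinate, and on undecided pairs both vanish; only one product from pair
        \<open>i\<close> survives.\<close>
      have "polar x y = (\<Sum>j=1..n. if j = i then co x (2 * i - 1) * co y (2 * i) else 0)"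
        unfolding polar_def
      proof (rule sum.cong[OF refl])
        fix j assume "j \<in> {1..n}"
        then consider "j = i" | "j \<in> C \<union> D" "j \<noteq> i" | "j \<in> {1..n} - (C \<union> insert i D)" "j \<noteq> i"
          using i by auto
        then show "co x (2 * j - 1) * co y (2 * j) + co x (2 * j) * co y (2 * j - 1) =
          (if j = i then co x (2 * i - 1) * co y (2 * i) else 0)"
        proof cases
          case 2
          then show ?thesis using polar_term_0[of J j x y] x(3) yJ by auto
        qed (use x y xi yi in auto)
      qed
      then have "co x (2 * i - 1) * co y (2 * i) = 0"
        using i totally_singularD(3)[OF X x(1) y(1)] by simp
      then have "co x (2 * i - 1) = 0 \<or> co y (2 * i) = 0" by simp
      then show False
      proof
        assume "co x (2 * i - 1) = 0"
        then have "x = 0" using ok x xi by auto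
        then show False using x by simp
      next
        assume "co y (2 * i) = 0"
        then have "y = 0" using ok y yi yJ by auto
        then show False using y by simp
      qed
    qed
    then show ?case
    proof
      assume "?ok J (insert i D)"
      moreover have "C \<subseteq> J \<and> J \<subseteq> C \<union> insert i D" using J by auto
      ultimately show ?thesis by blast
    next
      assume "?ok (insert i J) (insert i D)"
      moreover have "C \<subseteq> insert i J \<and> insert i J \<subseteq> C \<union> insert i D" using J by auto
      ultimately show ?thesis by blast
    qed
  qed
  from this[of "{1..n} - C"] obtain J where J: "C \<subseteq> J" "J \<subseteq> C \<union> ({1..n} - C)" "?ok J ({1..n} - C)"
    by auto
  have "C \<union> ({1..n} - C) = {1..n}" using C by auto
  then show ?thesis using J that[of J] by auto
qed

text \<open>Dimension count for \<open>v\<close> outside \<open>X\<close>: \<open>n\<close> linear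
  conditions on the \<open>(n + 1)\<close>-dimensional span of \<open>v\<close> and \<open>X\<close>
  leave a nonzero \<open>u\<close>. Its coefficient at \<open>v\<close> is nonzero because
  \<open>X\<close> meets the coordinate subspace trivially, and dividing by it decomposes
  \<open>v\<close>.\<close>

lemma opposite_frame_decompose:
  assumes X: "X \<in> max_singular E n"
    and opp: "\<And>x. \<lbrakk>x \<in> X; \<And>j. j \<in> {1..n} \<Longrightarrow> sel J j x = 0\<rbrakk> \<Longrightarrow> x = 0"
  obtains x where "x \<in> X" "\<And>j. j \<in> {1..n} \<Longrightarrow> sel J j (v - x) = 0"
proof (cases "v \<in> X")
  case True
  then show ?thesis using that[of v] by (simp add: sel_def)
next
  case False
  note X' = max_singularD[OF X]
  let ?U = "span (insert v X)" let ?K = "{u \<in> ?U. \<forall>j\<in>{1..n}. sel J j u = 0}"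
  have "dim ?U \<le> dim ?K + card {1..n}" "subspace ?K"
    using dim_common_kernel[of "{1..n}" "sel J" ?U] linear_form_sel subspace_span by auto
  moreover have "dim ?U = n + 1" using dim_span_insert[OF X'(2) False] X'(3) by simp
  ultimately have "1 \<le> dim ?K" by simp
  moreover have "dim {0} = 0"
    using dim_span_independent[OF independent_empty] by (simp add: span_empty)
  ultimately have "?K \<noteq> {0}" by auto
  then obtain u where u: "u \<in> ?K" "u \<noteq> 0" using subspace_0[OF \<open>subspace ?K\<close>] by blast
  then obtain x a where xa: "u = x + v \<cdot> a" "x \<in> X"
    unfolding span_insert span_subspace[OF X'(2)] by blast
  have "a \<noteq> 0"
  proof
    assume "a = 0"
    then have "u \<in> X" using xa by simp
    then show False using opp[of u] u by auto
  qed
  let ?x = "- (x \<cdot> inverse a)"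
  have "v - ?x = u \<cdot> inverse a"
    using \<open>a \<noteq> 0\<close> by (simp add: xa scale_left_distrib scale_scale scale_one)
  then have "sel J j (v - ?x) = 0" if "j \<in> {1..n}" for j using u that by (simp add: sel_scale)
  then show ?thesis using that[of ?x] xa X' by (simp add: subspace_neg subspace_scale)
qed

text \<open>Decomposing \<open>w\<close> against an opposite coordinate subspace leaves
  \<open>w - x\<close> orthogonal to \<open>X\<close> and to that subspace, thus to
  everything.\<close>

lemma max_singular_perp:
  assumes X: "X \<in> max_singular E n" and w: "\<And>x. x \<in> X \<Longrightarrow> polar w x = 0"
  shows "w \<in> X"
proof -
  note X' = max_singularD[OF X]
  obtain J where J: "\<And>x. \<lbrakk>x \<in> X; \<And>j. j \<in> {1..n} \<Longrightarrow> sel J j x = 0\<rbrakk> \<Longrightarrow> x = 0"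
  proof (rule opposite_frame_exists[OF X'(1), of "{}"])
    fix x assume "x \<in> X" "\<And>j. j \<in> {1..n} - {} \<Longrightarrow> co x (2 * j - 1) = 0 \<and> co x (2 * j) = 0"
    then show "x = 0" by (intro co_eqI) (metis pair_cases co_0 Diff_empty)
  qed auto
  obtain x where x: "x \<in> X" "\<And>j. j \<in> {1..n} \<Longrightarrow> sel J j (w - x) = 0"
    using opposite_frame_decompose[OF X J] by blast
  have "w - x = 0"
  proof (rule polar_nondegenerate)
    fix v
    obtain y where y: "y \<in> X" "\<And>j. j \<in> {1..n} \<Longrightarrow> sel J j (v - y) = 0"
      using opposite_frame_decompose[OF X J] by blast
    have "polar (w - x) (v - y) = 0" by (rule polar_sel_0[OF x(2) y(2)])
    moreover have "polar (w - x) y = 0" using w y(1) X'(5) x(1) by (simp add: polar_diff_left)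
    ultimately show "polar (w - x) v = 0" by (simp add: polar_diff_right)
  qed
  then show ?thesis using x(1) by simp
qed

lemma not_perp_max_singular:
  assumes "X \<in> max_singular E n" "w \<notin> X"
  obtains x where "x \<in> X" "polar w x = 1"
proof -
  obtain x where x: "x \<in> X" "polar w x \<noteq> 0" using max_singular_perp assms by blast
  then show ?thesis
    using that[of "x \<cdot> inverse (polar w x)"] subspace_scale max_singularD(2)[OF assms(1)]
    by (simp add: polar_scale_right)
qed

section \<open>Parity of intersections of maximal singular subspaces\<close>

lemma span_insert_eq:
  assumes "subspace W" "subspace Y" "W \<subseteq> Y" "y \<in> Y" "y \<notin> W" "dim Y \<le> dim W + 1"
  shows "span (insert y W) = Y"
  using assms dim_span_insert[of W y] by (intro dim_eq_imp_eq span_minimal subspace_span) auto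

text \<open>A vector of \<open>Y2 \<inter> M\<close> is orthogonal to \<open>W\<close> and to
  \<open>m\<close>, hence to \<open>Y1\<close>, hence lies in \<open>Y1\<close>. So
  \<open>Y2 \<inter> M\<close> shrinks to \<open>W \<inter> M\<close>, while
  \<open>Y1 \<inter> M\<close> has the extra vector \<open>m\<close>.\<close>

lemma adjacent_max_singular_dims:
  assumes Y1: "Y1 \<in> max_singular E n" and Y2: "Y2 \<in> max_singular E n" and M: "M \<in> max_singular E n"
    and W: "W = Y1 \<inter> Y2" "n \<le> dim W + 1" "Y1 \<noteq> Y2"
    and m: "m \<in> M" "m \<in> Y1" "m \<notin> W"
  shows "dim (Y1 \<inter> M) = dim (Y2 \<inter> M) + 1"
proof -
  note sub = max_singularD(2)[OF Y1] max_singularD(2)[OF Y2] max_singularD(2)[OF M]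
  have sW: "subspace W" using sub W subspace_Int by simp
  have Y1_eq: "span (insert m W) = Y1"
    using m W sW sub max_singularD(3)[OF Y1] by (intro span_insert_eq) auto
  have "Y2 \<inter> M \<subseteq> W"
  proof
    fix y assume y: "y \<in> Y2 \<inter> M"
    have "polar y v = 0" if "v \<in> Y1" for v
    proof (rule polar_span)
      show "v \<in> span (insert m W)" using that Y1_eq by simp
      fix u assume "u \<in> insert m W"
      then show "polar y u = 0"
        using y m(1) W(1) max_singularD(5)[OF M] max_singularD(5)[OF Y2] by auto
    qed
    then show "y \<in> W" using max_singular_perp[OF Y1] y W by auto
  qed
  then have Y2M: "Y2 \<inter> M = W \<inter> M" using W by auto
  have "Y1 \<inter> M = span (insert m (W \<inter> M))"
  proof
    show "span (insert m (W \<inter> M)) \<subseteq> Y1 \<inter> M"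
      using m W sub subspace_Int by (intro span_minimal) auto
    show "Y1 \<inter> M \<subseteq> span (insert m (W \<inter> M))"
    proof
      fix y assume y: "y \<in> Y1 \<inter> M"
      then have "y \<in> span (insert m W)" using Y1_eq by simp
      then obtain w a where wa: "y = w + m \<cdot> a" "w \<in> W"
        unfolding span_insert span_subspace[OF sW] by blast
      have "y - m \<cdot> a \<in> M" using y m sub by (simp add: subspace_diff subspace_scale)
      then have "w \<in> W \<inter> M" using wa by simp
      then show "y \<in> span (insert m (W \<inter> M))"
        using wa span_base[of w "W \<inter> M"] unfolding span_insert by blast
    qed
  qed
  then show ?thesis using dim_span_insert[of "W \<inter> M" m] m sW sub subspace_Int Y2M by simp
qed

text \<open>The orthogonal space of \<open>Y1 \<inter> Y2\<close> modulo this intersection is a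
  hyperbolic plane, whose only singular points come from \<open>Y1\<close> and \<open>Y2\<close>.
  \<open>M\<close> contains a vector orthogonal to the intersection and outside it, so the
  dimensions in which \<open>M\<close> meets \<open>Y1\<close> and \<open>Y2\<close> differ by
  one.\<close>

lemma adjacent_classes_differ:
  assumes Y1: "Y1 \<in> max_singular E n" and Y2: "Y2 \<in> max_singular E n" and M: "M \<in> max_singular E n"
    and dim_W: "dim (Y1 \<inter> Y2) = n - 1" and n: "1 \<le> n"
  shows "same_class Y1 M \<noteq> same_class Y2 M"
proof -
  note sub = max_singularD(2)[OF Y1] max_singularD(2)[OF Y2] max_singularD(2)[OF M]
  note dims = max_singularD(3)[OF Y1] max_singularD(3)[OF Y2] max_singularD(3)[OF M]
  define W where "W = Y1 \<inter> Y2"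
  have sW: "subspace W" using sub subspace_Int by (simp add: W_def)
  have ne: "Y1 \<noteq> Y2" using dim_W dims n by auto
  then obtain y2 where y2: "y2 \<in> Y2" "y2 \<notin> Y1" using dim_eq_imp_eq[of Y2 Y1] sub dims by auto
  obtain y1 where y1: "y1 \<in> Y1" "polar y2 y1 = 1" using not_perp_max_singular[OF Y1 y2(2)] .
  have "y1 \<notin> Y2" using y1 y2 max_singularD(5)[OF Y2] by auto
  then have Y_eq: "span (insert y1 W) = Y1" "span (insert y2 W) = Y2"
    using span_insert_eq[OF sW sub(1), of y1] span_insert_eq[OF sW sub(2), of y2] y1 y2 dims dim_W
    unfolding W_def by auto
  obtain A where A: "basis_of (M \<inter> W) A" using basis_exists subspace_Int sub(3) sW by blast
  have "independent A" "A \<subseteq> M \<inter> W" using A span_superset[of A] by (auto simp: basis_of_def)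
  then obtain B where B: "A \<subseteq> B" "basis_of W B" using basis_extend[OF sW] by blast
  have "finite B" using B independent_bound by (auto simp: basis_of_def)
  \<comment> \<open>Orthogonality to \<open>B - A\<close> is enough, since \<open>A\<close> lies in
    \<open>M\<close>. These are \<open>n - 1 - dim (M \<inter> W)\<close> conditions, so
    \<open>?K\<close> is larger than \<open>M \<inter> W\<close>.\<close>
  let ?K = "{v \<in> M. \<forall>w\<in>B - A. polar w v = 0}"
  have K: "dim M \<le> dim ?K + card (B - A)" "subspace ?K"
    using dim_common_kernel[of "B - A" polar M] \<open>finite B\<close> linear_form_polar sub by auto
  have "card (B - A) + card A = card B"
    using \<open>finite B\<close> B(1) card_Diff_subset[of A B] card_mono[of B A] finite_subset by fastforce
  then have "dim (M \<inter> W) < dim ?K"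
    using K(1) dims dim_basis[OF A] dim_basis[OF B(2)] dim_W n by (simp add: W_def)
  then have "\<not> ?K \<subseteq> M \<inter> W" using dim_mono[OF K(2) subspace_Int[OF sub(3) sW]] by auto
  then obtain m where m: "m \<in> M" "m \<notin> W" "\<And>w. w \<in> B - A \<Longrightarrow> polar w m = 0" by blast
  have mW: "polar m w = 0" if "w \<in> W" for w
  proof (rule polar_span)
    show "w \<in> span B" using that B by (simp add: basis_of_def)
    fix b assume "b \<in> B"
    then show "polar m b = 0"
      using m \<open>A \<subseteq> M \<inter> W\<close> max_singularD(5)[OF M] polar_sym by (cases "b \<in> A") auto
  qed
  \<comment> \<open>What remains of \<open>m\<close> after removing its part in the plane of
    \<open>y1\<close> and \<open>y2\<close>; as \<open>polar y1 y2 = 1\<close>, the coefficient of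
    \<open>y1\<close> is the product with \<open>y2\<close> and conversely.\<close>
  let ?w = "m - y1 \<cdot> polar m y2 - y2 \<cdot> polar m y1"
  have perp: "polar y1 y1 = 0" "polar y2 y2 = 0" "polar y1 y2 = 1"
    "\<And>w. w \<in> W \<Longrightarrow> polar y1 w = 0" "\<And>w. w \<in> W \<Longrightarrow> polar y2 w = 0"
    using y1 y2 max_singularD(5)[OF Y1] max_singularD(5)[OF Y2] polar_sym by (auto simp: W_def)
  have "?w \<in> Y1"
  proof (rule max_singular_perp[OF Y1])
    fix x assume "x \<in> Y1"
    then have "x \<in> span (insert y1 W)" using Y_eq by simp
    then show "polar ?w x = 0"
      by (rule polar_span[rotated]) (use y1 perp mW polar_sym in \<open>auto simp: polar_diff_left polar_scale_left polar_diff_right polar_scale_right\<close>)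
  qed
  moreover have "?w \<in> Y2"
  proof (rule max_singular_perp[OF Y2])
    fix x assume "x \<in> Y2"
    then have "x \<in> span (insert y2 W)" using Y_eq by simp
    then show "polar ?w x = 0"
      by (rule polar_span[rotated]) (use y1 perp mW polar_sym in \<open>auto simp: polar_diff_left polar_scale_left polar_diff_right polar_scale_right\<close>)
  qed
  ultimately have wW: "?w \<in> W" by (simp add: W_def)
  define c d where "c = polar m y2" and "d = polar m y1"
  have m_eq: "m = ?w + (y1 \<cdot> c + y2 \<cdot> d)" by (simp add: c_def d_def)
  have "q ?w = 0" "q y1 = 0" "q y2 = 0"
    using wW y1 y2 max_singularD(4)[OF Y1] max_singularD(4)[OF Y2] by (auto simp: W_def)
  moreover have "polar ?w (y1 \<cdot> c + y2 \<cdot> d) = 0"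
    using perp(4,5)[OF wW]
    by (simp add: polar_add_right polar_scale_right polar_sym[of _ y1] polar_sym[of _ y2])
  ultimately have "q m = c * d"
    by (subst m_eq, simp only: quad_form_add quad_form_scale polar_scale_left polar_scale_right perp)
      (simp add: mult_comm)
  then have "c = 0 \<or> d = 0" using max_singularD(4)[OF M m(1)] by simp
  then have "m \<in> Y1 \<or> m \<in> Y2"
    using m_eq wW y1 y2 sub unfolding W_def
    by (metis IntD1 IntD2 add_0 add.right_neutral scale_zero_right subspace_add subspace_scale)
  then have "dim (Y1 \<inter> M) = dim (Y2 \<inter> M) + 1 \<or> dim (Y2 \<inter> M) = dim (Y1 \<inter> M) + 1"
    using adjacent_max_singular_dims[OF Y1 Y2 M, of W m] adjacent_max_singular_dims[OF Y2 Y1 M, of W m]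
      m ne dim_W n by (auto simp: W_def Int_commute)
  moreover have "dim (Y1 \<inter> M) \<le> n" "dim (Y2 \<inter> M) \<le> n"
    using dim_mono[of "Y1 \<inter> M" Y1] dim_mono[of "Y2 \<inter> M" Y2] sub dims subspace_Int by auto
  ultimately show ?thesis unfolding same_class_def dims by auto
qed

text \<open>Distinct members of one class cannot meet in dimension \<open>n - 1\<close> by
  \<open>adjacent_classes_differ\<close>, so a common subspace of dimension \<open>n - 2\<close> is
  the whole intersection.\<close>

lemma same_class_Int_eq:
  assumes Y1: "Y1 \<in> max_singular E n" and Y2: "Y2 \<in> max_singular E n" and M: "M \<in> max_singular E n"
    and "same_class Y1 M = same_class Y2 M" "Y1 \<noteq> Y2"
    and U: "subspace U" "dim U = n - 2" "U \<subseteq> Y1" "U \<subseteq> Y2"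
  shows "Y1 \<inter> Y2 = U"
proof -
  note sub = max_singularD(2)[OF Y1] max_singularD(2)[OF Y2]
  have "dim (Y1 \<inter> Y2) < n"
    using dim_Int_less[OF sub] assms max_singularD(3)[OF Y1] max_singularD(3)[OF Y2] by simp
  moreover have "dim (Y1 \<inter> Y2) \<noteq> n - 1"
    using adjacent_classes_differ[OF Y1 Y2 M] calculation assms by auto
  ultimately show ?thesis
    using U sub subspace_Int by (intro dim_eq_imp_eq[symmetric]) auto
qed

end

section \<open>The geometry of type D\<close>

context hyperbolic_quadric
begin

section \<open>An explicit adjacent pair of maximal singular subspaces\<close>

lemma polar_basis: "m \<in> {1..2 * n} \<Longrightarrow> polar v (E m) = co v (if even m then m - 1 else m + 1)"
  by (erule pair_cases) (auto simp: polar_E)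

lemma quad_form_basis: "m \<in> {1..2 * n} \<Longrightarrow> q (E m) = 0"
  unfolding quad_form_def by (intro sum.neutral ballI) (auto simp: co_E pair_index_eq)

text \<open>For \<open>m = 6\<close> these vectors span the annihilator of the pure spinor
  \<open>(1 + a e\<^sub>1 e\<^sub>2) e\<^sub>4 \<dots> e\<^sub>n\<close>; \<open>m = 5\<close> gives an adjacent maximal singular subspace.\<close>

definition frame :: "'k \<Rightarrow> nat \<Rightarrow> nat \<Rightarrow> 'v" where
  "frame a m i = (if i = 1 then E 2 - E 3 \<cdot> a else if i = 2 then E 4 + E 1 \<cdot> a
     else if i = 3 then E m else E (2 * i - 1))"

definition frame_space :: "'k \<Rightarrow> nat \<Rightarrow> 'v set" where
  "frame_space a m = span (frame a m ` {1..n})"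

lemma co_frame:
  assumes "3 \<le> n" "m \<in> {5, 6}" "i \<in> {1..n}"
  shows "co (frame a m i) k =
    (if i = 1 then (if k = 2 then 1 else if k = 3 then - a else 0)
     else if i = 2 then (if k = 4 then 1 else if k = 1 then a else 0)
     else if i = 3 then (if k = m then 1 else 0)
     else if k = 2 * i - 1 then 1 else 0)"
proof -
  have "2 * i - 1 \<in> {1..2 * n}" using pair_index(1)[OF assms(3)] .
  moreover have "m \<in> {1..2 * n}" "1 \<in> {1..2 * n}" "2 \<in> {1..2 * n}" "3 \<in> {1..2 * n}" "4 \<in> {1..2 * n}"
    using assms by auto
  ultimately show ?thesis
    by (simp add: frame_def co_add co_diff co_scale co_E del: atLeastAtMost_iff)
qed

lemma polar_frame:
  assumes "3 \<le> n" "m \<in> {5, 6}" "i \<in> {1..n}"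
  shows "polar v (frame a m i) =
    (if i = 1 then co v 1 - co v 4 * a else if i = 2 then co v 3 + co v 2 * a
     else if i = 3 then co v (if m = 5 then 6 else 5) else co v (2 * i))"
proof -
  have "polar v (E (2 * i - 1)) = co v (2 * i)" using assms(3) by (rule polar_E)
  then show ?thesis
    using assms
    by (auto simp: frame_def polar_basis polar_diff_right polar_add_right polar_scale_right
        One_nat_def[symmetric])
qed

lemma quad_form_frame:
  assumes "3 \<le> n" "m \<in> {5, 6}" "i \<in> {1..n}"
  shows "q (frame a m i) = 0"
proof -
  have eq: "E 2 - E 3 \<cdot> a = E 2 + E 3 \<cdot> (- a)" by (simp add: scale_minus_right)
  have "q (E (2 * i - 1)) = 0" using pair_index(1)[OF assms(3)] by (rule quad_form_basis)
  then show ?thesis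
    using assms unfolding frame_def eq
    by (auto simp: quad_form_basis quad_form_add quad_form_scale polar_scale_right polar_basis co_E)
qed

lemma frame_index_cases:
  assumes "i \<in> {1..n}"
  obtains "i = 1" | "i = 2" | "i = 3" | "4 \<le> i"
  using assms by fastforce

lemma frame_index_simps:
  fixes i j k :: nat
  assumes "4 \<le> i"
  shows "i \<noteq> 1" "i \<noteq> 2" "i \<noteq> 3"
    "k \<le> 6 \<Longrightarrow> 2 * i - 1 \<noteq> k" "k \<le> 6 \<Longrightarrow> k \<noteq> 2 * i - 1"
    "4 \<le> j \<Longrightarrow> 2 * i - 1 = 2 * j - 1 \<longleftrightarrow> i = j" "2 * i - 1 \<noteq> 2 * j" "2 * j \<noteq> 2 * i - 1"
    "k \<le> 6 \<Longrightarrow> 2 * i \<noteq> k" "k \<le> 6 \<Longrightarrow> k \<noteq> 2 * i"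
  using assms by presburger+

lemma dim_frame_span:
  assumes "3 \<le> n" "m \<in> {5, 6}" "I \<subseteq> {1..n}"
  shows "dim (span (frame a m ` I)) = card I"
\<comment> \<open>Each of the coordinates 2, 4, \<open>m\<close> and, for \<open>i \<ge> 4\<close>,
  \<open>2 * i - 1\<close> occurs in just one frame vector.\<close>
proof (rule dim_span_family[where k = "\<lambda>i. if i = 1 then 2 else if i = 2 then 4 else if i = 3 then m else 2 * i - 1"])
  show "finite I" using assms finite_subset by blast
next
  fix i assume "i \<in> I"
  then show "co (frame a m i) (if i = 1 then 2 else if i = 2 then 4 else if i = 3 then m else 2 * i - 1) = 1"
    using assms co_frame[OF assms(1,2), of i a] by auto
next
  fix i j assume ij: "i \<in> I" "j \<in> I" "i \<noteq> j"
  then have "i \<in> {1..n}" "j \<in> {1..n}" using assms by auto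
  then show "co (frame a m j) (if i = 1 then 2 else if i = 2 then 4 else if i = 3 then m else 2 * i - 1) = 0"
    unfolding co_frame[OF assms(1,2) \<open>j \<in> {1..n}\<close>]
    by (cases rule: frame_index_cases[OF \<open>i \<in> {1..n}\<close>]; cases rule: frame_index_cases[OF \<open>j \<in> {1..n}\<close>])
      (use assms(2) ij(3) in \<open>auto simp: frame_index_simps\<close>)
qed

text \<open>The one product that does not vanish term by term is that of the first two frame
  vectors, where \<open>a\<close> and \<open>- a\<close> cancel.\<close>

lemma frame_space_max_singular:
  assumes "3 \<le> n" "m \<in> {5, 6}"
  shows "frame_space a m \<in> max_singular E n"
proof -
  have "totally_singular E n (frame_space a m)"
    unfolding frame_space_def
  proof (rule totally_singular_span)
    show "q v = 0" if "v \<in> frame a m ` {1..n}" for v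
      using that quad_form_frame[OF assms] by auto
    fix v w assume "v \<in> frame a m ` {1..n}" "w \<in> frame a m ` {1..n}"
    then obtain i j where ij: "i \<in> {1..n}" "j \<in> {1..n}" "v = frame a m i" "w = frame a m j" by auto
    show "polar v w = 0"
      unfolding ij polar_frame[OF assms ij(2)] co_frame[OF assms ij(1)]
      by (cases rule: frame_index_cases[OF ij(1)]; cases rule: frame_index_cases[OF ij(2)])
        (use assms(2) in \<open>auto simp: frame_index_simps\<close>)
  qed
  then show ?thesis
    using dim_frame_span[OF assms, of "{1..n}" a] by (simp add: max_singular_def frame_space_def)
qed

lemma frame_in_space: "i \<in> {1..n} \<Longrightarrow> frame a m i \<in> frame_space a m"
  unfolding frame_space_def by (rule span_base) auto

text \<open>All frame vectors but the third are shared, and the third ones \<open>E 5\<close> and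
  \<open>E 6\<close> are not orthogonal, so the spaces differ.\<close>

lemma dim_frame_space_Int:
  assumes "3 \<le> n"
  shows "dim (frame_space a 5 \<inter> frame_space a 6) = n - 1"
proof -
  let ?X = "frame_space a 5" and ?Y = "frame_space a 6"
  have X: "?X \<in> max_singular E n" and Y: "?Y \<in> max_singular E n"
    using frame_space_max_singular assms by auto
  have "E 5 \<in> ?X" "E 6 \<in> ?Y"
    using frame_in_space[of 3 a 5] frame_in_space[of 3 a 6] assms by (auto simp: frame_def)
  moreover have "polar (E 5) (E 6) = 1" using assms by (simp add: polar_basis co_E)
  ultimately have ne: "?X \<noteq> ?Y" using max_singularD(5)[OF X, of "E 5" "E 6"] by auto
  have less: "dim (?X \<inter> ?Y) < n"
    using dim_Int_less[of ?X ?Y] max_singularD(2,3)[OF X] max_singularD(2,3)[OF Y] ne by auto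
  have "frame a 6 ` ({1..n} - {3}) = frame a 5 ` ({1..n} - {3})"
    by (rule image_cong) (auto simp: frame_def)
  moreover have "span (frame a k ` ({1..n} - {3})) \<subseteq> frame_space a k" for k
    unfolding frame_space_def by (intro span_mono image_mono) auto
  ultimately have "span (frame a 5 ` ({1..n} - {3})) \<subseteq> ?X \<inter> ?Y" by (metis le_inf_iff)
  then have "card ({1..n} - {3}) \<le> dim (?X \<inter> ?Y)"
    using dim_frame_span[of 5 "{1..n} - {3}" a] assms max_singularD(2)[OF X] max_singularD(2)[OF Y]
      dim_mono[OF subspace_span subspace_Int] by fastforce
  then show ?thesis using less assms by simp
qed

end

section \<open>Flags and pencils of the building of type D\<close>

locale oriented_quadric = hyperbolic_quadric scale E n
  for scale :: "'v::ab_group_add \<Rightarrow> 'k::division_ring \<Rightarrow> 'v" (infixl "\<cdot>" 75)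
    and E :: "nat \<Rightarrow> 'v" and n :: nat +
  fixes M :: "'v set"
  assumes M: "M \<in> max_singular E n" and n_ge_3: "3 \<le> n"
begin

abbreviation G where "G \<equiv> D_building E n M"
abbreviation Sp where "Sp \<equiv> plus_class E n M"
abbreviation Sm where "Sm \<equiv> minus_class E n M"

lemma class_disjoint: "X \<in> Sp \<Longrightarrow> X \<notin> Sm"
  by (simp add: plus_class_def minus_class_def)

lemma class_max: "X \<in> Sp \<Longrightarrow> X \<in> max_singular E n" "X \<in> Sm \<Longrightarrow> X \<in> max_singular E n"
  by (auto simp: plus_class_def minus_class_def)

lemma elements_D: "X \<in> elements G \<longleftrightarrow> totally_singular E n X \<and> dim X \<in> {1..n - 2} \<or> X \<in> Sp \<or> X \<in> Sm"
  by (auto simp: D_building_def Let_def)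

lemma type_D_Plus: "type_of G X = Plus \<longleftrightarrow> X \<in> Sp"
  and type_D_Minus: "type_of G X = Minus \<longleftrightarrow> X \<in> Sm"
  and type_D_Node: "type_of G X = Node i \<longleftrightarrow> X \<notin> Sp \<and> X \<notin> Sm \<and> dim X = i"
  using class_disjoint by (auto simp: D_building_def Let_def)

lemma incident_D: "incident G X Y \<longleftrightarrow>
    (if X \<in> Sp \<and> Y \<in> Sm \<or> X \<in> Sm \<and> Y \<in> Sp then dim (X \<inter> Y) = n - 1 else X \<subseteq> Y \<or> Y \<subseteq> X)"
  by (simp add: D_building_def Let_def)

lemma fr_D: "fr G j = {i. D_edge n j i}"
  by (simp add: D_building_def Let_def fr_def)

lemma element_subspace: "X \<in> elements G \<Longrightarrow> subspace X"
  using totally_singularD(1) max_singularD(2) class_max by (auto simp: elements_D)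

lemma node_element:
  "X \<in> elements G \<Longrightarrow> type_of G X = Node i \<Longrightarrow> subspace X \<and> dim X = i \<and> i \<in> {1..n - 2}"
  using element_subspace by (auto simp: elements_D type_D_Node)

lemma subset_if_dim_le:
  "subspace X \<Longrightarrow> subspace Y \<Longrightarrow> X \<subseteq> Y \<or> Y \<subseteq> X \<Longrightarrow> dim X \<le> dim Y \<Longrightarrow> X \<subseteq> Y"
  using dim_eq_imp_eq[of Y X] by auto

lemma node_subset:
  assumes "X \<in> elements G" "type_of G X = Node i" "Y \<in> elements G"
    "incident G X Y \<or> incident G Y X" "i \<le> dim Y"
  shows "X \<subseteq> Y"
  using assms node_element[of X i] element_subspace[of Y]
  by (intro subset_if_dim_le) (auto simp: incident_D type_D_Node)

lemma dim_class: "X \<in> Sp \<or> X \<in> Sm \<Longrightarrow> dim X = n"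
  using class_max max_singularD(3) by blast

text \<open>Elements of one class are incident only by inclusion, and equal type forces equal
  dimension.\<close>

lemma flag_type_inj_D:
  assumes F: "flag G F" "X \<in> F" "Y \<in> F" and eq: "type_of G X = type_of G Y"
  shows "X = Y"
proof (rule ccontr)
  assume "X \<noteq> Y"
  then have inc: "incident G X Y" using flag_incident F by metis
  have el: "X \<in> elements G" "Y \<in> elements G" using flag_element F by metis+
  have eq': "X \<in> Sp \<longleftrightarrow> Y \<in> Sp" "X \<in> Sm \<longleftrightarrow> Y \<in> Sm"
    using eq type_D_Plus type_D_Minus by metis+
  then have "X \<subseteq> Y \<or> Y \<subseteq> X" using inc class_disjoint by (auto simp: incident_D)
  moreover have "dim X = dim Y"
  proof (cases "X \<in> Sp \<or> X \<in> Sm")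
    case True
    then show ?thesis using eq' dim_class by metis
  next
    case False
    then show ?thesis using eq eq' type_D_Node by metis
  qed
  ultimately show False
    using subset_if_dim_le[of X Y] subset_if_dim_le[of Y X] el element_subspace \<open>X \<noteq> Y\<close> by auto
qed

lemma pencil_class_Int:
  assumes L: "L \<in> elements G" "type_of G L = Node (n - 2)"
    and Y: "Y1 \<in> pencil G t L" "Y2 \<in> pencil G t L" "Y1 \<noteq> Y2" and t: "t = Plus \<or> t = Minus"
  shows "Y1 \<inter> Y2 = L" "Y1 \<in> max_singular E n" "Y2 \<in> max_singular E n"
proof -
  have el: "Y1 \<in> elements G" "Y2 \<in> elements G" and inc: "incident G Y1 L" "incident G Y2 L"
    and ty: "type_of G Y1 = t" "type_of G Y2 = t"
    using Y by (auto simp: pencil_def)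
  have cls: "Y1 \<in> Sp \<and> Y2 \<in> Sp \<or> Y1 \<in> Sm \<and> Y2 \<in> Sm" using ty t by (auto simp: type_D_Plus type_D_Minus)
  then show max: "Y1 \<in> max_singular E n" "Y2 \<in> max_singular E n" using class_max by auto
  have "L \<subseteq> Y1" "L \<subseteq> Y2"
    using node_subset[OF L el(1)] node_subset[OF L el(2)] inc max max_singularD(3) by auto
  then show "Y1 \<inter> Y2 = L"
    using node_element[OF L] cls Y(3) M
    by (intro same_class_Int_eq[OF max M]) (auto simp: plus_class_def minus_class_def)
qed

lemma pencil_subset:
  assumes L: "L \<in> elements G" "type_of G L = Node (n - 2)" and Y: "Y \<in> pencil G t L" "t = Plus \<or> t = Minus"
  shows "L \<subseteq> Y"
proof -
  have "Y \<in> Sp \<or> Y \<in> Sm" using Y by (auto simp: pencil_def type_D_Plus type_D_Minus)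
  then show ?thesis
    using node_subset[OF L, of Y] Y dim_class by (auto simp: pencil_def)
qed

text \<open>Which of the two spaces belongs to \<open>Sp\<close> depends on \<open>M\<close>, so the
  indices are left open.\<close>

lemma frame_spaces_oriented:
  obtains m m' where "{m, m'} = {5, 6}" "frame_space a m \<in> Sp" "frame_space a m' \<in> Sm"
    "dim (frame_space a m \<inter> frame_space a m') = n - 1"
proof -
  have max: "frame_space a 5 \<in> max_singular E n" "frame_space a 6 \<in> max_singular E n"
    using frame_space_max_singular n_ge_3 by auto
  have d: "dim (frame_space a 5 \<inter> frame_space a 6) = n - 1" by (rule dim_frame_space_Int[OF n_ge_3])
  have "same_class (frame_space a 5) M \<noteq> same_class (frame_space a 6) M"
    using adjacent_classes_differ[OF max M d] n_ge_3 by simp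
  then consider "frame_space a 5 \<in> Sp" "frame_space a 6 \<in> Sm" | "frame_space a 6 \<in> Sp" "frame_space a 5 \<in> Sm"
    using max by (auto simp: plus_class_def minus_class_def)
  then show ?thesis
  proof cases
    case 1
    then show ?thesis using that[of 5 6] d by simp
  next
    case 2
    then show ?thesis using that[of 6 5] d by (simp add: Int_commute insert_commute)
  qed
qed

text \<open>The relation concerns only the elements of types \<open>Node 1\<close> and
  \<open>Minus\<close>, so both Grassmannians are settled at once. The bound
  \<open>4 \<le> n\<close> makes \<open>Node 2\<close> a neighbour of \<open>Node 1\<close>, so that
  points vary along singular lines.\<close>

lemma not_rationally_generated_Node1_Minus:
  assumes K0: "sub_division_ring K0" "K0 \<noteq> UNIV" and n: "4 \<le> n"
    and J: "J = {Node 1, Minus} \<or> J = {Node 1, Plus, Minus}"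
  shows "\<not> rationally_generated E (2 * n) K0 G J"
proof -
  have sub: "gr_subspace G J (related_points G J (Node 1) Minus (lift_incident K0))"
  proof (rule gr_subspace_related_points[where s' = "Node 2" and t' = "Node (n - 2)"])
    show "X = Y" if "flag G F" "X \<in> F" "Y \<in> F" "type_of G X = type_of G Y" for F X Y
      by (rule flag_type_inj_D[OF that])
  next
    fix L W P Q U
    assume *: "L \<in> elements G" "type_of G L = Node 2" "W \<in> elements G" "type_of G W = Minus"
      "P \<in> pencil G (Node 1) L" "Q \<in> pencil G (Node 1) L" "U \<in> pencil G (Node 1) L" "P \<noteq> Q"
      "lift_incident K0 P W" "lift_incident K0 Q W"
    have L: "subspace L" "dim L = 2" using node_element[OF *(1,2)] by auto
    have pen: "subspace V" "dim V = 1" "V \<subseteq> L" if "V \<in> pencil G (Node 1) L" for V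
      using that node_element[of V 1] node_subset[of V 1 L] * L by (auto simp: pencil_def)
    show "lift_incident K0 U W"
      by (rule lift_incident_pencil[of P Q L]) (use pen *(5-10) L element_subspace[OF *(3)] in auto)
  next
    fix L U Y1 Y2 Y
    assume *: "L \<in> elements G" "type_of G L = Node (n - 2)" "U \<in> elements G" "type_of G U = Node 1"
      "Y1 \<in> pencil G Minus L" "Y2 \<in> pencil G Minus L" "Y \<in> pencil G Minus L" "Y1 \<noteq> Y2"
      "lift_incident K0 U Y1" "lift_incident K0 U Y2"
    have "Y1 \<inter> Y2 = L" "L \<subseteq> Y"
      using pencil_class_Int[OF *(1,2,5,6,8)] pencil_subset[OF *(1,2,7)] by auto
    then show "lift_incident K0 U Y" using *(9,10) unfolding lift_incident_def by blast
  qed (use n J in \<open>auto simp: fr_D\<close>)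
  have rat: "lift_incident K0 U Y"
    if "P \<in> rational_points E (2 * n) K0 G J" "U \<in> P" "Y \<in> P" "type_of G U = Node 1" "type_of G Y = Minus"
    for P U Y
  proof (rule lift_incident_rational)
    show "rational_subspace E (2 * n) K0 U" using that by (auto simp: rational_points_def)
    have F: "flag G P" using that by (auto simp: rational_points_def gr_points_def flags_of_type_def)
    have "U \<noteq> Y" using that by auto
    then have "incident G U Y" using flag_incident[OF F that(2,3)] by simp
    then show "U \<subseteq> Y"
      using node_subset[OF flag_element[OF F that(2)] that(4) flag_element[OF F that(3)]] that(5) n
        dim_class[of Y] by (simp add: type_D_Minus)
  qed
  obtain a where a: "a \<notin> K0" using K0 by auto
  obtain m m' where mm': "{m, m'} = {5, 6}" "frame_space a m \<in> Sp" "frame_space a m' \<in> Sm"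
    "dim (frame_space a m \<inter> frame_space a m') = n - 1" by (rule frame_spaces_oriented)
  define X where "X = frame_space a m"
  define Y where "Y = frame_space a m'"
  \<comment> \<open>The first frame vector \<open>E 2 - E 3 \<cdot> a\<close> does not depend on
    \<open>m\<close>, so this point lies in both frame spaces.\<close>
  define U where "U = span {frame a 5 1}"
  have m: "m \<in> {5, 6}" "m' \<in> {5, 6}" using mm'(1) by auto
  have XY: "X \<in> Sp" "Y \<in> Sm" "dim (X \<inter> Y) = n - 1" using mm' by (simp_all add: X_def Y_def)
  have frame1: "frame a k 1 = frame a 5 1" for k by (simp add: frame_def)
  have "frame a 5 1 \<in> frame_space a k" for k using frame_in_space[of 1 a k] frame1[of k] n by simp
  then have UX: "U \<subseteq> frame_space a k" for k
    unfolding U_def using subspace_span by (intro span_minimal) (auto simp: frame_space_def)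
  have dim_U: "dim U = 1" using dim_frame_span[of 5 "{1}" a] n by (simp add: U_def)
  have U_ts: "totally_singular E n U"
    using UX[of m] max_singularD(1)[OF class_max(1)[OF XY(1)]] subspace_span
    by (auto simp: totally_singular_def U_def X_def)
  have U_cls: "U \<notin> Sp" "U \<notin> Sm" using dim_class dim_U n by auto
  have tyU: "type_of G U = Node 1" using U_cls dim_U by (simp add: type_D_Node)
  have tyXY: "type_of G X = Plus" "type_of G Y = Minus" using XY by (simp_all add: type_D_Plus type_D_Minus)
  define P where "P = (if J = {Node 1, Minus} then {U, Y} else {U, X, Y})"
  have "flag G {U, X, Y}"
  proof -
    have "U \<in> elements G" "X \<in> elements G" "Y \<in> elements G"
      using U_ts dim_U n XY by (auto simp: elements_D)
    moreover have "incident G U X" "incident G X U" "incident G U Y" "incident G Y U"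
      using UX U_cls by (auto simp: incident_D X_def Y_def)
    moreover have "incident G X Y" "incident G Y X"
      using XY by (auto simp: incident_D Int_commute)
    ultimately show ?thesis by (auto simp: flag_def pairwise_def)
  qed
  then have "flag G P" by (auto simp: P_def flag_def pairwise_def)
  then have P: "P \<in> gr_points G J"
    using J tyU tyXY by (auto simp: gr_points_def flags_of_type_def P_def)
  have not_R: "\<not> lift_incident K0 U Y"
  proof
    assume *: "lift_incident K0 U Y"
    obtain f where f: "left_linear K0 f" "f 1 = 0" "f a = 1"
      using exists_left_linear_separating[OF K0(1) a] .
    have "frame a 5 1 \<in> U" by (simp add: U_def span_base)
    then have "lift f (frame a 5 1) \<in> Y" using * f by (auto simp: lift_incident_def)
    \<comment> \<open>The lift is \<open>- E 3\<close>, whose product with the frame vector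
      \<open>E 4 + E 1 \<cdot> a\<close> is \<open>- 1\<close>, whereas elements of \<open>Y\<close>
      are mutually orthogonal.\<close>
    moreover have "frame a m' 2 \<in> Y" using frame_in_space[of 2 a m'] n by (simp add: Y_def)
    ultimately have "polar (lift f (frame a 5 1)) (frame a m' 2) = 0"
      using max_singularD(5)[OF class_max(2)[OF XY(2)]] by blast
    then show False
      using f n m by (auto simp: polar_frame co_frame co_lift[OF f(1)] left_linear_minus[OF f(1)])
  qed
  show ?thesis
    by (rule not_rationally_generatedI[OF sub rat P _ _ tyU tyXY(2) not_R]) (auto simp: P_def)
qed

end

section \<open>Spinors\<close>

definition flip :: "nat \<Rightarrow> nat set \<Rightarrow> nat set" where
  "flip i J = (if i \<in> J then J - {i} else insert i J)"

text \<open>The sign from moving e_i to its place in the monomial of \<open>J\<close>, past the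
  factors of smaller index.\<close>

definition sign_below :: "nat \<Rightarrow> nat set \<Rightarrow> 'k::ring_1" where
  "sign_below i J = (- 1) ^ card {j \<in> J. j < i}"

lemma flip_flip [simp]: "flip i (flip i J) = J"
  by (auto simp: flip_def)

lemma flip_commute: "flip i (flip j J) = flip j (flip i J)"
  by (auto simp: flip_def)

lemma mem_flip: "j \<in> flip i J \<longleftrightarrow> (if j = i then j \<notin> J else j \<in> J)"
  by (auto simp: flip_def)

lemma sign_below_empty: "sign_below i {} = 1"
  by (simp add: sign_below_def)

lemma sign_below_insert:
  assumes "j \<notin> J"
  shows "sign_below i (insert j J) = (if j < i then - sign_below i J else (sign_below i J :: 'k::ring_1))"
proof (cases "j < i")
  case True
  then have "{k \<in> insert j J. k < i} = insert j {k \<in> J. k < i}" by auto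
  moreover have "finite {k \<in> J. k < i}" by (rule finite_subset[of _ "{..<i}"]) auto
  ultimately show ?thesis using assms True by (simp add: sign_below_def)
next
  case False
  then have "{k \<in> insert j J. k < i} = {k \<in> J. k < i}" by auto
  then show ?thesis using False by (simp add: sign_below_def)
qed

lemma sign_below_flip:
  "sign_below i (flip j J) = (if j < i then - sign_below i J else (sign_below i J :: 'k::ring_1))"
proof (cases "j \<in> J")
  case True
  then have "sign_below i J = (if j < i then - sign_below i (J - {j}) else (sign_below i (J - {j}) :: 'k))"
    using sign_below_insert[of j "J - {j}" i] by (simp add: insert_absorb)
  then show ?thesis using True by (simp add: flip_def)
next
  case False
  then show ?thesis by (simp add: flip_def sign_below_insert)
qed

lemma sign_below_union_above:
  assumes "\<And>j. j \<in> C \<Longrightarrow> i \<le> j"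
  shows "sign_below i (I \<union> C) = sign_below i I"
proof -
  have "{j \<in> I \<union> C. j < i} = {j \<in> I. j < i}" using assms by fastforce
  then show ?thesis by (simp add: sign_below_def)
qed

lemma sign_below_cases: "sign_below i J = (1 :: 'k::ring_1) \<or> sign_below i J = (- 1 :: 'k)"
  unfolding sign_below_def using neg_one_even_power neg_one_odd_power by metis

lemma sign_below_square: "sign_below i J * (sign_below i J * x) = (x :: 'k::ring_1)"
  using sign_below_cases[of i J, where 'k = 'k] by auto

text \<open>Off-diagonal terms cancel in pairs. Nothing is halved, so \<open>cliff_square\<close>
  can rely on this in characteristic 2.\<close>

lemma sum_antisymmetric:
  fixes T :: "'a \<Rightarrow> 'a \<Rightarrow> 'b::ab_group_add"
  assumes "finite A" "\<And>i j. i \<in> A \<Longrightarrow> j \<in> A \<Longrightarrow> i \<noteq> j \<Longrightarrow> T i j = - T j i"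
  shows "(\<Sum>i\<in>A. \<Sum>j\<in>A. T i j) = (\<Sum>i\<in>A. T i i)"
  using assms
proof (induction A rule: finite_induct)
  case empty
  then show ?case by simp
next
  case (insert x A)
  have "(\<Sum>i\<in>A. T i x) = (\<Sum>i\<in>A. - T x i)"
    using insert.hyps by (intro sum.cong insert.prems) auto
  moreover have "(\<Sum>i\<in>A. \<Sum>j\<in>A. T i j) = (\<Sum>i\<in>A. T i i)"
    by (intro insert.IH insert.prems) auto
  ultimately show ?case using insert.hyps by (simp add: sum.distrib sum_negf)
qed

section \<open>The Clifford action and the spinors of a singular subspace\<close>

context hyperbolic_quadric
begin

text \<open>A spinor assigns a coefficient to each monomial \<open>e\<^sub>J\<close> of the exterior algebra on
  \<open>e\<^sub>1, \<dots>, e\<^sub>n\<close>. The vector \<open>E (2 * i - 1)\<close> acts by exterior multiplication with \<open>e\<^sub>i\<close>, and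
  \<open>E (2 * i)\<close> by the corresponding contraction.\<close>

definition cliff :: "'v \<Rightarrow> (nat set \<Rightarrow> 'k) \<Rightarrow> nat set \<Rightarrow> 'k" where
  "cliff v s J = (\<Sum>i=1..n. sign_below i J * (sel J i v * s (flip i J)))"

definition smul :: "(nat set \<Rightarrow> 'k) \<Rightarrow> 'k \<Rightarrow> nat set \<Rightarrow> 'k" where
  "smul s c J = s J * c"

lemma cliff_add_vector: "cliff (v + w) s = cliff v s + cliff w s"
  by (rule ext) (simp add: cliff_def sel_add distrib_left distrib_right sum.distrib)

lemma cliff_scale_vector: "cliff (v \<cdot> a) s = smul (cliff v s) a"
  unfolding cliff_def smul_def sum_distrib_right fun_eq_iff
  by (intro allI sum.cong) (simp_all add: sel_scale comm_simps)

lemma cliff_diff_vector: "cliff (v - w) s = cliff v s - cliff w s"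
  using cliff_add_vector[of "v - w" w s] by simp

lemma cliff_add: "cliff v (s + t) = cliff v s + cliff v t"
  by (rule ext) (simp add: cliff_def distrib_left sum.distrib)

lemma cliff_zero [simp]: "cliff v 0 = 0"
  by (rule ext) (simp add: cliff_def)

lemma cliff_zero_vector [simp]: "cliff 0 s = 0"
  by (rule ext) (simp add: cliff_def sel_def)

lemma cliff_minus: "cliff v (- s) = - cliff v s"
  using cliff_add[of v s "- s"] by (simp add: eq_neg_iff_add_eq_0 add.commute)

lemma cliff_diff: "cliff v (s - t) = cliff v s - cliff v t"
  using cliff_add[of v s "- t"] by (simp add: cliff_minus)

lemma cliff_smul: "cliff v (smul s c) = smul (cliff v s) c"
  by (rule ext) (simp add: cliff_def smul_def sum_distrib_right mult.assoc)

lemma smul_zero [simp]: "smul 0 c = 0" "smul s 0 = 0"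
  by (auto simp: smul_def fun_eq_iff)

lemma smul_one: "smul s 1 = s"
  by (simp add: smul_def fun_eq_iff)

lemma sel_flip: "i \<noteq> j \<Longrightarrow> sel (flip i J) j v = sel J j v"
  by (simp add: sel_def mem_flip)

lemma sel_flip_self: "sel (flip i J) i v = co v (if i \<in> J then 2 * i else 2 * i - 1)"
  by (simp add: sel_def mem_flip)

definition cliff_term :: "(nat set \<Rightarrow> 'k) \<Rightarrow> nat set \<Rightarrow> 'v \<Rightarrow> 'v \<Rightarrow> nat \<Rightarrow> nat \<Rightarrow> 'k" where
  "cliff_term s J v w i k = sign_below i J * (sel J i v *
     (sign_below k (flip i J) * (sel (flip i J) k w * s (flip k (flip i J)))))"

lemma cliff_cliff: "cliff v (cliff w s) J = (\<Sum>i=1..n. \<Sum>k=1..n. cliff_term s J v w i k)"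
  unfolding cliff_def cliff_term_def by (simp add: sum_distrib_left)

text \<open>Flipping the smaller index changes the sign at the larger one and not conversely, so
  exactly one of the two orders acquires a minus sign.\<close>

lemma cliff_term_antisymmetric:
  assumes "i \<noteq> k"
  shows "cliff_term s J v w i k = - cliff_term s J w v k i"
proof -
  have "cliff_term s J v w i k = (if i < k then - 1 else 1) *
      (sign_below i J * (sign_below k J * (sel J i v * (sel J k w * s (flip k (flip i J))))))"
    if "i \<noteq> k" for i k v w
    using that by (simp add: cliff_term_def sel_flip sign_below_flip comm_simps)
  from this[OF assms, of v w] this[of k i w v] show ?thesis
    using assms flip_commute[of i k J] by (cases "i < k") (auto simp: comm_simps)
qed

lemma cliff_term_diag: "cliff_term s J v w i i = sel J i v * sel (flip i J) i w * s J"
proof -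
  have "cliff_term s J v w i i = sign_below i J * (sign_below i J * (sel J i v * sel (flip i J) i w * s J))"
    by (simp add: cliff_term_def sign_below_flip comm_simps)
  then show ?thesis by (simp only: sign_below_square)
qed

lemma cliff_anticommutator: "cliff v (cliff w s) + cliff w (cliff v s) = smul s (polar v w)"
proof
  fix J
  have "(cliff v (cliff w s) + cliff w (cliff v s)) J =
      (\<Sum>i=1..n. \<Sum>k=1..n. cliff_term s J v w i k) + (\<Sum>i=1..n. \<Sum>k=1..n. cliff_term s J w v k i)"
    by (simp add: cliff_cliff sum.swap[of "\<lambda>i k. cliff_term s J w v k i"])
  also have "\<dots> = (\<Sum>i=1..n. \<Sum>k=1..n. cliff_term s J v w i k + cliff_term s J w v k i)"
    by (simp add: sum.distrib)
  also have "\<dots> = (\<Sum>i=1..n. cliff_term s J v w i i + cliff_term s J w v i i)"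
  proof (rule sum.cong[OF refl])
    fix i assume i: "i \<in> {1..n}"
    have "(\<Sum>k=1..n. cliff_term s J v w i k + cliff_term s J w v k i) =
        (\<Sum>k=1..n. if k = i then cliff_term s J v w i i + cliff_term s J w v i i else 0)"
    proof (rule sum.cong[OF refl])
      fix k
      show "cliff_term s J v w i k + cliff_term s J w v k i =
          (if k = i then cliff_term s J v w i i + cliff_term s J w v i i else 0)"
        using cliff_term_antisymmetric[of i k s J v w] by (cases "k = i") auto
    qed
    then show "(\<Sum>k=1..n. cliff_term s J v w i k + cliff_term s J w v k i) =
        cliff_term s J v w i i + cliff_term s J w v i i" using i by simp
  qed
  also have "\<dots> = (\<Sum>i=1..n. (co v (2 * i - 1) * co w (2 * i) + co v (2 * i) * co w (2 * i - 1)) * s J)"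
    unfolding cliff_term_diag sel_flip_self
    by (rule sum.cong) (auto simp: sel_def distrib_left comm_simps add.commute)
  also have "\<dots> = smul s (polar v w) J"
    by (simp add: smul_def polar_def sum_distrib_right mult_comm[of "s J"])
  finally show "(cliff v (cliff w s) + cliff w (cliff v s)) J = smul s (polar v w) J" .
qed

text \<open>Setting \<open>w = v\<close> in the anticommutator only gives twice this, so the
  diagonal of the double sum is evaluated directly.\<close>

lemma cliff_square: "cliff v (cliff v s) = smul s (q v)"
proof
  fix J
  have "cliff v (cliff v s) J = (\<Sum>i=1..n. cliff_term s J v v i i)"
    unfolding cliff_cliff by (rule sum_antisymmetric) (auto intro: cliff_term_antisymmetric)
  also have "\<dots> = (\<Sum>i=1..n. co v (2 * i - 1) * co v (2 * i) * s J)"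
    unfolding cliff_term_diag sel_flip_self
    by (rule sum.cong) (auto simp: sel_def comm_simps)
  finally show "cliff v (cliff v s) J = smul s (q v) J"
    by (simp add: smul_def quad_form_def sum_distrib_right mult_comm[of "s J"])
qed

lemma cliff_anticommute: "polar v w = 0 \<Longrightarrow> cliff v (cliff w s) = - cliff w (cliff v s)"
  using cliff_anticommutator[of v w s] by (simp add: eq_neg_iff_add_eq_0)

lemma cliff_dual: "polar v w = 1 \<Longrightarrow> cliff v (cliff w s) + cliff w (cliff v s) = s"
  using cliff_anticommutator[of v w s] by (simp add: smul_one)

lemma cliff_singular: "q v = 0 \<Longrightarrow> cliff v (cliff v s) = 0"
  using cliff_square[of v s] by simp

text \<open>For a maximal singular space the restrictions of these functions to subsets of
  \<open>{1..n}\<close> are the multiples of its pure spinor. Values at other sets of naturals do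
  not interact with them and are not read by \<open>pairing\<close> when
  \<open>3 \<le> n\<close>.\<close>

definition Spin :: "'v set \<Rightarrow> (nat set \<Rightarrow> 'k) set" where
  "Spin X = {s. \<forall>v\<in>X. cliff v s = 0}"

lemma subspace_annihilator: "subspace {v. cliff v s = 0}"
  unfolding subspace_def by (auto simp: cliff_add_vector cliff_scale_vector)

lemma Spin_span: "s \<in> Spin B \<Longrightarrow> s \<in> Spin (span B)"
  using span_minimal[OF _ subspace_annihilator, of B s] by (auto simp: Spin_def)

lemma Spin_insert: "cliff v s = 0 \<Longrightarrow> s \<in> Spin B \<Longrightarrow> s \<in> Spin (span (insert v B))"
  by (rule Spin_span) (auto simp: Spin_def)

lemma Spin_closed:
  "s \<in> Spin X \<Longrightarrow> t \<in> Spin X \<Longrightarrow> s - t \<in> Spin X" "s \<in> Spin X \<Longrightarrow> smul s c \<in> Spin X"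
  by (auto simp: Spin_def cliff_diff cliff_smul)

text \<open>The coordinates of \<open>v\<close> and the signs lie in \<open>K0\<close> and multiply
  from the left, so \<open>f\<close> passes through each summand.\<close>

lemma cliff_rational_vector:
  assumes K0: "sub_division_ring K0" and f: "left_linear K0 f" and v: "rational_vector E (2 * n) K0 v"
  shows "cliff v (f \<circ> s) = f \<circ> cliff v s"
proof
  fix J
  have "sign_below i J * (sel J i v * f x) = f (sign_below i J * (sel J i v * x))" if "i \<in> {1..n}" for i x
  proof -
    have "sel J i v \<in> K0" using rational_vector_co[OF v] pair_index[OF that] by (simp add: sel_def del: atLeastAtMost_iff)
    moreover have "(sign_below i J :: 'k) \<in> K0"
      using sign_below_cases[of i J, where 'k = 'k] sub_division_ring_closed[OF K0] by auto
    ultimately show ?thesis by (simp add: left_linear_mult[OF f])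
  qed
  then show "cliff v (f \<circ> s) J = (f \<circ> cliff v s) J"
    unfolding cliff_def comp_def left_linear_sum[OF f] by (intro sum.cong) auto
qed

lemma Spin_rational:
  assumes K0: "sub_division_ring K0" and f: "left_linear K0 f"
    and X: "rational_subspace E (2 * n) K0 X" and s: "s \<in> Spin X"
  shows "f \<circ> s \<in> Spin X"
proof -
  obtain B where B: "span B = X" "\<And>v. v \<in> B \<Longrightarrow> rational_vector E (2 * n) K0 v"
    using X by (auto simp: rational_subspace_def basis_of_def)
  have "cliff v (f \<circ> s) = 0" if "v \<in> B" for v
  proof -
    have "cliff v s = 0" using s that span_base[of v B] B(1) by (auto simp: Spin_def)
    then show ?thesis using cliff_rational_vector[OF K0 f B(2)[OF that], of s] left_linear_0[OF f]
      by (auto simp: fun_eq_iff)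
  qed
  then show ?thesis using Spin_span[of "f \<circ> s" B] B(1) by (auto simp: Spin_def)
qed

text \<open>A spinor of \<open>X\<close> is determined by one coefficient. The induction is on the
  number of indices where \<open>J\<close> differs from \<open>J0\<close>. For such an
  \<open>i\<close> some \<open>x\<close> in \<open>X\<close> has selected coordinates 0 except for 1
  at \<open>i\<close>; the equation \<open>cliff x s = 0\<close> at \<open>flip i J\<close> then
  expresses \<open>s J\<close> through sets that differ from \<open>J0\<close> in two indices
  fewer.\<close>

lemma Spin_eq_0_if_vacuum_0:
  assumes X: "X \<in> max_singular E n" and J0: "J0 \<subseteq> {1..n}"
    and opp: "\<And>x. \<lbrakk>x \<in> X; \<And>j. j \<in> {1..n} \<Longrightarrow> sel J0 j x = 0\<rbrakk> \<Longrightarrow> x = 0"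
    and s: "s \<in> Spin X" "s J0 = 0" and J: "J \<subseteq> {1..n}"
  shows "s J = 0"
proof -
  let ?D = "\<lambda>J. {i \<in> {1..n}. (i \<in> J) \<noteq> (i \<in> J0)}"
  have flip_D: "?D (flip i J) = ?D J - {i}" if "i \<in> ?D J" for i J
    using that by (auto simp: mem_flip)
  have "s J = 0" if "card (?D J) = m" "J \<subseteq> {1..n}" for m J
    using that
  proof (induction m arbitrary: J rule: less_induct)
    case (less m)
    show ?case
    proof (cases "?D J = {}")
      case True
      then have "J = J0" using less.prems(2) J0 by blast
      then show ?thesis using s by simp
    next
      case False
      then obtain i where i: "i \<in> ?D J" by blast
      let ?J = "flip i J" let ?e = "E (if i \<in> J0 then 2 * i - 1 else 2 * i)"
      obtain x where x: "x \<in> X" "\<And>j. j \<in> {1..n} \<Longrightarrow> sel J0 j (?e - x) = 0"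
        using opposite_frame_decompose[OF X opp] by blast
      have x_sel: "sel J0 j x = (if j = i then 1 else 0)" if "j \<in> {1..n}" for j
      proof -
        have "sel J0 j ?e = (if j = i then 1 else 0)"
          using i that pair_index[of i] pair_index_eq[of i j] pair_index_eq[of j i]
          by (auto simp: sel_def co_E)
        then show ?thesis using x(2)[OF that] by (simp add: sel_diff)
      qed
      have "sign_below j ?J * (sel ?J j x * s (flip j ?J)) =
          (if j = i then sign_below i ?J * s J else 0)" if j: "j \<in> {1..n}" for j
      proof -
        have sel_eq: "sel ?J j x = sel J0 j x" if "j \<notin> ?D ?J" using that j by (simp add: sel_def)
        consider "j = i" | "j \<noteq> i" "j \<notin> ?D ?J" | "j \<noteq> i" "j \<in> ?D ?J" by blast
        then show ?thesis
        proof cases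
          case 1
          then have "sel ?J j x = sel J0 j x" using sel_eq flip_D[OF i] by blast
          then show ?thesis using 1 x_sel[OF j] by simp
        next
          case 2
          then show ?thesis using sel_eq x_sel[OF j] by simp
        next
          case 3
          have "?D (flip j ?J) \<subset> ?D J" using flip_D[OF 3(2)] flip_D[OF i] i by auto
          then have "card (?D (flip j ?J)) < m"
            using less.prems(1) psubset_card_mono[of "?D J"] by auto
          moreover have "flip j ?J \<subseteq> {1..n}"
            using less.prems(2) i j by (auto simp: flip_def split: if_splits)
          ultimately have "s (flip j ?J) = 0" using less.IH by blast
          then show ?thesis using 3 by simp
        qed
      qed
      then have "cliff x s ?J = (\<Sum>j=1..n. if j = i then sign_below i ?J * s J else 0)"
        unfolding cliff_def by (intro sum.cong) auto
      then have "sign_below i ?J * s J = 0" using i s(1) x(1) by (simp add: Spin_def)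
      then show ?thesis using sign_below_square[of i ?J "s J"] by (metis mult_zero_right)
    qed
  qed
  then show ?thesis using J by blast
qed

text \<open>The matching of the half-spin modules of the hyperbolic \<open>6\<close>-space spanned by
  \<open>E 1, \<dots>, E 6\<close>: the coefficient of \<open>e\<^sub>1 e\<^sub>2 e\<^sub>3\<close> in the product of the reversal of \<open>s\<close> with \<open>t\<close>,
  after restricting both to the monomials divisible by \<open>e\<^sub>4 \<dots> e\<^sub>n\<close>.\<close>

definition restr :: "(nat set \<Rightarrow> 'k) \<Rightarrow> nat set \<Rightarrow> 'k" where
  "restr s I = s (I \<union> {4..n})"

definition pairing :: "(nat set \<Rightarrow> 'k) \<Rightarrow> (nat set \<Rightarrow> 'k) \<Rightarrow> 'k" where
  "pairing s t =
     restr s {} * restr t {1, 2, 3} + restr s {1} * restr t {2, 3}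
     - restr s {2} * restr t {1, 3} + restr s {3} * restr t {1, 2}
     - restr s {1, 2} * restr t {3} + restr s {1, 3} * restr t {2}
     - restr s {2, 3} * restr t {1} - restr s {1, 2, 3} * restr t {}"

lemma pairing_add_left: "pairing (s + s') t = pairing s t + pairing s' t"
  by (simp add: pairing_def restr_def algebra_simps)

lemma pairing_add_right: "pairing s (t + t') = pairing s t + pairing s t'"
  by (simp add: pairing_def restr_def algebra_simps)

text \<open>At a set containing \<open>{4..n}\<close> a pair \<open>j \<ge> 4\<close> contributes
  only through its exterior coordinate \<open>2 * j - 1\<close>, which is zero here; contraction by
  e_j produces no monomial divisible by e_j.\<close>

lemma restr_cliff:
  assumes n: "3 \<le> n" and z: "\<And>j. j \<in> {4..n} \<Longrightarrow> co z (2 * j - 1) = 0" and I: "I \<subseteq> {1, 2, 3}"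
  shows "restr (cliff z s) I = (\<Sum>i\<in>{1, 2, 3}. sign_below i I * (sel I i z * restr s (flip i I)))"
proof -
  have "restr (cliff z s) I =
      (\<Sum>i=1..n. sign_below i (I \<union> {4..n}) * (sel (I \<union> {4..n}) i z * s (flip i (I \<union> {4..n}))))"
    by (simp add: restr_def cliff_def)
  also have "\<dots> = (\<Sum>i\<in>{1, 2, 3}. sign_below i (I \<union> {4..n}) * (sel (I \<union> {4..n}) i z * s (flip i (I \<union> {4..n}))))"
  proof (rule sum.mono_neutral_right)
    show "\<forall>i\<in>{1..n} - {1, 2, 3}.
        sign_below i (I \<union> {4..n}) * (sel (I \<union> {4..n}) i z * s (flip i (I \<union> {4..n}))) = 0"
    proof
      fix i assume "i \<in> {1..n} - {1, 2, 3}"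
      then have "i \<in> {4..n}" by auto
      then show "sign_below i (I \<union> {4..n}) * (sel (I \<union> {4..n}) i z * s (flip i (I \<union> {4..n}))) = 0"
        using z by (simp add: sel_def)
    qed
  qed (use n in auto)
  also have "\<dots> = (\<Sum>i\<in>{1, 2, 3}. sign_below i I * (sel I i z * restr s (flip i I)))"
  proof (rule sum.cong[OF refl])
    fix i :: nat assume "i \<in> {1, 2, 3}"
    then have i: "i \<le> 3" by auto
    have "flip i (I \<union> {4..n}) = flip i I \<union> {4..n}" using i by (auto simp: flip_def)
    moreover have "sel (I \<union> {4..n}) i z = sel I i z" using i by (simp add: sel_def)
    moreover have "sign_below i (I \<union> {4..n}) = (sign_below i I :: 'k)"
      using i by (intro sign_below_union_above) auto
    ultimately show "sign_below i (I \<union> {4..n}) * (sel (I \<union> {4..n}) i z * s (flip i (I \<union> {4..n}))) =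
        sign_below i I * (sel I i z * restr s (flip i I))"
      by (simp add: restr_def)
  qed
  finally show ?thesis .
qed

text \<open>For such a \<open>z\<close> the form taking \<open>s\<close> and \<open>s'\<close> to
  \<open>pairing s (cliff z s')\<close> is alternating on all spinors, pure or not; the signs in
  \<open>pairing\<close> are those that make the terms cancel in pairs.\<close>

lemma pairing_cliff_self:
  assumes "3 \<le> n" "\<And>j. j \<in> {4..n} \<Longrightarrow> co z (2 * j - 1) = 0"
  shows "pairing s (cliff z s) = 0"
proof -
  have ins: "insert 2 {1::nat} = {1, 2}" "insert 3 {1::nat} = {1, 3}" "insert 3 {2::nat} = {2, 3}"
    "insert 2 {1::nat, 3} = {1, 2, 3}" "insert 3 {1::nat, 2} = {1, 2, 3}"
    "{1::nat, 2} - {1} = {2}" "{1::nat, 2} - {2} = {1}" "{1::nat, 3} - {1} = {3}" "{1::nat, 3} - {3} = {1}"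
    "{2::nat, 3} - {2} = {3}" "{2::nat, 3} - {3} = {2}" "{1::nat, 2, 3} - {1} = {2, 3}"
    "{1::nat, 2, 3} - {2} = {1, 3}" "{1::nat, 2, 3} - {3} = {1, 2}" by auto
  note eval = sum.insert sign_below_insert sign_below_empty sel_def flip_def ins One_nat_def[symmetric]
  have r: "restr (cliff z s) {} = co z 2 * restr s {1} + co z 4 * restr s {2} + co z 6 * restr s {3}"
    "restr (cliff z s) {1} = co z 1 * restr s {} - co z 4 * restr s {1, 2} - co z 6 * restr s {1, 3}"
    "restr (cliff z s) {2} = co z 2 * restr s {1, 2} + co z 3 * restr s {} - co z 6 * restr s {2, 3}"
    "restr (cliff z s) {3} = co z 2 * restr s {1, 3} + co z 4 * restr s {2, 3} + co z 5 * restr s {}"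
    "restr (cliff z s) {1, 2} = co z 1 * restr s {2} - co z 3 * restr s {1} + co z 6 * restr s {1, 2, 3}"
    "restr (cliff z s) {1, 3} = co z 1 * restr s {3} - co z 4 * restr s {1, 2, 3} - co z 5 * restr s {1}"
    "restr (cliff z s) {2, 3} = co z 2 * restr s {1, 2, 3} + co z 3 * restr s {3} - co z 5 * restr s {2}"
    "restr (cliff z s) {1, 2, 3} = co z 1 * restr s {2, 3} - co z 3 * restr s {1, 3} + co z 5 * restr s {1, 2}"
    by (subst restr_cliff[OF assms]; simp add: eval)+
  show ?thesis
    unfolding pairing_def r by (simp add: algebra_simps comm_simps)
qed

text \<open>Spinors of an adjacent space arise from a spinor of \<open>X\<close> by the action of
  one vector: up to a scalar, \<open>t\<close> is \<open>cliff z s\<close>, and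
  \<open>pairing_cliff_self\<close> applies if \<open>z\<close> lacks the coordinates excluded
  there. Such a \<open>z\<close> exists if \<open>X\<close> meets the span of
  \<open>E 8, E 10, ..., E (2 * n)\<close> only in 0; otherwise all restricted coefficients of
  \<open>s\<close> vanish.\<close>

lemma pairing_incident:
  assumes n: "3 \<le> n" and X: "X \<in> max_singular E n" and Y: "Y \<in> max_singular E n"
    and dim_W: "dim (X \<inter> Y) = n - 1" and s: "s \<in> Spin X" and t: "t \<in> Spin Y"
  shows "pairing s t = 0"
proof (cases "\<exists>x\<in>X. x \<noteq> 0 \<and> (\<forall>j\<in>{4..n}. co x (2 * j - 1) = 0) \<and>
    (\<forall>j\<in>{1..n} - {4..n}. co x (2 * j - 1) = 0 \<and> co x (2 * j) = 0)")
  case True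
  then obtain x where x: "x \<in> X" "x \<noteq> 0" "\<And>j. j \<in> {4..n} \<Longrightarrow> co x (2 * j - 1) = 0"
    "\<And>j. j \<in> {1..n} - {4..n} \<Longrightarrow> co x (2 * j - 1) = 0 \<and> co x (2 * j) = 0" by blast
  have "\<exists>m\<in>{1..2 * n}. co x m \<noteq> 0" using x(2) co_eqI[of x 0] by (metis co_0)
  then obtain k where k: "k \<in> {4..n}" "co x (2 * k) \<noteq> 0"
    using x(3,4) by (metis pair_cases DiffI)
  have "restr s I = 0" if "I \<subseteq> {1, 2, 3}" for I
  proof -
    \<comment> \<open>Deleting \<open>k\<close> isolates one term: at this set only the contraction
      by e_k contributes, and it carries the coefficient of \<open>s\<close> at
      \<open>I \<union> {4..n}\<close>.\<close>
    let ?J = "I \<union> {4..n} - {k}"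
    have J_flip: "flip k ?J = I \<union> {4..n}" using k by (auto simp: flip_def)
    have "0 = cliff x s ?J" using s x(1) by (simp add: Spin_def)
    also have "\<dots> = (\<Sum>j=1..n. if j = k then sign_below k ?J * (co x (2 * k) * restr s I) else 0)"
      unfolding cliff_def
    proof (rule sum.cong[OF refl])
      fix j assume j: "j \<in> {1..n}"
      have "sel ?J j x = 0" if "j \<noteq> k"
      proof (cases "j \<in> {4..n}")
        case True
        then show ?thesis using x(3) that by (simp add: sel_def)
      next
        case False
        then show ?thesis using x(4)[of j] j by (simp add: sel_def)
      qed
      moreover have "sel ?J k x = co x (2 * k)" by (simp add: sel_def)
      ultimately show "sign_below j ?J * (sel ?J j x * s (flip j ?J)) =
          (if j = k then sign_below k ?J * (co x (2 * k) * restr s I) else 0)"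
        using J_flip by (simp add: restr_def)
    qed
    also have "\<dots> = sign_below k ?J * (co x (2 * k) * restr s I)" using k by simp
    finally have "co x (2 * k) * restr s I = 0"
      using sign_below_square[of k ?J "co x (2 * k) * restr s I"] by (metis mult_zero_right)
    then show ?thesis using k by simp
  qed
  then show ?thesis by (simp add: pairing_def)
next
  case False
  note X' = max_singularD[OF X] and Y' = max_singularD[OF Y]
  obtain J0 where J0: "{4..n} \<subseteq> J0" "J0 \<subseteq> {1..n}"
    and opp: "\<And>x. \<lbrakk>x \<in> X; \<And>j. j \<in> {1..n} \<Longrightarrow> sel J0 j x = 0\<rbrakk> \<Longrightarrow> x = 0"
  proof (rule opposite_frame_exists[OF X'(1), of "{4..n}"])
    show "{4..n} \<subseteq> {1..n}" by auto
    show "x = 0" if "x \<in> X" "\<And>j. j \<in> {4..n} \<Longrightarrow> co x (2 * j - 1) = 0"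
      "\<And>j. j \<in> {1..n} - {4..n} \<Longrightarrow> co x (2 * j - 1) = 0 \<and> co x (2 * j) = 0" for x
      using False that by blast
  qed blast
  have vanish: "u J = 0" if "u \<in> Spin X" "u J0 = 0" "J \<subseteq> {1..n}" for u J
    using Spin_eq_0_if_vacuum_0[OF X J0(2) opp that] by blast
  have sub: "I \<union> {4..n} \<subseteq> {1..n}" if "I \<subseteq> {1, 2, 3}" for I using that n by auto
  show ?thesis
  proof (cases "s J0 = 0")
    case True
    have "restr s I = 0" if "I \<subseteq> {1, 2, 3}" for I
      using vanish[OF s True sub[OF that]] by (simp add: restr_def)
    then show ?thesis by (simp add: pairing_def)
  next
    case nz: False
    have "X \<noteq> Y" using dim_W X'(3) n by auto
    then obtain y where y: "y \<in> Y" "y \<notin> X" using dim_eq_imp_eq[of Y X] X' Y' by auto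
    obtain x where x: "x \<in> X" "polar y x = 1" using not_perp_max_singular[OF X y(2)] .
    \<comment> \<open>As \<open>y\<close> annihilates \<open>t\<close> and
      \<open>polar y x = 1\<close>, the Clifford relation recovers \<open>t\<close> as
      \<open>cliff y t'\<close>, while \<open>t'\<close> is annihilated by \<open>x\<close> as well
      as by \<open>X \<inter> Y\<close>.\<close>
    define t' where "t' = cliff x t"
    have t_eq: "t = cliff y t'"
      using cliff_dual[OF x(2), of t] t y(1) by (simp add: t'_def Spin_def)
    have "x \<notin> X \<inter> Y" using x y Y'(5)[of y x] by auto
    then have X_eq: "span (insert x (X \<inter> Y)) = X"
      using x X' Y' dim_W n by (intro span_insert_eq subspace_Int) auto
    have "t' \<in> Spin (span (insert x (X \<inter> Y)))"
    proof (rule Spin_insert)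
      show "cliff x t' = 0" using cliff_singular X'(4)[OF x(1)] by (simp add: t'_def)
      show "t' \<in> Spin (X \<inter> Y)"
        using t x(1) X'(5) cliff_anticommute by (auto simp: t'_def Spin_def)
    qed
    then have t': "t' \<in> Spin X" using X_eq by simp
    define c where "c = inverse (s J0) * t' J0"
    have proportional: "t' J = s J * c" if "J \<subseteq> {1..n}" for J
    proof -
      have "t' - smul s c \<in> Spin X" using t' s Spin_closed by blast
      moreover have "(t' - smul s c) J0 = 0" using nz by (simp add: smul_def c_def mult.assoc[symmetric])
      ultimately have "(t' - smul s c) J = 0" using vanish that by blast
      then show ?thesis by (simp add: smul_def)
    qed
    obtain x1 where x1: "x1 \<in> X" "\<And>j. j \<in> {1..n} \<Longrightarrow> sel J0 j (y - x1) = 0"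
      using opposite_frame_decompose[OF X opp] by blast
    \<comment> \<open>Subtracting an element of \<open>X\<close> does not change the action on
      \<open>t'\<close>; \<open>{4..n} \<subseteq> J0\<close> makes the coordinates
      \<open>2 * j - 1\<close> of \<open>z\<close> vanish for \<open>j\<close> in
      \<open>{4..n}\<close>.\<close>
    define z where "z = y - x1"
    have "t = cliff z t'" using t_eq t' x1(1) by (simp add: z_def cliff_diff_vector Spin_def)
    moreover have "cliff z t' J = cliff z s J * c" if "J \<subseteq> {1..n}" for J
    proof -
      have "flip i J \<subseteq> {1..n}" if "i \<in> {1..n}" for i
        using \<open>J \<subseteq> {1..n}\<close> that by (auto simp: flip_def split: if_splits)
      then show ?thesis
        unfolding cliff_def sum_distrib_right using proportional by (intro sum.cong) (auto simp: mult.assoc)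
    qed
    ultimately have "restr t I = restr (cliff z s) I * c" if "I \<subseteq> {1, 2, 3}" for I
      using sub[OF that] by (simp add: restr_def)
    then have "pairing s t = pairing s (cliff z s) * c"
      by (simp add: pairing_def distrib_right left_diff_distrib mult.assoc)
    moreover have "co z (2 * j - 1) = 0" if "j \<in> {4..n}" for j
      using x1(2)[of j] that J0 by (auto simp: z_def sel_def split: if_splits)
    ultimately show ?thesis using pairing_cliff_self[OF n, of z s] by simp
  qed
qed

section \<open>Spinors along a pencil\<close>

lemma dual_pair:
  assumes P: "P \<in> max_singular E n" and b: "b1 \<notin> P" "\<And>c. b2 - b1 \<cdot> c \<notin> P"
  obtains p1 p2 where "p1 \<in> P" "p2 \<in> P" "polar p1 b1 = 1" "polar p1 b2 = 0" "polar p2 b1 = 0" "polar p2 b2 = 1"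
proof -
  note P' = max_singularD(2)[OF P]
  obtain x where x: "x \<in> P" "polar b1 x = 1" using not_perp_max_singular[OF P b(1)] .
  define c where "c = polar b2 x"
  obtain y where y: "y \<in> P" "polar (b2 - b1 \<cdot> c) y = 1" using not_perp_max_singular[OF P b(2)] .
  \<comment> \<open>Subtracting a multiple of \<open>x\<close> makes \<open>p2\<close> orthogonal to
    \<open>b1\<close>; subtracting a multiple of \<open>p2\<close> then makes \<open>p1\<close>
    orthogonal to \<open>b2\<close>.\<close>
  define p2 where "p2 = y - x \<cdot> polar b1 y"
  define p1 where "p1 = x - p2 \<cdot> c"
  have 2: "polar b1 p2 = 0" "polar b2 p2 = 1"
    using x y by (simp_all add: p2_def c_def polar_diff_right polar_diff_left polar_scale_right
        polar_scale_left mult_comm)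
  have 1: "polar b1 p1 = 1" "polar b2 p1 = 0"
    using x 2 by (simp_all add: p1_def c_def polar_diff_right polar_scale_right)
  have "p2 \<in> P" using x y P' by (simp add: p2_def subspace_diff subspace_scale)
  moreover have "p1 \<in> P" using x \<open>p2 \<in> P\<close> P' by (simp add: p1_def subspace_diff subspace_scale)
  ultimately show ?thesis using that 1 2 polar_sym by metis
qed

lemma span_dual_pair:
  assumes P: "P \<in> max_singular E n" and U: "subspace U" "U \<subseteq> P" "n \<le> dim U + 2"
    and p: "p1 \<in> P" "p2 \<in> P" and b: "\<And>u. u \<in> U \<Longrightarrow> polar b1 u = 0" "\<And>u. u \<in> U \<Longrightarrow> polar b2 u = 0"
    "polar b1 p1 = 1" "polar b2 p1 = 0" "polar b2 p2 = 1"
  shows "span (insert p2 (span (insert p1 U))) = P"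
proof (rule span_insert_eq)
  have "p1 \<notin> U" using b(1)[of p1] b(3) by auto
  then have "dim (span (insert p1 U)) = dim U + 1" by (rule dim_span_insert[OF U(1)])
  then show "dim P \<le> dim (span (insert p1 U)) + 1" using U max_singularD(3)[OF P] by simp
  show "span (insert p1 U) \<subseteq> P" using U p max_singularD(2)[OF P] by (intro span_minimal) auto
  show "p2 \<notin> span (insert p1 U)"
  proof
    assume "p2 \<in> span (insert p1 U)"
    then have "polar b2 p2 = 0" by (rule polar_span[rotated]) (use b in auto)
    then show False using b by simp
  qed
qed (use p subspace_span max_singularD(2)[OF P] in auto)

text \<open>\<open>a1\<close> meets itself at once, \<open>a2\<close> anticommutes past
  \<open>a1\<close> and \<open>b1\<close> to meet itself, and vectors of \<open>U\<close>
  anticommute through the whole word to reach \<open>s\<close>.\<close>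

lemma Spin_word:
  assumes s: "s \<in> Spin U" and U: "\<And>u v. u \<in> U \<Longrightarrow> v \<in> {a1, a2, b1, b2} \<Longrightarrow> polar u v = 0"
    and a: "q a1 = 0" "q a2 = 0" "polar a1 a2 = 0" "polar a2 b1 = 0"
  shows "cliff a1 (cliff b1 (cliff a2 (cliff b2 s))) \<in> Spin (span (insert a2 (span (insert a1 U))))"
proof (intro Spin_insert)
  show "cliff a1 (cliff a1 (cliff b1 (cliff a2 (cliff b2 s)))) = 0" by (rule cliff_singular[OF a(1)])
  have "polar a2 a1 = 0" using a(3) polar_sym by metis
  then show "cliff a2 (cliff a1 (cliff b1 (cliff a2 (cliff b2 s)))) = 0"
    by (simp add: cliff_anticommute[of a2 a1] cliff_anticommute[OF a(4)] cliff_singular[OF a(2)] cliff_minus)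
  show "cliff a1 (cliff b1 (cliff a2 (cliff b2 s))) \<in> Spin U"
    unfolding Spin_def
  proof (intro CollectI ballI)
    fix u assume u: "u \<in> U"
    have "cliff u s = 0" using s u by (simp add: Spin_def)
    then show "cliff u (cliff a1 (cliff b1 (cliff a2 (cliff b2 s)))) = 0"
      using U[OF u] by (simp add: cliff_anticommute[of u] cliff_minus)
  qed
qed

text \<open>Dual bases of \<open>X1\<close> and \<open>X2\<close> modulo \<open>U\<close> give
  \<open>s = (a1 b1 + b1 a1) (a2 b2 + b2 a2) s\<close>. The words \<open>a1 b1 a2 b2\<close> and
  \<open>b1 a1 b2 a2\<close> lead into \<open>Spin X1\<close> and \<open>Spin X2\<close>; the two
  mixed words vanish because modulo \<open>U\<close> the space \<open>X\<close> is the graph of an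
  alternating map from \<open>X1\<close> to \<open>X2\<close>.\<close>

lemma Spin_pencil:
  assumes n: "2 \<le> n" and X: "X \<in> max_singular E n" and X1: "X1 \<in> max_singular E n" and X2: "X2 \<in> max_singular E n"
    and U: "subspace U" "dim U = n - 2" "X1 \<inter> X2 = U" "X \<inter> X2 = U" "U \<subseteq> X"
    and s: "s \<in> Spin X"
  obtains s1 s2 where "s1 \<in> Spin X1" "s2 \<in> Spin X2" "s = s1 + s2"
proof -
  note X' = max_singularD[OF X] and X1' = max_singularD[OF X1] and X2' = max_singularD[OF X2]
  have UX: "U \<subseteq> X" "U \<subseteq> X1" "U \<subseteq> X2" using U by auto
  have "U \<noteq> X2" using U(2) X2'(3) n by auto
  then obtain b1 where b1: "b1 \<in> X2" "b1 \<notin> U" using UX by blast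
  have "dim (span (insert b1 U)) = n - 1" using dim_span_insert[OF U(1) b1(2)] U n by simp
  then have "span (insert b1 U) \<noteq> X2" using X2' n by auto
  moreover have "span (insert b1 U) \<subseteq> X2" using b1 UX X2' by (intro span_minimal) auto
  ultimately obtain b2 where b2: "b2 \<in> X2" "b2 \<notin> span (insert b1 U)" by blast
  have b2c: "b2 - b1 \<cdot> c \<notin> U" for c
  proof
    assume "b2 - b1 \<cdot> c \<in> U"
    then have "(b2 - b1 \<cdot> c) + b1 \<cdot> c \<in> span (insert b1 U)"
      using span_subspace[OF U(1)] unfolding span_insert by blast
    then show False using b2 by simp
  qed
  have b2X2: "b2 - b1 \<cdot> c \<in> X2" for c using b1 b2 X2' by (simp add: subspace_diff subspace_scale)
  obtain a1 a2 where a: "a1 \<in> X1" "a2 \<in> X1" "polar a1 b1 = 1" "polar a1 b2 = 0" "polar a2 b1 = 0" "polar a2 b2 = 1"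
    by (rule dual_pair[OF X1, of b1 b2]) (use b1 b2c b2X2 U(3) in auto)
  obtain x1 x2 where x: "x1 \<in> X" "x2 \<in> X" "polar x1 b1 = 1" "polar x1 b2 = 0" "polar x2 b1 = 0" "polar x2 b2 = 1"
    by (rule dual_pair[OF X, of b1 b2]) (use b1 b2c b2X2 U(4) in auto)
  have U_perp: "polar v u = 0" "polar u v = 0" if "u \<in> U" "v \<in> X \<union> X1 \<union> X2" for u v
    using that UX X'(5) X1'(5) X2'(5) by auto
  have polars: "polar b1 a1 = 1" "polar b2 a1 = 0" "polar b1 a2 = 0" "polar b2 a2 = 1"
    "polar a1 a2 = 0" "polar b1 b2 = 0" "polar b2 b1 = 0" "polar a2 a1 = 0" "polar a1 a1 = 0" "polar a2 a2 = 0"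
    "polar b1 b1 = 0" "polar b2 b2 = 0"
    using a b1 b2 X1'(5) X2'(5) polar_sym by metis+
  have qs: "q a1 = 0" "q a2 = 0" "q b1 = 0" "q b2 = 0" using a b1 b2 X1'(4) X2'(4) by auto
  have X1_eq: "span (insert a2 (span (insert a1 U))) = X1"
    by (rule span_dual_pair[OF X1 U(1) UX(2), of a1 a2 b1 b2])
      (use U(2) a b1 b2 U_perp polars in auto)
  have X2_eq: "span (insert b2 (span (insert b1 U))) = X2"
    by (rule span_dual_pair[OF X2 U(1) UX(3), of b1 b2 a1 a2])
      (use U(2) a b1 b2 U_perp polars in auto)
  have perp_pair: "polar w v = 0"
    if "\<And>u. u \<in> U \<Longrightarrow> polar w u = 0" "polar w p1 = 0" "polar w p2 = 0"
      "v \<in> span (insert p2 (span (insert p1 U)))" for w v p1 p2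
    by (rule polar_span[OF _ that(4)]) (use that polar_span[of "insert p1 U" w] in auto)
  \<comment> \<open>Modulo \<open>U\<close>, \<open>x\<close> is \<open>a\<close> plus a combination
    of \<open>b1\<close> and \<open>b2\<close>. From \<open>cliff x s = 0\<close> follows the action
    of \<open>a\<close> on \<open>s\<close>; from \<open>q x = 0\<close> follows that the diagonal
    entries \<open>polar x1 a1\<close> and \<open>polar x2 a2\<close> vanish.\<close>
  have reduce: "cliff a s = - smul (cliff b1 s) (polar x a1) - smul (cliff b2 s) (polar x a2) \<and>
      polar x a1 * polar a b1 + polar x a2 * polar a b2 = 0"
    if "x \<in> X" "a \<in> X1" "polar x b1 = polar a b1" "polar x b2 = polar a b2" for x a
  proof -
    define y where "y = a + (b1 \<cdot> polar x a1 + b2 \<cdot> polar x a2)"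
    have a_perp: "polar a a1 = 0" "polar a a2 = 0" using that a X1'(5) by auto
    have "polar (x - y) u = 0" if "u \<in> U" for u
      using U_perp[OF \<open>u \<in> U\<close>] \<open>x \<in> X\<close> \<open>a \<in> X1\<close> b1 b2
      by (simp add: y_def polar_diff_left polar_add_left polar_scale_left)
    moreover have "polar (x - y) a1 = 0" "polar (x - y) a2 = 0" "polar (x - y) b1 = 0" "polar (x - y) b2 = 0"
      using that a_perp polars
      by (simp_all add: y_def polar_diff_left polar_add_left polar_scale_left)
    ultimately have "polar (x - y) v = 0" if "v \<in> X1 \<or> v \<in> X2" for v
      using that perp_pair[of "x - y" a1 a2 v] perp_pair[of "x - y" b1 b2 v] unfolding X1_eq X2_eq by blast
    then have "x - y \<in> X1" "x - y \<in> X2"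
      using max_singular_perp[OF X1] max_singular_perp[OF X2] by blast+
    then have xy: "x - y \<in> U" using U by auto
    then have "cliff (x - y) s = 0" "cliff x s = 0" using s UX that by (auto simp: Spin_def)
    then have "cliff y s = 0" by (simp add: cliff_diff_vector)
    then have "cliff a s + (smul (cliff b1 s) (polar x a1) + smul (cliff b2 s) (polar x a2)) = 0"
      by (simp add: y_def cliff_add_vector cliff_scale_vector)
    then have 1: "cliff a s = - smul (cliff b1 s) (polar x a1) - smul (cliff b2 s) (polar x a2)"
      by (simp add: add_eq_0_iff2)
    have "q x = q (x - y) + q y + polar (x - y) y" using quad_form_add[of "x - y" y] by simp
    moreover have "q (x - y) = 0" using X'(4) xy UX by auto
    moreover have "polar (x - y) y = 0"
      using U_perp[OF xy] \<open>a \<in> X1\<close> b1 b2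
      by (simp add: y_def polar_add_right polar_scale_right)
    moreover have "q y = polar a b1 * polar x a1 + polar a b2 * polar x a2"
      using X1'(4)[OF \<open>a \<in> X1\<close>] qs polars
      by (simp add: y_def quad_form_add quad_form_scale polar_add_right polar_scale_right polar_scale_left)
    ultimately have "polar x a1 * polar a b1 + polar x a2 * polar a b2 = 0"
      using X'(4)[OF \<open>x \<in> X\<close>] by (simp add: mult_comm)
    with 1 show ?thesis by blast
  qed
  have a1s: "cliff a1 s = - smul (cliff b2 s) (polar x1 a2)"
    using reduce[OF x(1) a(1)] x a by simp
  have a2s: "cliff a2 s = - smul (cliff b1 s) (polar x2 a1)"
    using reduce[OF x(2) a(2)] x a by simp
  define s1 where "s1 = cliff a1 (cliff b1 (cliff a2 (cliff b2 s)))"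
  define s2 where "s2 = cliff b1 (cliff a1 (cliff b2 (cliff a2 s)))"
  have sU: "s \<in> Spin U" using s UX by (auto simp: Spin_def)
  have "s1 \<in> Spin X1"
    unfolding s1_def X1_eq[symmetric]
    by (rule Spin_word[OF sU]) (use U_perp a b1 b2 qs polars in auto)
  moreover have "s2 \<in> Spin X2"
    unfolding s2_def X2_eq[symmetric]
    by (rule Spin_word[OF sU]) (use U_perp a b1 b2 qs polars in auto)
  moreover have "s = s1 + s2"
  proof -
    \<comment> \<open>\<open>a2\<close> acts on \<open>s\<close> as a multiple of \<open>b1\<close>,
      so \<open>b1\<close> occurs twice in the word.\<close>
    have m1: "cliff a1 (cliff b1 (cliff b2 (cliff a2 s))) = 0"
      by (simp add: a2s cliff_minus cliff_smul cliff_anticommute[OF polars(7)] cliff_singular[OF qs(3)])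
    have "cliff a1 (cliff a2 (cliff b2 s)) = cliff a2 (cliff b2 (cliff a1 s))"
      by (simp add: cliff_anticommute[OF polars(5)] cliff_anticommute[OF a(4)] cliff_minus)
    then have m2: "cliff b1 (cliff a1 (cliff a2 (cliff b2 s))) = 0"
      by (simp add: a1s cliff_minus cliff_smul cliff_singular[OF qs(4)])
    have "s = cliff a2 (cliff b2 s) + cliff b2 (cliff a2 s)"
      using cliff_dual[OF a(6), of s] by simp
    also have "\<dots> = (cliff a1 (cliff b1 (cliff a2 (cliff b2 s))) + cliff b1 (cliff a1 (cliff a2 (cliff b2 s)))) +
        (cliff a1 (cliff b1 (cliff b2 (cliff a2 s))) + cliff b1 (cliff a1 (cliff b2 (cliff a2 s))))"
      using cliff_dual[OF a(3), of "cliff a2 (cliff b2 s)"] cliff_dual[OF a(3), of "cliff b2 (cliff a2 s)"]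
      by simp
    finally show ?thesis using m1 m2 by (simp add: s1_def s2_def)
  qed
  ultimately show ?thesis using that by blast
qed

end

section \<open>The spinors of the explicit adjacent pair\<close>

lemma set_neqI: "x \<in> A \<Longrightarrow> x \<notin> B \<Longrightarrow> A \<noteq> B" and set_neqI': "x \<notin> A \<Longrightarrow> x \<in> B \<Longrightarrow> A \<noteq> B"
  by auto

lemma Diff_singleton_eq_iff: "x \<in> A \<Longrightarrow> x \<notin> B \<Longrightarrow> A - {x} = B \<longleftrightarrow> A = insert x B"
  by auto

context hyperbolic_quadric
begin

lemma cliff_basis:
  assumes i: "i \<in> {1..n}"
  shows "cliff (E (2 * i - 1)) s J = (if i \<in> J then sign_below i J * s (J - {i}) else 0)"
    and "cliff (E (2 * i)) s J = (if i \<in> J then 0 else sign_below i J * s (insert i J))"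
proof -
  have 1: "sel J j (E (2 * i - 1)) = (if j = i \<and> i \<in> J then 1 else 0)" if "j \<in> {1..n}" for j
    using co_E[OF pair_index(1)[OF i]] pair_index_eq[of i j] pair_index_eq[of j i] that i
    by (auto simp: sel_def)
  have "cliff (E (2 * i - 1)) s J = (\<Sum>j=1..n. if j = i then (if i \<in> J then sign_below i J * s (J - {i}) else 0) else 0)"
    unfolding cliff_def by (rule sum.cong) (auto simp: 1 flip_def)
  then show "cliff (E (2 * i - 1)) s J = (if i \<in> J then sign_below i J * s (J - {i}) else 0)"
    using i by simp
  have 2: "sel J j (E (2 * i)) = (if j = i \<and> i \<notin> J then 1 else 0)" if "j \<in> {1..n}" for j
    using co_E[OF pair_index(2)[OF i]] pair_index_eq[of i j] pair_index_eq[of j i] that i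
    by (auto simp: sel_def)
  have "cliff (E (2 * i)) s J = (\<Sum>j=1..n. if j = i then (if i \<in> J then 0 else sign_below i J * s (insert i J)) else 0)"
    unfolding cliff_def by (rule sum.cong) (auto simp: 2 flip_def)
  then show "cliff (E (2 * i)) s J = (if i \<in> J then 0 else sign_below i J * s (insert i J))"
    using i by simp
qed

definition frame_spinor :: "'k \<Rightarrow> nat set \<Rightarrow> 'k" where
  "frame_spinor a J = (if J = {4..n} then 1 else if J = {1, 2} \<union> {4..n} then a else 0)"

lemma restr_frame_spinor:
  assumes "I \<subseteq> {1, 2, 3}"
  shows "restr (frame_spinor a) I = (if I = {} then 1 else if I = {1, 2} then a else 0)"
proof -
  have "I \<union> {4..n} = I' \<union> {4..n} \<longleftrightarrow> I = I'" if "I' \<subseteq> {1, 2, 3}" for I'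
  proof
    assume eq: "I \<union> {4..n} = I' \<union> {4..n}"
    have "I = (I \<union> {4..n}) \<inter> {1, 2, 3}" using assms by auto
    also have "\<dots> = I'" using that unfolding eq by auto
    finally show "I = I'" .
  qed simp
  from this[of "{}"] this[of "{1, 2}"] show ?thesis by (simp add: restr_def frame_spinor_def)
qed

text \<open>Contraction by e_1 and multiplication by \<open>a\<close> e_2 give the same multiple of
  e_2 e_4 ... e_n, so they cancel in the first frame vector; the second works likewise. The others
  contract by the missing e_3 or repeat a factor.\<close>

lemma frame_spinor_Spin:
  assumes n: "3 \<le> n"
  shows "frame_spinor a \<in> Spin (frame_space a 6)"
  unfolding frame_space_def
proof (rule Spin_span)
  let ?s = "frame_spinor a"
  have E_odd: "cliff (E (2 * i - 1)) ?s J = (if i \<in> J then sign_below i J * ?s (J - {i}) else 0)"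
    and E_even: "cliff (E (2 * i)) ?s J = (if i \<in> J then 0 else sign_below i J * ?s (insert i J))"
    if "1 \<le> i" "i \<le> n" for i J
    using cliff_basis[of i ?s J] that by auto
  have above: "sign_below i (I \<union> {4..n}) = (sign_below i I :: 'k)" if "i \<le> 3" for i I
    using that by (intro sign_below_union_above) auto
  have E1: "cliff (E 1) ?s J = (if J = insert 1 {4..n} then 1 else 0)" for J
  proof -
    have "1 \<in> J \<Longrightarrow> J - {1} = {4..n} \<longleftrightarrow> J = insert 1 {4..n}" by (rule Diff_singleton_eq_iff) auto
    moreover have "J - {1} \<noteq> {1, 2} \<union> {4..n}" by (rule set_neqI'[of 1]) auto
    ultimately show ?thesis using E_odd[of 1 J] above[of 1 "{1}"] n
      by (auto simp: frame_spinor_def sign_below_insert sign_below_empty One_nat_def[symmetric])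
  qed
  have E2: "cliff (E 2) ?s J = (if J = insert 2 {4..n} then a else 0)" for J
  proof -
    have "1 \<notin> J \<Longrightarrow> insert 1 J = {1, 2} \<union> {4..n} \<longleftrightarrow> J = insert 2 {4..n}"
      using insert_ident[of 1 J "insert 2 {4..n}"] by simp
    moreover have "insert 1 J \<noteq> {4..n}" by (rule set_neqI[of 1]) auto
    ultimately show ?thesis using E_even[of 1 J] above[of 1 "{2}"] n
      by (auto simp: frame_spinor_def sign_below_insert sign_below_empty)
  qed
  have E3: "cliff (E 3) ?s J = (if J = insert 2 {4..n} then 1 else 0)" for J
  proof -
    have "2 \<in> J \<Longrightarrow> J - {2} = {4..n} \<longleftrightarrow> J = insert 2 {4..n}" by (rule Diff_singleton_eq_iff) auto
    moreover have "J - {2} \<noteq> {1, 2} \<union> {4..n}" by (rule set_neqI'[of 2]) auto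
    ultimately show ?thesis using E_odd[of 2 J] above[of 2 "{2}"] n
      by (auto simp: frame_spinor_def sign_below_insert sign_below_empty)
  qed
  have E4: "cliff (E 4) ?s J = (if J = insert 1 {4..n} then - a else 0)" for J
  proof -
    have "2 \<notin> J \<Longrightarrow> insert 2 J = {1, 2} \<union> {4..n} \<longleftrightarrow> J = insert 1 {4..n}"
      using insert_ident[of 2 J "insert 1 {4..n}"] by (simp add: insert_commute)
    moreover have "insert 2 J \<noteq> {4..n}" by (rule set_neqI[of 2]) auto
    ultimately show ?thesis using E_even[of 2 J] above[of 2 "{1}"] n
      by (auto simp: frame_spinor_def sign_below_insert sign_below_empty)
  qed
  have E6: "cliff (E 6) ?s J = 0" for J
  proof -
    have "insert 3 J \<noteq> {1, 2} \<union> {4..n}" "insert 3 J \<noteq> {4..n}" by (rule set_neqI[of 3], simp, simp)+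
    then show ?thesis using E_even[of 3 J] n by (auto simp: frame_spinor_def)
  qed
  have E_high: "cliff (E (2 * i - 1)) ?s J = 0" if "4 \<le> i" "i \<le> n" for i J
  proof -
    have "J - {i} \<noteq> {1, 2} \<union> {4..n}" "J - {i} \<noteq> {4..n}" using that by (simp_all add: set_neqI'[of i])
    then show ?thesis using E_odd[of i J] that by (auto simp: frame_spinor_def)
  qed
  have "cliff (frame a 6 i) ?s = 0" if "i \<in> {1..n}" for i
  proof
    fix J
    show "cliff (frame a 6 i) ?s J = 0 J"
      by (cases rule: frame_index_cases[OF that])
        (use that in \<open>auto simp: frame_def cliff_diff_vector cliff_add_vector cliff_scale_vector smul_def
          E1 E2 E3 E4 E6 E_high\<close>)
  qed
  then show "?s \<in> Spin (frame a 6 ` {1..n})" by (auto simp: Spin_def)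
qed

text \<open>\<open>E 5\<close> is singular, and the remaining frame vectors are orthogonal to it and
  annihilate the frame spinor, so they anticommute past \<open>E 5\<close>.\<close>

lemma cliff_frame_spinor_Spin:
  assumes n: "3 \<le> n"
  shows "cliff (E 5) (frame_spinor a) \<in> Spin (frame_space a 5)"
  unfolding frame_space_def
proof (rule Spin_span)
  have "cliff (frame a 5 i) (cliff (E 5) (frame_spinor a)) = 0" if i: "i \<in> {1..n}" for i
  proof (cases "i = 3")
    case True
    then show ?thesis using n by (simp add: frame_def cliff_singular quad_form_basis)
  next
    case False
    then have eq: "frame a 5 i = frame a 6 i" by (simp add: frame_def)
    have "5 \<noteq> 2 * i" by presburger
    then have "polar (E 5) (frame a 6 i) = 0"
      using n False i by (simp add: polar_frame co_E)
    moreover have "cliff (frame a 6 i) (frame_spinor a) = 0"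
      using frame_spinor_Spin[OF n] frame_in_space[OF i] by (auto simp: Spin_def)
    ultimately show ?thesis
      unfolding eq using polar_sym by (simp add: cliff_anticommute)
  qed
  then show "cliff (E 5) (frame_spinor a) \<in> Spin (frame a 5 ` {1..n})" by (auto simp: Spin_def)
qed

lemma restr_cliff_frame_spinor:
  assumes n: "3 \<le> n" and I: "I \<subseteq> {1, 2, 3}"
  shows "restr (cliff (E 5) (frame_spinor a)) I = (if I = {3} then 1 else if I = {1, 2, 3} then a else 0)"
proof -
  have "restr (cliff (E 5) (frame_spinor a)) I =
      (if 3 \<in> I then sign_below 3 I * restr (frame_spinor a) (I - {3}) else 0)"
  proof -
    have "sign_below 3 (I \<union> {4..n}) = (sign_below 3 I :: 'k)" by (rule sign_below_union_above) auto
    moreover have "I \<union> {4..n} - {3} = (I - {3}) \<union> {4..n}" by auto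
    ultimately show ?thesis
      using cliff_basis(1)[of 3 "frame_spinor a" "I \<union> {4..n}"] n by (simp add: restr_def)
  qed
  also have "\<dots> = (if I = {3} then 1 else if I = {1, 2, 3} then a else 0)"
  proof (cases "3 \<in> I")
    case True
    have "I - {3} = {} \<longleftrightarrow> I = {3}" "I - {3} = {1, 2} \<longleftrightarrow> I = {1, 2, 3}"
      using Diff_singleton_eq_iff[OF True, of "{}"] Diff_singleton_eq_iff[OF True, of "{1, 2}"]
      by (simp_all add: insert_commute)
    moreover have "I - {3} \<subseteq> {1, 2, 3}" using I by auto
    ultimately show ?thesis
      using True by (auto simp: restr_frame_spinor sign_below_insert sign_below_empty)
  qed auto
  finally show ?thesis .
qed

definition spin_incident :: "'k set \<Rightarrow> 'v set \<Rightarrow> 'v set \<Rightarrow> bool" where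
  "spin_incident K0 X Y \<longleftrightarrow>
     (\<forall>f s t. left_linear K0 f \<longrightarrow> s \<in> Spin X \<longrightarrow> t \<in> Spin Y \<longrightarrow> pairing (f \<circ> s) t = 0)"

text \<open>Without \<open>f\<close> the pairing consists of the terms \<open>a\<close> and
  \<open>- a\<close>; since \<open>f\<close> maps 1 to 0 and \<open>a\<close> to 1, the sum becomes
  \<open>- 1\<close>. Both orders occur because either space may be the one of type
  \<open>Plus\<close>.\<close>

lemma not_spin_incident_frame_space:
  assumes n: "3 \<le> n" and f: "left_linear K0 f" "f 1 = 0" "f a = 1"
  shows "\<not> spin_incident K0 (frame_space a 6) (frame_space a 5)"
    and "\<not> spin_incident K0 (frame_space a 5) (frame_space a 6)"
proof -
  let ?s = "frame_spinor a" let ?t = "cliff (E 5) ?s"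
  have r: "restr (f \<circ> u) I = f (restr u I)" for u I by (simp add: restr_def)
  have "{1::nat, 2, 3} \<noteq> {3}" "{1::nat, 2, 3} \<noteq> {1, 2}"
    "{1::nat, 3} \<noteq> {1, 2}" "{1::nat, 3} \<noteq> {3}" "{1::nat, 3} \<noteq> {1, 2, 3}"
    "{2::nat, 3} \<noteq> {1, 2}" "{2::nat, 3} \<noteq> {3}" "{2::nat, 3} \<noteq> {1, 2, 3}"
    "{1::nat, 2} \<noteq> {3}" "{1::nat, 2} \<noteq> {1, 2, 3}"
    "{1::nat} \<noteq> {1, 2}" "{1::nat} \<noteq> {3}" "{1::nat} \<noteq> {1, 2, 3}"
    "{2::nat} \<noteq> {1, 2}" "{2::nat} \<noteq> {3}" "{2::nat} \<noteq> {1, 2, 3}"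
    "{3::nat} \<noteq> {1, 2}" "{3::nat} \<noteq> {1, 2, 3}"
    by (rule set_neqI[of 3] set_neqI[of 1] set_neqI[of 2] set_neqI'[of 1] set_neqI'[of 2] set_neqI'[of 3]; simp; fail)+
  note eval = this r restr_frame_spinor restr_cliff_frame_spinor[OF n] left_linear_0[OF f(1)] f(2,3)
  have "pairing (f \<circ> ?s) ?t = - 1" "pairing (f \<circ> ?t) ?s = - 1"
    unfolding pairing_def by (simp_all add: eval)
  then show "\<not> spin_incident K0 (frame_space a 6) (frame_space a 5)"
    "\<not> spin_incident K0 (frame_space a 5) (frame_space a 6)"
    using frame_spinor_Spin[OF n, of a] cliff_frame_spinor_Spin[OF n, of a] f(1)
    unfolding spin_incident_def by (metis neg_equal_0_iff_equal one_neq_zero)+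
qed

end

section \<open>Flags of type {+,-}\<close>

context oriented_quadric
begin

text \<open>\<open>X\<close> may coincide with \<open>X1\<close> or \<open>X2\<close>; the zero
  spinor is then the other summand.\<close>

lemma Spin_pencil_D:
  assumes L: "L \<in> elements G" "type_of G L = Node (n - 2)"
    and X: "X1 \<in> pencil G t L" "X2 \<in> pencil G t L" "X \<in> pencil G t L" "X1 \<noteq> X2" and t: "t = Plus \<or> t = Minus"
    and s: "s \<in> Spin X"
  obtains s1 s2 where "s1 \<in> Spin X1" "s2 \<in> Spin X2" "s = s1 + s2"
proof -
  have zero: "0 \<in> Spin Y" for Y by (simp add: Spin_def)
  consider "X = X1" | "X = X2" | "X \<noteq> X1" "X \<noteq> X2" by blast
  then show ?thesis
  proof cases
    case 1
    then show ?thesis using that[of s 0] s zero by simp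
  next
    case 2
    then show ?thesis using that[of 0 s] s zero by simp
  next
    case 3
    show ?thesis
    proof (rule Spin_pencil[of X X1 X2 L s])
      show "X1 \<inter> X2 = L" "X1 \<in> max_singular E n" "X2 \<in> max_singular E n"
        using pencil_class_Int[OF L X(1,2,4) t] by auto
      show "X \<inter> X2 = L" "X \<in> max_singular E n" using pencil_class_Int[OF L X(3,2) 3(2) t] by auto
      show "L \<subseteq> X" by (rule pencil_subset[OF L X(3) t])
      show "subspace L" "dim L = n - 2" using node_element[OF L] by auto
      show "2 \<le> n" using n_ge_3 by simp
    qed (use s that in auto)
  qed
qed

text \<open>Both types have \<open>Node (n - 2)\<close> as neighbour, so each member of the flag
  varies in the pencil of an \<open>(n - 2)\<close>-space. Splitting a spinor along the pencil turns
  closure under lines into additivity of \<open>pairing\<close> in each argument.\<close>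

lemma not_rationally_generated_Plus_Minus:
  assumes K0: "sub_division_ring K0" "K0 \<noteq> UNIV"
  shows "\<not> rationally_generated E (2 * n) K0 G {Plus, Minus}"
proof -
  have sub: "gr_subspace G {Plus, Minus} (related_points G {Plus, Minus} Plus Minus (spin_incident K0))"
  proof (rule gr_subspace_related_points[where s' = "Node (n - 2)" and t' = "Node (n - 2)"])
    show "X = Y" if "flag G F" "X \<in> F" "Y \<in> F" "type_of G X = type_of G Y" for F X Y
      by (rule flag_type_inj_D[OF that])
  next
    fix L Y X1 X2 X
    assume *: "L \<in> elements G" "type_of G L = Node (n - 2)" "Y \<in> elements G" "type_of G Y = Minus"
      "X1 \<in> pencil G Plus L" "X2 \<in> pencil G Plus L" "X \<in> pencil G Plus L" "X1 \<noteq> X2"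
      "spin_incident K0 X1 Y" "spin_incident K0 X2 Y"
    show "spin_incident K0 X Y"
      unfolding spin_incident_def
    proof (intro allI impI)
      fix f s t assume f: "left_linear K0 f" and "s \<in> Spin X" and t: "t \<in> Spin Y"
      then obtain s1 s2 where s: "s1 \<in> Spin X1" "s2 \<in> Spin X2" "s = s1 + s2"
        using Spin_pencil_D[OF *(1,2,5-8)] by blast
      have "f \<circ> s = (f \<circ> s1) + (f \<circ> s2)" using s(3) left_linear_add[OF f] by auto
      then show "pairing (f \<circ> s) t = 0"
        using *(9,10) f s t by (simp add: pairing_add_left spin_incident_def)
    qed
  next
    fix L X Y1 Y2 Y
    assume *: "L \<in> elements G" "type_of G L = Node (n - 2)" "X \<in> elements G" "type_of G X = Plus"
      "Y1 \<in> pencil G Minus L" "Y2 \<in> pencil G Minus L" "Y \<in> pencil G Minus L" "Y1 \<noteq> Y2"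
      "spin_incident K0 X Y1" "spin_incident K0 X Y2"
    show "spin_incident K0 X Y"
      unfolding spin_incident_def
    proof (intro allI impI)
      fix f s t assume f: "left_linear K0 f" and s: "s \<in> Spin X" and "t \<in> Spin Y"
      then obtain t1 t2 where "t1 \<in> Spin Y1" "t2 \<in> Spin Y2" "t = t1 + t2"
        using Spin_pencil_D[OF *(1,2,5-8)] by blast
      then show "pairing (f \<circ> s) t = 0"
        using *(9,10) f s by (simp add: pairing_add_right spin_incident_def)
    qed
  qed (auto simp: fr_D)
  have rat: "spin_incident K0 X Y"
    if "P \<in> rational_points E (2 * n) K0 G {Plus, Minus}" "X \<in> P" "Y \<in> P" "type_of G X = Plus" "type_of G Y = Minus"
    for P X Y
    unfolding spin_incident_def
  proof (intro allI impI)
    fix f s t assume f: "left_linear K0 f" and s: "s \<in> Spin X" and t: "t \<in> Spin Y"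
    have F: "flag G P" using that by (auto simp: rational_points_def gr_points_def flags_of_type_def)
    have XY: "X \<in> Sp" "Y \<in> Sm" using that by (simp_all add: type_D_Plus type_D_Minus)
    have "X \<noteq> Y" using that by auto
    then have "incident G X Y" using flag_incident[OF F that(2,3)] by simp
    then have "dim (X \<inter> Y) = n - 1" using XY by (simp add: incident_D)
    moreover have "rational_subspace E (2 * n) K0 X" using that by (auto simp: rational_points_def)
    \<comment> \<open>By rationality \<open>f \<circ> s\<close> is again a spinor of
      \<open>X\<close>, so \<open>pairing_incident\<close> applies to it.\<close>
    ultimately show "pairing (f \<circ> s) t = 0"
      using pairing_incident[OF n_ge_3 class_max(1)[OF XY(1)] class_max(2)[OF XY(2)]]
        Spin_rational[OF K0(1) f _ s] t by blast
  qed
  obtain a where "a \<notin> K0" using K0 by auto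
  then obtain f where f: "left_linear K0 f" "f 1 = 0" "f a = 1"
    using exists_left_linear_separating[OF K0(1)] by blast
  obtain m m' where mm': "{m, m'} = {5, 6}" "frame_space a m \<in> Sp" "frame_space a m' \<in> Sm"
    "dim (frame_space a m \<inter> frame_space a m') = n - 1" by (rule frame_spaces_oriented)
  have "m = 6 \<and> m' = 5 \<or> m = 5 \<and> m' = 6" using mm'(1) by (auto simp: doubleton_eq_iff)
  then have not_R: "\<not> spin_incident K0 (frame_space a m) (frame_space a m')"
    using not_spin_incident_frame_space[OF n_ge_3 f] by auto
  have ty: "type_of G (frame_space a m) = Plus" "type_of G (frame_space a m') = Minus"
    using mm' by (simp_all add: type_D_Plus type_D_Minus)
  have P: "{frame_space a m, frame_space a m'} \<in> gr_points G {Plus, Minus}"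
    using mm' ty
    by (auto simp: gr_points_def flags_of_type_def flag_def pairwise_def elements_D incident_D Int_commute)
  show ?thesis
    by (rule not_rationally_generatedI[OF sub rat P _ _ ty not_R]) auto
qed

end

theorem theorem1p1:
  fixes scale :: "'v::ab_group_add \<Rightarrow> 'k::division_ring \<Rightarrow> 'v"
    and E :: "nat \<Rightarrow> 'v" and n :: nat and K0 :: "'k set"
  assumes "right_vector_space scale"
    and "sub_division_ring K0" and "K0 \<noteq> UNIV"
  shows
    "(right_vector_space.indexed_basis scale E (n + 1) \<longrightarrow>
        (3 \<le> n \<longrightarrow> \<not> right_vector_space.rationally_generated scale E (n + 1) K0
           (right_vector_space.A_building scale n) {1, n})) \<and>
     ((\<forall>x y :: 'k. x * y = y * x) \<and> right_vector_space.indexed_basis scale E (2 * n) \<longrightarrow>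
        (\<forall>M \<in> right_vector_space.max_singular scale E n.
          (3 \<le> n \<longrightarrow> \<not> right_vector_space.rationally_generated scale E (2 * n) K0
             (right_vector_space.D_building scale E n M) {Plus, Minus}) \<and>
          (4 \<le> n \<longrightarrow> \<not> right_vector_space.rationally_generated scale E (2 * n) K0
             (right_vector_space.D_building scale E n M) {Node 1, Plus, Minus}) \<and>
          (4 \<le> n \<longrightarrow> \<not> right_vector_space.rationally_generated scale E (2 * n) K0
             (right_vector_space.D_building scale E n M) {Node 1, Minus})))"
proof (intro conjI impI ballI)
  show "\<not> right_vector_space.rationally_generated scale E (n + 1) K0 (right_vector_space.A_building scale n) {1, n}"
    if "right_vector_space.indexed_basis scale E (n + 1)" "3 \<le> n"
    using A_not_rationally_generated[OF assms(1) that(1) assms(2,3) that(2)] .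
next
  fix M
  assume basis: "(\<forall>x y :: 'k. x * y = y * x) \<and> right_vector_space.indexed_basis scale E (2 * n)"
    and M: "M \<in> right_vector_space.max_singular scale E n"
  have oriented: "oriented_quadric scale E n M" if "3 \<le> n"
    using assms(1) basis M that
    by (simp add: oriented_quadric_def oriented_quadric_axioms_def hyperbolic_quadric_def
        hyperbolic_quadric_axioms_def fin_dim_rvs_def fin_dim_rvs_axioms_def)
  show "\<not> right_vector_space.rationally_generated scale E (2 * n) K0
      (right_vector_space.D_building scale E n M) {Plus, Minus}" if "3 \<le> n"
    using oriented_quadric.not_rationally_generated_Plus_Minus[OF oriented[OF that] assms(2,3)] .
  show "\<not> right_vector_space.rationally_generated scale E (2 * n) K0
      (right_vector_space.D_building scale E n M) {Node 1, Plus, Minus}" if "4 \<le> n"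
    by (rule oriented_quadric.not_rationally_generated_Node1_Minus[OF oriented assms(2,3)]) (use that in auto)
  show "\<not> right_vector_space.rationally_generated scale E (2 * n) K0
      (right_vector_space.D_building scale E n M) {Node 1, Minus}" if "4 \<le> n"
    by (rule oriented_quadric.not_rationally_generated_Node1_Minus[OF oriented assms(2,3)]) (use that in auto)
qed

end
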